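(* Let $M$ be a Kähler manifold (with real analytic metric), let $N\subset M$ be a totally geodesic complex submanifold, endowed with the induced Kähler structure, and let $p\in N$. Then the restriction of the Kähler normal coordinates $\mathrm{knc}_p:T_pM\to M$ of $M$ centered in $p$ to the vector subspace $T_pN\subset T_pM$ are the Kähler normal coordinates of the Kähler manifold $N$ centered in $p$ (as germs at $0$).
   Context: A Kähler manifold is a smooth manifold $M$ with a Riemannian metric $g$ and an orthogonal almost complex structure $I$ with $\nabla I=0$ for the Levi-Civita connection $\nabla$; $\omega(X,Y)=g(IX,Y)$. A local potential is a real function $\theta^{\mathrm{loc}}$ on an open set with $\omega=\frac i2\partial\overline\partial\theta^{\mathrm{loc}}$. $\mathrm{Sym}^{\kappa,\overline\kappa}T_p^*M$ is the space of complex valued polynomials $\eta$ on $T_pM$, homogeneous of degree $\kappa+\overline\kappa$, with $\frac d{dt}|_0\eta(X+tI_pX)=i(\kappa-\overline\kappa)\eta(X)$. $\overline{\mathrm{Sym}}^{\ge(2,2)}T_p^*M$ is the space of real formal power series on $T_pM$ all of whose bihomogeneous components have $\kappa,\overline\kappa\ge2$. Anchored coordinates centered in $p$ are a smooth map $\varphi$ from a neighborhood of $0\in T_pM$ to $M$, diffeomorphic onto a neighborhood of $p$, with $\varphi(0)=p$ and differential $\mathrm{id}_{T_pM}$ at $0$. Kähler normal coordinates (Bochner): there are unique (as germs) anchored coordinates $\mathrm{knc}_p$ centered in $p$, holomorphic with respect to $I_p$ on $T_pM$ and $I$ on $M$, and a unique local potential $\theta_p^{\mathrm{loc}}$ near $p$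 such that the Taylor series $\theta_p$ of $\theta_p^{\mathrm{loc}}\circ\mathrm{knc}_p$ in $0$ satisfies $\theta_p(X)\equiv g_p(X,X)$ modulo $\overline{\mathrm{Sym}}^{\ge(2,2)}T_p^*M$. *)

theory Defs
  imports "HOL-Analysis.Analysis"
begin

section \<open>Calculus on open subsets of a linear subspace\<close>

text \<open>
  Manifolds are modelled on a linear subspace \<open>E\<close> of a Euclidean space, so that a manifold and its
  submanifolds (of every dimension, including \<open>0\<close>) can be modelled inside the same type.
  Below, \<open>U\<close> is always an open subset of \<open>E\<close> and only directions in \<open>E\<close> matter.
\<close>

definition dir_deriv :: "('e::real_normed_vector \<Rightarrow> 'f::real_normed_vector) \<Rightarrow> 'e \<Rightarrow> 'e \<Rightarrow> 'f" where
  "dir_deriv f u x = vector_derivative (\<lambda>t. f (x + t *\<^sub>R u)) (at 0)"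

text \<open>The derivative within \<open>U\<close> is determined on \<open>E\<close> only; its values off \<open>E\<close> are not used.\<close>

primrec Ck_on :: "nat \<Rightarrow> 'e::real_normed_vector set \<Rightarrow> 'e set \<Rightarrow> ('e \<Rightarrow> 'f::real_normed_vector) \<Rightarrow> bool" where
  "Ck_on 0 E U f \<longleftrightarrow> continuous_on U f"
| "Ck_on (Suc k) E U f \<longleftrightarrow>
     (\<exists>f'. (\<forall>x\<in>U. (f has_derivative f' x) (at x within U)) \<and> (\<forall>v\<in>E. Ck_on k E U (\<lambda>x. f' x v)))"

definition smooth_on :: "'e::real_normed_vector set \<Rightarrow> 'e set \<Rightarrow> ('e \<Rightarrow> 'f::real_normed_vector) \<Rightarrow> bool" where
  "smooth_on E U f \<longleftrightarrow> (\<forall>k. Ck_on k E U f)"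

text \<open>
  Locally the sum of an (absolutely) convergent power series in the coordinates \<open>h \<bullet> b\<close>;
  the multi-indices are the functions \<open>\<alpha>\<close> from the standard basis to the naturals.
\<close>

definition real_analytic_on :: "'e::euclidean_space set \<Rightarrow> 'e set \<Rightarrow> ('e \<Rightarrow> real) \<Rightarrow> bool" where
  "real_analytic_on E U f \<longleftrightarrow>
     (\<forall>a\<in>U. \<exists>r>0. \<exists>coef. \<forall>h\<in>E. norm h < r \<longrightarrow>
        ((\<lambda>\<alpha>. coef \<alpha> * (\<Prod>b\<in>Basis. (h \<bullet> b) ^ \<alpha> b)) has_sum f (a + h)) (Basis \<rightarrow>\<^sub>E (UNIV :: nat set)))"


section \<open>Smooth manifolds and tangent vectors\<close>

type_synonym ('m, 'e) chart = "'m set \<times> ('m \<Rightarrow> 'e)"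

text \<open>
  A tangent vector is the family of its components in the charts around its base point
  (and \<open>0\<close> at all other charts).
\<close>

type_synonym ('m, 'e) tvec = "('m, 'e) chart \<Rightarrow> 'e"

record ('m, 'e) smooth_structure =
  mtop :: "'m topology"
  model :: "'e set"
  charts :: "('m, 'e) chart set"

definition cpoint :: "('m, 'e) chart \<Rightarrow> 'e \<Rightarrow> 'm" where
  "cpoint c = inv_into (fst c) (snd c)"

definition is_chart :: "('m, 'e::euclidean_space, 'r) smooth_structure_scheme \<Rightarrow> ('m, 'e) chart \<Rightarrow> bool" where
  "is_chart M c \<longleftrightarrow>
     openin (mtop M) (fst c) \<and>
     openin (top_of_set (model M)) (snd c ` fst c) \<and>
     homeomorphic_map (subtopology (mtop M) (fst c)) (top_of_set (snd c ` fst c)) (snd c)"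

definition smooth_transition ::
    "('m, 'e::euclidean_space, 'r) smooth_structure_scheme \<Rightarrow> ('m, 'e) chart \<Rightarrow> ('m, 'e) chart \<Rightarrow> bool" where
  "smooth_transition M c d \<longleftrightarrow> smooth_on (model M) (snd c ` (fst c \<inter> fst d)) (\<lambda>x. snd d (cpoint c x))"

text \<open>\<open>charts M\<close> is the maximal atlas.\<close>

definition smooth_manifold :: "('m, 'e::euclidean_space, 'r) smooth_structure_scheme \<Rightarrow> bool" where
  "smooth_manifold M \<longleftrightarrow>
     subspace (model M) \<and> Hausdorff_space (mtop M) \<and> second_countable (mtop M) \<and>
     (\<Union>c\<in>charts M. fst c) = topspace (mtop M) \<and>
     (\<forall>c\<in>charts M. is_chart M c) \<and>
     (\<forall>c\<in>charts M. \<forall>d\<in>charts M. smooth_transition M c d) \<and>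
     (\<forall>c. is_chart M c \<and> (\<forall>d\<in>charts M. smooth_transition M c d \<and> smooth_transition M d c)
        \<longrightarrow> c \<in> charts M)"

definition charts_at :: "('m, 'e, 'r) smooth_structure_scheme \<Rightarrow> 'm \<Rightarrow> ('m, 'e) chart set" where
  "charts_at M p = {c \<in> charts M. p \<in> fst c}"

definition velocity :: "('m, 'e::euclidean_space, 'r) smooth_structure_scheme \<Rightarrow> (real \<Rightarrow> 'm) \<Rightarrow> ('m, 'e) tvec" where
  "velocity M \<gamma> =
     (\<lambda>c. if c \<in> charts_at M (\<gamma> 0) then vector_derivative (\<lambda>t. snd c (\<gamma> t)) (at 0) else 0)"

definition chart_line :: "('m, 'e::real_vector) chart \<Rightarrow> 'm \<Rightarrow> 'e \<Rightarrow> real \<Rightarrow> 'm" where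
  "chart_line c p u t = cpoint c (snd c p + t *\<^sub>R u)"

text \<open>The tangent vector at \<open>p\<close> with components \<open>u\<close> in the chart \<open>c\<close>.\<close>

definition cvec ::
    "('m, 'e::euclidean_space, 'r) smooth_structure_scheme \<Rightarrow> ('m, 'e) chart \<Rightarrow> 'm \<Rightarrow> 'e \<Rightarrow> ('m, 'e) tvec" where
  "cvec M c p u = velocity M (chart_line c p u)"

text \<open>\<open>X = cvec M c p (X c)\<close> is the transformation law for the components in different charts.\<close>

definition tangent_space :: "('m, 'e::euclidean_space, 'r) smooth_structure_scheme \<Rightarrow> 'm \<Rightarrow> ('m, 'e) tvec set" where
  "tangent_space M p = {X. \<forall>c\<in>charts_at M p. X c \<in> model M \<and> X = cvec M c p (X c)}"

definition tzero :: "('m, 'e::real_vector) tvec" where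
  "tzero = (\<lambda>c. 0)"

definition tscale :: "real \<Rightarrow> ('m, 'e::real_vector) tvec \<Rightarrow> ('m, 'e) tvec" where
  "tscale a X = (\<lambda>c. a *\<^sub>R X c)"

definition tadd :: "('m, 'e::real_vector) tvec \<Rightarrow> ('m, 'e) tvec \<Rightarrow> ('m, 'e) tvec" where
  "tadd X Y = (\<lambda>c. X c + Y c)"


section \<open>Kaehler manifolds\<close>

record ('m, 'e) hermitian_structure = "('m, 'e) smooth_structure" +
  metr :: "'m \<Rightarrow> ('m, 'e) tvec \<Rightarrow> ('m, 'e) tvec \<Rightarrow> real"
  acs :: "'m \<Rightarrow> ('m, 'e) tvec \<Rightarrow> ('m, 'e) tvec"

definition metr_coef ::
    "('m, 'e::euclidean_space, 'r) hermitian_structure_scheme \<Rightarrow> ('m, 'e) chart \<Rightarrow> 'e \<Rightarrow> 'e \<Rightarrow> 'e \<Rightarrow> real" where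
  "metr_coef M c x u w = metr M (cpoint c x) (cvec M c (cpoint c x) u) (cvec M c (cpoint c x) w)"

definition acs_coef ::
    "('m, 'e::euclidean_space, 'r) hermitian_structure_scheme \<Rightarrow> ('m, 'e) chart \<Rightarrow> 'e \<Rightarrow> 'e \<Rightarrow> 'e" where
  "acs_coef M c x u = acs M (cpoint c x) (cvec M c (cpoint c x) u) c"

definition riemannian_metric :: "('m, 'e::euclidean_space, 'r) hermitian_structure_scheme \<Rightarrow> bool" where
  "riemannian_metric M \<longleftrightarrow>
     (\<forall>q\<in>topspace (mtop M). \<forall>X\<in>tangent_space M q.
        (\<forall>Y\<in>tangent_space M q. metr M q X Y = metr M q Y X) \<and>
        (\<forall>Y\<in>tangent_space M q. \<forall>Z\<in>tangent_space M q. \<forall>a.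
           metr M q (tadd X (tscale a Y)) Z = metr M q X Z + a * metr M q Y Z) \<and>
        (X \<noteq> tzero \<longrightarrow> metr M q X X > 0)) \<and>
     (\<forall>c\<in>charts M. \<forall>u\<in>model M. \<forall>w\<in>model M.
        smooth_on (model M) (snd c ` fst c) (\<lambda>x. metr_coef M c x u w))"

definition almost_complex_structure :: "('m, 'e::euclidean_space, 'r) hermitian_structure_scheme \<Rightarrow> bool" where
  "almost_complex_structure M \<longleftrightarrow>
     (\<forall>q\<in>topspace (mtop M). \<forall>X\<in>tangent_space M q.
        acs M q X \<in> tangent_space M q \<and>
        acs M q (acs M q X) = tscale (-1) X \<and>
        (\<forall>Y\<in>tangent_space M q. \<forall>a.
           acs M q (tadd X (tscale a Y)) = tadd (acs M q X) (tscale a (acs M q Y)))) \<and>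
     (\<forall>c\<in>charts M. \<forall>u\<in>model M. smooth_on (model M) (snd c ` fst c) (\<lambda>x. acs_coef M c x u))"

text \<open>
  The Levi-Civita connection in the chart \<open>c\<close>: \<open>christoffel M c x u w\<close> is \<open>\<nabla>\<^sub>u w\<close> at \<open>x\<close> for constant
  fields \<open>u, w\<close>, as given by the Koszul formula.
\<close>

definition christoffel ::
    "('m, 'e::euclidean_space, 'r) hermitian_structure_scheme \<Rightarrow> ('m, 'e) chart \<Rightarrow> 'e \<Rightarrow> 'e \<Rightarrow> 'e \<Rightarrow> 'e" where
  "christoffel M c x u w =
     (THE y. y \<in> model M \<and> (\<forall>z\<in>model M.
        metr_coef M c x y z =
          (dir_deriv (\<lambda>x. metr_coef M c x w z) u x
         + dir_deriv (\<lambda>x. metr_coef M c x u z) w x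
         - dir_deriv (\<lambda>x. metr_coef M c x u w) z x) / 2))"

text \<open>
  Covariant derivative in the direction \<open>u\<close> of a vector field \<open>Y\<close> along a map \<open>f\<close> into the chart \<open>c\<close>
  (both given in coordinates); for vector fields on the manifold itself \<open>f\<close> is the identity.
\<close>

definition cov_deriv_along ::
    "('m, 'e::euclidean_space, 'r) hermitian_structure_scheme \<Rightarrow> ('m, 'e) chart
      \<Rightarrow> ('e \<Rightarrow> 'e) \<Rightarrow> ('e \<Rightarrow> 'e) \<Rightarrow> 'e \<Rightarrow> 'e \<Rightarrow> 'e" where
  "cov_deriv_along M c f Y u y = dir_deriv Y u y + christoffel M c (f y) (dir_deriv f u y) (Y y)"

definition parallel_acs :: "('m, 'e::euclidean_space, 'r) hermitian_structure_scheme \<Rightarrow> bool" where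
  "parallel_acs M \<longleftrightarrow>
     (\<forall>c\<in>charts M. \<forall>x\<in>snd c ` fst c. \<forall>u\<in>model M. \<forall>w\<in>model M.
        cov_deriv_along M c (\<lambda>y. y) (\<lambda>y. acs_coef M c y w) u x
          = acs_coef M c x (cov_deriv_along M c (\<lambda>y. y) (\<lambda>y. w) u x))"

definition kaehler_manifold :: "('m, 'e::euclidean_space, 'r) hermitian_structure_scheme \<Rightarrow> bool" where
  "kaehler_manifold M \<longleftrightarrow>
     smooth_manifold M \<and> riemannian_metric M \<and> almost_complex_structure M \<and>
     (\<forall>q\<in>topspace (mtop M). \<forall>X\<in>tangent_space M q. \<forall>Y\<in>tangent_space M q.
        metr M q (acs M q X) (acs M q Y) = metr M q X Y) \<and>
     parallel_acs M"

text \<open>A chart is holomorphic iff the complex structure is constant in its coordinates.\<close>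

definition holomorphic_chart ::
    "('m, 'e::euclidean_space, 'r) hermitian_structure_scheme \<Rightarrow> ('m, 'e) chart \<Rightarrow> bool" where
  "holomorphic_chart M c \<longleftrightarrow> c \<in> charts M \<and>
     (\<forall>x\<in>snd c ` fst c. \<forall>y\<in>snd c ` fst c. \<forall>u\<in>model M. acs_coef M c x u = acs_coef M c y u)"

text \<open>
  Analyticity refers to the real analytic structure underlying the complex manifold, whose atlas
  consists of the holomorphic charts (which cover \<open>M\<close> by the Newlander-Nirenberg theorem).
\<close>

definition real_analytic_metric :: "('m, 'e::euclidean_space, 'r) hermitian_structure_scheme \<Rightarrow> bool" where
  "real_analytic_metric M \<longleftrightarrow>
     (\<forall>c. holomorphic_chart M c \<longrightarrow>
        (\<forall>u\<in>model M. \<forall>w\<in>model M.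
           real_analytic_on (model M) (snd c ` fst c) (\<lambda>x. metr_coef M c x u w)))"


section \<open>Local potentials\<close>

text \<open>
  The defining equation is \<open>\<omega> = (i/2) \<partial> dbar \<theta>\<close> with \<open>\<omega>(u,w) = g(Iu,w)\<close>; on a complex manifold
  \<open>\<partial> dbar f = d(dbar f)\<close>. In a chart: \<open>dbar\<close> is the (0,1)-part of \<open>df\<close>;
  \<open>d_one_form\<close> is the exterior derivative of a 1-form,
  \<open>d\<beta>(u,w) = D\<^sub>u(\<beta>(w)) - D\<^sub>w(\<beta>(u))\<close> for constant fields; \<open>del_dbar\<close> is the (1,1)-part of \<open>d(dbar f)\<close>.
\<close>

definition dbar ::
    "('m, 'e::euclidean_space, 'r) hermitian_structure_scheme \<Rightarrow> ('m, 'e) chart \<Rightarrow> ('e \<Rightarrow> real) \<Rightarrow> 'e \<Rightarrow> 'e \<Rightarrow> complex" where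
  "dbar M c f x w =
     (complex_of_real (dir_deriv f w x) + \<i> * complex_of_real (dir_deriv f (acs_coef M c x w) x)) / 2"

definition d_one_form :: "('e::real_normed_vector \<Rightarrow> 'e \<Rightarrow> complex) \<Rightarrow> 'e \<Rightarrow> 'e \<Rightarrow> 'e \<Rightarrow> complex" where
  "d_one_form \<beta> x u w = dir_deriv (\<lambda>y. \<beta> y w) u x - dir_deriv (\<lambda>y. \<beta> y u) w x"

definition del_dbar ::
    "('m, 'e::euclidean_space, 'r) hermitian_structure_scheme \<Rightarrow> ('m, 'e) chart \<Rightarrow> ('e \<Rightarrow> real) \<Rightarrow> 'e \<Rightarrow> 'e \<Rightarrow> 'e \<Rightarrow> complex" where
  "del_dbar M c f x u w =
     (d_one_form (dbar M c f) x u w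
       + d_one_form (dbar M c f) x (acs_coef M c x u) (acs_coef M c x w)) / 2"

definition local_potential ::
    "('m, 'e::euclidean_space, 'r) hermitian_structure_scheme \<Rightarrow> 'm set \<Rightarrow> ('m \<Rightarrow> real) \<Rightarrow> bool" where
  "local_potential M V \<theta> \<longleftrightarrow> openin (mtop M) V \<and>
     (\<forall>c\<in>charts M.
        smooth_on (model M) (snd c ` (fst c \<inter> V)) (\<lambda>x. \<theta> (cpoint c x)) \<and>
        (\<forall>x\<in>snd c ` (fst c \<inter> V). \<forall>u\<in>model M. \<forall>w\<in>model M.
           complex_of_real (metr_coef M c x (acs_coef M c x u) w)
             = \<i> / 2 * del_dbar M c (\<lambda>x. \<theta> (cpoint c x)) x u w))"


section \<open>Polynomials and formal power series on a tangent space\<close>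

definition homogeneous_poly ::
    "('m, 'e::euclidean_space, 'r) smooth_structure_scheme \<Rightarrow> 'm \<Rightarrow> nat \<Rightarrow> (('m, 'e) tvec \<Rightarrow> complex) \<Rightarrow> bool" where
  "homogeneous_poly M p n \<eta> \<longleftrightarrow>
     (\<forall>c\<in>charts_at M p. \<exists>P. polynomial_function P \<and> (\<forall>X\<in>tangent_space M p. \<eta> X = P (X c))) \<and>
     (\<forall>X\<in>tangent_space M p. \<forall>t. \<eta> (tscale t X) = complex_of_real (t ^ n) * \<eta> X)"

definition Sym_bi ::
    "('m, 'e::euclidean_space, 'r) hermitian_structure_scheme \<Rightarrow> 'm \<Rightarrow> nat \<Rightarrow> nat \<Rightarrow> (('m, 'e) tvec \<Rightarrow> complex) set" where
  "Sym_bi M p \<kappa> \<kappa>' = {\<eta>. homogeneous_poly M p (\<kappa> + \<kappa>') \<eta> \<and>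
     (\<forall>X\<in>tangent_space M p.
        ((\<lambda>t. \<eta> (tadd X (tscale t (acs M p X)))) has_vector_derivative
           \<i> * (of_nat \<kappa> - of_nat \<kappa>') * \<eta> X) (at 0))}"

text \<open>A formal power series is the sequence of its homogeneous components.\<close>

definition Sym_ge22 ::
    "('m, 'e::euclidean_space, 'r) hermitian_structure_scheme \<Rightarrow> 'm \<Rightarrow> (nat \<Rightarrow> ('m, 'e) tvec \<Rightarrow> real) set" where
  "Sym_ge22 M p = {\<eta>. \<exists>\<zeta>.
     (\<forall>\<kappa> \<kappa>'. \<zeta> \<kappa> \<kappa>' \<in> Sym_bi M p \<kappa> \<kappa>') \<and>
     (\<forall>n. \<forall>X\<in>tangent_space M p.
        complex_of_real (\<eta> n X) =
          (\<Sum>(\<kappa>, \<kappa>')\<in>{(\<kappa>, \<kappa>'). \<kappa> + \<kappa>' = n \<and> \<kappa> \<ge> 2 \<and> \<kappa>' \<ge> 2}. \<zeta> \<kappa> \<kappa>' X))}"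

definition taylor_series :: "(('m, 'e::euclidean_space) tvec \<Rightarrow> real) \<Rightarrow> nat \<Rightarrow> ('m, 'e) tvec \<Rightarrow> real" where
  "taylor_series f n X = (deriv ^^ n) (\<lambda>t. f (tscale t X)) 0 / fact n"


section \<open>Kaehler normal coordinates\<close>

text \<open>
  \<open>k\<close> restricts to a diffeomorphism from the open neighborhood \<open>W\<close> of \<open>0\<close> in the tangent space onto
  an open neighborhood of \<open>p\<close>; a chart \<open>c\<close> at \<open>p\<close> provides linear coordinates on the tangent space.
\<close>

definition anchored_coordinates ::
    "('m, 'e::euclidean_space, 'r) smooth_structure_scheme \<Rightarrow> 'm \<Rightarrow> ('m, 'e) tvec set \<Rightarrow> (('m, 'e) tvec \<Rightarrow> 'm) \<Rightarrow> bool" where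
  "anchored_coordinates M p W k \<longleftrightarrow>
     W \<subseteq> tangent_space M p \<and> tzero \<in> W \<and>
     (\<forall>c\<in>charts_at M p. openin (top_of_set (model M)) ((\<lambda>X. X c) ` W)) \<and>
     inj_on k W \<and> openin (mtop M) (k ` W) \<and>
     (\<forall>c\<in>charts_at M p. \<forall>d\<in>charts M.
        openin (top_of_set (model M)) ((\<lambda>X. X c) ` {X \<in> W. k X \<in> fst d}) \<and>
        smooth_on (model M) ((\<lambda>X. X c) ` {X \<in> W. k X \<in> fst d}) (\<lambda>x. snd d (k (cvec M c p x))) \<and>
        smooth_on (model M) (snd d ` (k ` W \<inter> fst d)) (\<lambda>y. inv_into W k (cpoint d y) c)) \<and>
     k tzero = p \<and>
     (\<forall>X\<in>tangent_space M p. velocity M (\<lambda>t. k (tscale t X)) = X)"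

definition holomorphic_coordinates ::
    "('m, 'e::euclidean_space, 'r) hermitian_structure_scheme \<Rightarrow> 'm \<Rightarrow> ('m, 'e) tvec set \<Rightarrow> (('m, 'e) tvec \<Rightarrow> 'm) \<Rightarrow> bool" where
  "holomorphic_coordinates M p W k \<longleftrightarrow>
     (\<forall>X\<in>W. \<forall>Y\<in>tangent_space M p.
        velocity M (\<lambda>t. k (tadd X (tscale t (acs M p Y))))
          = acs M (k X) (velocity M (\<lambda>t. k (tadd X (tscale t Y)))))"

text \<open>
  \<open>k\<close> is a representative of the germ of the Kaehler normal coordinates centered in \<open>p\<close>; its values
  away from \<open>0\<close> are irrelevant.
\<close>

definition kaehler_normal_coordinates ::
    "('m, 'e::euclidean_space, 'r) hermitian_structure_scheme \<Rightarrow> 'm \<Rightarrow> (('m, 'e) tvec \<Rightarrow> 'm) \<Rightarrow> bool" where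
  "kaehler_normal_coordinates M p k \<longleftrightarrow>
     (\<exists>W V \<theta>. anchored_coordinates M p W k \<and> holomorphic_coordinates M p W k \<and>
        local_potential M V \<theta> \<and> p \<in> V \<and>
        (\<lambda>n X. taylor_series (\<lambda>X. \<theta> (k X)) n X - (if n = 2 then metr M p X X else 0)) \<in> Sym_ge22 M p)"


section \<open>Submanifolds\<close>

definition incl_differential ::
    "('m, 'e::euclidean_space, 'r) smooth_structure_scheme \<Rightarrow> ('m, 'e, 's) smooth_structure_scheme
      \<Rightarrow> 'm \<Rightarrow> ('m, 'e) tvec \<Rightarrow> ('m, 'e) tvec" where
  "incl_differential N M q X = (let d = SOME d. d \<in> charts_at N q in velocity M (chart_line d q (X d)))"

text \<open>
  The inclusion is an injective immersion; the topology of \<open>N\<close> may be finer than the subspace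
  topology. Embedded submanifolds are the case \<open>mtop N = subtopology (mtop M) (topspace (mtop N))\<close>.
\<close>

definition submanifold ::
    "('m, 'e::euclidean_space, 'r) smooth_structure_scheme \<Rightarrow> ('m, 'e, 's) smooth_structure_scheme \<Rightarrow> bool" where
  "submanifold N M \<longleftrightarrow> smooth_manifold N \<and>
     topspace (mtop N) \<subseteq> topspace (mtop M) \<and> continuous_map (mtop N) (mtop M) (\<lambda>q. q) \<and>
     (\<forall>d\<in>charts N. \<forall>c\<in>charts M.
        smooth_on (model N) (snd d ` (fst d \<inter> fst c)) (\<lambda>y. snd c (cpoint d y))) \<and>
     (\<forall>q\<in>topspace (mtop N). inj_on (incl_differential N M q) (tangent_space N q))"

definition complex_submanifold ::
    "('m, 'e::euclidean_space, 'r) smooth_structure_scheme \<Rightarrow> ('m, 'e, 's) hermitian_structure_scheme \<Rightarrow> bool" where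
  "complex_submanifold N M \<longleftrightarrow> submanifold N M \<and>
     (\<forall>q\<in>topspace (mtop N). \<forall>X\<in>tangent_space N q.
        acs M q (incl_differential N M q X) \<in> incl_differential N M q ` tangent_space N q)"

text \<open>
  Vanishing second fundamental form: the covariant derivative in \<open>M\<close> of coordinate fields of \<open>N\<close>
  along coordinate fields of \<open>N\<close> is tangent to \<open>N\<close>.
\<close>

definition totally_geodesic ::
    "('m, 'e::euclidean_space, 'r) smooth_structure_scheme \<Rightarrow> ('m, 'e, 's) hermitian_structure_scheme \<Rightarrow> bool" where
  "totally_geodesic N M \<longleftrightarrow>
     (\<forall>d\<in>charts N. \<forall>c\<in>charts M. \<forall>y\<in>snd d ` (fst d \<inter> fst c). \<forall>u\<in>model N. \<forall>w\<in>model N.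
        let f = (\<lambda>y. snd c (cpoint d y)) in
        \<exists>z\<in>model N. cov_deriv_along M c f (dir_deriv f w) u y = dir_deriv f z y)"

definition induced_structure ::
    "('m, 'e::euclidean_space) smooth_structure \<Rightarrow> ('m, 'e) hermitian_structure \<Rightarrow> ('m, 'e) hermitian_structure" where
  "induced_structure N M =
     \<lparr> mtop = mtop N, model = model N, charts = charts N,
       metr = (\<lambda>q X Y. metr M q (incl_differential N M q X) (incl_differential N M q Y)),
       acs = (\<lambda>q X. THE Y. Y \<in> tangent_space N q \<and>
                incl_differential N M q Y = acs M q (incl_differential N M q X)) \<rparr>"

end

theory Submission
  imports Defs "HOL-Complex_Analysis.Cauchy_Integral_Formula"
begin

text \<open>
  In the normal coordinates of \<open>M\<close> the potential satisfies \<open>\<theta> \<equiv> g\<^sub>p\<close> modulo bidegrees \<open>\<ge> (2,2)\<close>, so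
  for a vector \<open>n\<close> at \<open>p\<close> the (0,1)-derivative of \<open>\<theta>\<close> in the direction \<open>n\<close> has the same holomorphic jet
  at \<open>0\<close> as the linear form \<open>h\<^sub>p(_, n)\<close>, with \<open>h\<close> the Hermitian metric; its (1,0)-derivatives are
  \<open>h(_, n)\<close>. Parametrize \<open>N\<close> near \<open>p\<close> by a holomorphic map \<open>F\<close> as a graph over \<open>T\<^sub>pN\<close>, and let \<open>n\<close> be
  orthogonal to \<open>T\<^sub>pN\<close>. Since \<open>N\<close> is totally geodesic and \<open>n\<close> is parallel in the (0,1)-directions, the
  functions \<open>h(dF b, n)\<close> satisfy a homogeneous linear system of differential equations in the
  (1,0)-directions with initial value \<open>0\<close>, so their holomorphic jets at \<open>0\<close> vanish. Hence the jet of
  the holomorphic function \<open>h\<^sub>p(F, n)\<close> vanishes, i.e. \<open>N\<close> is the linear subspace \<open>T\<^sub>pN\<close> in these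
  coordinates. The potential and its Taylor series then restrict to \<open>N\<close>.
\<close>

section \<open>Differentiation in open subsets of a subspace\<close>

text \<open>The normal form of \<theta> constrains only a formal series, so the argument compares
  jets at 0; a jet determines a function only if that function is holomorphic. Hence the single
  function evaluated away from 0 is the complex linear form \<open>h 0 _ n\<close> composed with the
  holomorphic map F, and this only on the complex line through one vector X. All jets are iterated
  derivatives in the (1,0)-direction of that X. Bidegrees are tracked by weights: a term of bidegree
  (a, b) and degree n has weight a - b = n - 2 b, so b \<ge> 2 reads weight \<le> n - 4. A
  (0,1)-derivative turns the defect 4 into 2, (1,0)-derivatives keep it, and a positive defect
  forces the value 0 at the origin. A constant field n is parallel in (0,1)-directions because
  symmetry of \<Gamma> and parallelism of I give \<nabla>_{IY} n = I \<nabla>_Y n, and h is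
  antilinear in its second argument. To show that F is linear, n is taken to be the deviation F x -
  dF_0 x itself: it is orthogonal to the tangent space, and h 0 (F x) n = 0 then makes its length
  zero. The graph chart uses the orthogonal projection because its kernel is I-invariant, which
  makes the complex structure of N constant in that chart.\<close>

abbreviation rel_open :: "'e::euclidean_space set \<Rightarrow> 'e set \<Rightarrow> bool" where
  "rel_open E U \<equiv> subspace E \<and> openin (top_of_set E) U"

lemma rel_open_subset: "rel_open E U \<Longrightarrow> U \<subseteq> E"
  using openin_imp_subset by blast

lemma rel_open_line:
  assumes "rel_open E U" "x \<in> U" "v \<in> E"
  obtains e where "e > 0" "\<And>t. \<bar>t\<bar> < e \<Longrightarrow> x + t *\<^sub>R v \<in> U"
proof -
  obtain T where T: "open T" "U = E \<inter> T"
    using assms(1) by (auto simp: openin_open)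
  have "open ((\<lambda>t. x + t *\<^sub>R v) -` T)"
    by (intro open_vimage T continuous_intros)
  moreover have "0 \<in> (\<lambda>t. x + t *\<^sub>R v) -` T" using assms T by auto
  ultimately obtain e where "e > 0" "ball 0 e \<subseteq> (\<lambda>t. x + t *\<^sub>R v) -` T"
    using open_contains_ball by blast
  moreover have "x + t *\<^sub>R v \<in> E" for t
    using assms rel_open_subset by (blast intro: subspace_add subspace_mul)
  ultimately show ?thesis using T by (intro that[of e]) (auto simp: subset_iff)
qed

text \<open>Many maps below are linear on \<open>E\<close> only. Writing a vector of
  \<open>E\<close> through the coordinates \<open>v \<bullet> b\<close> replaces such a map by a
  finite sum that is bounded linear on the whole type, so that the usual calculus applies to
  it.\<close>

lemma subspace_onb:
  fixes E :: "'e::euclidean_space set"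
  assumes "subspace E"
  obtains B where "finite B" "B \<subseteq> E" "\<And>a b. a \<in> B \<Longrightarrow> b \<in> B \<Longrightarrow> a \<bullet> b = (if a = b then 1 else 0)"
    "\<And>v. v \<in> E \<Longrightarrow> (\<Sum>b\<in>B. (v \<bullet> b) *\<^sub>R b) = v"
proof -
  obtain B where B: "B \<subseteq> E" "pairwise orthogonal B" "\<And>x. x \<in> B \<Longrightarrow> norm x = 1"
    "independent B" "span B = E"
    using orthonormal_basis_subspace[OF assms] by metis
  have fin: "finite B" using B(4) by (rule independent_imp_finite)
  have orth: "a \<bullet> b = (if a = b then 1 else 0)" if "a \<in> B" "b \<in> B" for a b
    using that B(2,3) by (auto simp: pairwise_def orthogonal_def norm_eq_1)
  have "(\<Sum>b\<in>B. (v \<bullet> b) *\<^sub>R b) = v" if "v \<in> E" for v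
  proof -
    have "v \<in> range (\<lambda>u. \<Sum>b\<in>B. u b *\<^sub>R b)"
      using that unfolding B(5)[symmetric] span_finite[OF fin] .
    then obtain u where u: "v = (\<Sum>b\<in>B. u b *\<^sub>R b)" by (rule rangeE)
    have "v \<bullet> b = u b" if "b \<in> B" for b
    proof -
      have "v \<bullet> b = (\<Sum>a\<in>B. u a * (a \<bullet> b))" by (simp add: u inner_sum_left)
      also have "\<dots> = (\<Sum>a\<in>B. if a = b then u a else 0)"
        by (rule sum.cong) (auto simp: orth that)
      also have "\<dots> = u b" using fin that by simp
      finally show ?thesis .
    qed
    then show ?thesis unfolding u[symmetric] using u by simp
  qed
  then show ?thesis using fin B(1) orth that by blast
qed

text \<open>\<open>U\<close> has empty interior when \<open>E\<close> is a proper subspace, so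
  derivatives exist only within \<open>U\<close>. Along a direction of \<open>E\<close> a short
  segment stays in \<open>U\<close>, and the restriction to it has an ordinary two-sided
  derivative.\<close>

lemma has_derivative_imp_line:
  assumes "rel_open E U" "x \<in> U" "v \<in> E" "(f has_derivative f') (at x within U)"
  shows "((\<lambda>t. f (x + t *\<^sub>R v)) has_vector_derivative f' v) (at 0)"
proof -
  obtain e where e: "e > 0" "\<And>t. \<bar>t\<bar> < e \<Longrightarrow> x + t *\<^sub>R v \<in> U"
    using rel_open_line[OF assms(1-3)] by blast
  have l: "((\<lambda>t. x + t *\<^sub>R v) has_derivative (\<lambda>t. t *\<^sub>R v)) (at 0 within ball 0 e)"
    by (auto intro!: derivative_eq_intros)
  have "(f has_derivative f') (at (x + 0 *\<^sub>R v) within (\<lambda>t. x + t *\<^sub>R v) ` ball 0 e)"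
    using assms(4) by (auto intro: has_derivative_subset simp: e image_subset_iff)
  from has_derivative_in_compose[OF l this]
  have "((\<lambda>t. f (x + t *\<^sub>R v)) has_derivative (\<lambda>t. f' (t *\<^sub>R v))) (at 0 within ball 0 e)"
    by simp
  moreover have "f' (t *\<^sub>R v) = t *\<^sub>R f' v" for t
    using assms(4) has_derivative_linear linear_cmul by blast
  ultimately have "((\<lambda>t. f (x + t *\<^sub>R v)) has_derivative (\<lambda>t. t *\<^sub>R f' v)) (at 0 within ball 0 e)"
    by simp
  moreover have "at 0 within ball 0 e = at (0::real)" using e(1) by (intro at_within_open) auto
  ultimately show ?thesis by (simp add: has_vector_derivative_def)
qed

lemma dir_deriv_eq:
  assumes "rel_open E U" "x \<in> U" "v \<in> E" "(f has_derivative f') (at x within U)"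
  shows "dir_deriv f v x = f' v"
  unfolding dir_deriv_def by (rule vector_derivative_at[OF has_derivative_imp_line[OF assms]])

lemma has_vector_derivative_shift:
  assumes "((\<lambda>s. f (t + s)) has_vector_derivative D) (at (0::real))"
  shows "(f has_vector_derivative D) (at t)"
proof -
  have "((\<lambda>s. f (t + s)) \<circ> (\<lambda>s. s - t) has_vector_derivative 1 *\<^sub>R D) (at t)"
    by (rule vector_diff_chain_at) (use assms in \<open>auto intro!: derivative_eq_intros\<close>)
  then show ?thesis by (simp add: o_def)
qed

lemma line_has_vector_derivative:
  assumes "rel_open E U" "x + t *\<^sub>R v \<in> U" "v \<in> E" "f differentiable (at (x + t *\<^sub>R v) within U)"
  shows "((\<lambda>t. f (x + t *\<^sub>R v)) has_vector_derivative dir_deriv f v (x + t *\<^sub>R v)) (at t)"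
proof -
  obtain f' where f': "(f has_derivative f') (at (x + t *\<^sub>R v) within U)"
    using assms(4) by (auto simp: differentiable_def)
  have "((\<lambda>s. f (x + t *\<^sub>R v + s *\<^sub>R v)) has_vector_derivative f' v) (at 0)"
    by (rule has_derivative_imp_line[OF assms(1-3) f'])
  then have "((\<lambda>s. f (x + (t + s) *\<^sub>R v)) has_vector_derivative f' v) (at 0)"
    by (simp add: algebra_simps)
  then show ?thesis
    using has_vector_derivative_shift[of "\<lambda>t. f (x + t *\<^sub>R v)"] dir_deriv_eq[OF assms(1-3) f'] by simp
qed

lemma dir_deriv_linear:
  assumes "rel_open E U" "x \<in> U" "f differentiable (at x within U)" "u \<in> E" "v \<in> E"
  shows "dir_deriv f (u + v) x = dir_deriv f u x + dir_deriv f v x"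
    "dir_deriv f (a *\<^sub>R u) x = a *\<^sub>R dir_deriv f u x"
    "dir_deriv f (- u) x = - dir_deriv f u x"
proof -
  obtain f' where f': "(f has_derivative f') (at x within U)"
    using assms(3) by (auto simp: differentiable_def)
  have l: "linear f'" using f' by (rule has_derivative_linear)
  have E: "u + v \<in> E" "a *\<^sub>R u \<in> E" "- u \<in> E"
    using assms by (auto intro: subspace_add subspace_mul subspace_neg)
  note D = dir_deriv_eq[OF assms(1,2) _ f']
  show "dir_deriv f (u + v) x = dir_deriv f u x + dir_deriv f v x"
    "dir_deriv f (a *\<^sub>R u) x = a *\<^sub>R dir_deriv f u x"
    "dir_deriv f (- u) x = - dir_deriv f u x"
    using E assms(4,5) by (simp_all add: D linear_add[OF l] linear_cmul[OF l] linear_neg[OF l])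
qed

lemma dir_deriv_sum:
  assumes "rel_open E U" "x \<in> U" "f differentiable (at x within U)" "finite S" "\<And>b. b \<in> S \<Longrightarrow> w b \<in> E"
  shows "dir_deriv f (\<Sum>b\<in>S. c b *\<^sub>R w b) x = (\<Sum>b\<in>S. c b *\<^sub>R dir_deriv f (w b) x)"
proof -
  obtain f' where f': "(f has_derivative f') (at x within U)"
    using assms(3) by (auto simp: differentiable_def)
  have l: "linear f'" using f' by (rule has_derivative_linear)
  have E: "(\<Sum>b\<in>S. c b *\<^sub>R w b) \<in> E" using assms by (intro subspace_sum subspace_mul) auto
  note D = dir_deriv_eq[OF assms(1,2) _ f']
  show ?thesis using D assms(5) E by (simp add: linear_sum[OF l] linear_cmul[OF l])
qed

section \<open>Functions of class C^k on relatively open sets\<close>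

lemma has_derivative_cong_on:
  assumes "\<And>x. x \<in> U \<Longrightarrow> f x = g x" "x \<in> U"
  shows "(f has_derivative f') (at x within U) \<longleftrightarrow> (g has_derivative f') (at x within U)"
  using assms by (metis has_derivative_transform)

lemma Ck_on_cong:
  assumes "\<And>x. x \<in> U \<Longrightarrow> f x = g x"
  shows "Ck_on k E U f \<longleftrightarrow> Ck_on k E U g"
proof (cases k)
  case 0
  then show ?thesis using assms by (simp cong: continuous_on_cong)
next
  case (Suc k')
  have "(f has_derivative f') (at x within U) \<longleftrightarrow> (g has_derivative f') (at x within U)" if "x \<in> U" for f' x
    using has_derivative_cong_on[OF assms that] .
  then show ?thesis using Suc by auto
qed

text \<open>\<open>Ck_on\<close> quantifies existentially over the derivative. On directions in
  \<open>E\<close> every witness agrees with \<open>dir_deriv\<close>, so the recursion can be run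
  with this canonical choice.\<close>

lemma Ck_on_Suc:
  assumes "rel_open E U"
  shows "Ck_on (Suc k) E U f \<longleftrightarrow>
    (\<forall>x\<in>U. f differentiable (at x within U)) \<and> (\<forall>v\<in>E. Ck_on k E U (dir_deriv f v))"
proof
  assume "Ck_on (Suc k) E U f"
  then obtain f' where f': "\<And>x. x \<in> U \<Longrightarrow> (f has_derivative f' x) (at x within U)"
    "\<And>v. v \<in> E \<Longrightarrow> Ck_on k E U (\<lambda>x. f' x v)" by auto
  have "Ck_on k E U (dir_deriv f v)" if "v \<in> E" for v
  proof -
    have "Ck_on k E U (dir_deriv f v) \<longleftrightarrow> Ck_on k E U (\<lambda>x. f' x v)"
      by (rule Ck_on_cong) (rule dir_deriv_eq[OF assms _ that f'(1)])
    then show ?thesis using f'(2)[OF that] by simp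
  qed
  then show "(\<forall>x\<in>U. f differentiable (at x within U)) \<and> (\<forall>v\<in>E. Ck_on k E U (dir_deriv f v))"
    using f' by (auto simp: differentiable_def)
next
  assume H: "(\<forall>x\<in>U. f differentiable (at x within U)) \<and> (\<forall>v\<in>E. Ck_on k E U (dir_deriv f v))"
  then obtain f' where f': "\<And>x. x \<in> U \<Longrightarrow> (f has_derivative f' x) (at x within U)"
    unfolding differentiable_def by metis
  have "Ck_on k E U (\<lambda>x. f' x v)" if "v \<in> E" for v
  proof -
    have "Ck_on k E U (dir_deriv f v) \<longleftrightarrow> Ck_on k E U (\<lambda>x. f' x v)"
      by (rule Ck_on_cong) (rule dir_deriv_eq[OF assms _ that f'(1)])
    then show ?thesis using H that by simp
  qed
  then show "Ck_on (Suc k) E U f" using f' by auto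
qed

lemmas Ck_on_SucD = Ck_on_Suc[THEN iffD1, THEN conjunct1, rule_format] Ck_on_Suc[THEN iffD1, THEN conjunct2, rule_format]

lemma Ck_on_SucI:
  assumes "rel_open E U" "\<And>x. x \<in> U \<Longrightarrow> f differentiable (at x within U)"
    "\<And>v. v \<in> E \<Longrightarrow> Ck_on k E U (dir_deriv f v)"
  shows "Ck_on (Suc k) E U f"
  unfolding Ck_on_Suc[OF assms(1)] using assms(2,3) by simp

lemma Ck_on_continuous: "Ck_on k E U f \<Longrightarrow> continuous_on U f"
  by (cases k) (auto simp: continuous_on_eq_continuous_within intro: has_derivative_continuous)

lemma Ck_on_mono:
  assumes "Ck_on (Suc k) E U f" shows "Ck_on k E U f"
  using assms
proof (induction k arbitrary: f)
  case 0
  then show ?case using Ck_on_continuous by fastforce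
next
  case (Suc k)
  then show ?case by (metis Ck_on.simps(2))
qed

lemma Ck_on_subset:
  assumes "Ck_on k E U f" "U' \<subseteq> U"
  shows "Ck_on k E U' f"
  using assms(1)
proof (induction k arbitrary: f)
  case 0
  then show ?case using assms continuous_on_subset by auto
next
  case (Suc k)
  then obtain f' where "\<forall>x\<in>U. (f has_derivative f' x) (at x within U)" "\<forall>v\<in>E. Ck_on k E U (\<lambda>x. f' x v)"
    by auto
  then show ?case unfolding Ck_on.simps
    using assms(2) Suc.IH has_derivative_subset[OF _ assms(2)] by (intro exI[of _ f']) blast
qed

lemma Ck_on_const: "Ck_on k E U (\<lambda>x. c)"
proof (induction k arbitrary: c)
  case 0
  then show ?case by simp
next
  case (Suc k)
  have "\<forall>x\<in>U. ((\<lambda>x. c) has_derivative (\<lambda>_. 0)) (at x within U)" by simp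
  then show ?case using Suc[of 0] by force
qed

lemma Ck_on_bounded_linear:
  assumes "bounded_linear h" shows "Ck_on k E U h"
proof (cases k)
  case 0
  then show ?thesis using assms linear_continuous_on by auto
next
  case (Suc k')
  have "\<forall>x\<in>U. (h has_derivative h) (at x within U)" using assms bounded_linear_imp_has_derivative by blast
  then show ?thesis unfolding Suc Ck_on.simps by (intro exI[of _ "\<lambda>_. h"]) (simp add: Ck_on_const)
qed

lemma Ck_on_add:
  assumes "Ck_on k E U f" "Ck_on k E U g"
  shows "Ck_on k E U (\<lambda>x. f x + g x)"
  using assms
proof (induction k arbitrary: f g)
  case 0
  then show ?case by (auto intro: continuous_intros)
next
  case (Suc k)
  from Suc.prems obtain f' g' where
    f': "\<forall>x\<in>U. (f has_derivative f' x) (at x within U)" "\<forall>v\<in>E. Ck_on k E U (\<lambda>x. f' x v)" and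
    g': "\<forall>x\<in>U. (g has_derivative g' x) (at x within U)" "\<forall>v\<in>E. Ck_on k E U (\<lambda>x. g' x v)"
    by auto
  show ?case unfolding Ck_on.simps
    by (rule exI[of _ "\<lambda>x v. f' x v + g' x v"]) (use f' g' Suc.IH in \<open>auto intro: has_derivative_add\<close>)
qed

lemma Ck_on_bilinear:
  assumes "bounded_bilinear pr" "Ck_on k E U f" "Ck_on k E U g"
  shows "Ck_on k E U (\<lambda>x. pr (f x) (g x))"
  using assms(2,3)
proof (induction k arbitrary: f g)
  case 0
  then show ?case by (auto intro: bounded_bilinear.continuous_on[OF assms(1)])
next
  case (Suc k)
  note m = Suc.prems[THEN Ck_on_mono]
  from Suc.prems obtain f' g' where
    f': "\<forall>x\<in>U. (f has_derivative f' x) (at x within U)" "\<forall>v\<in>E. Ck_on k E U (\<lambda>x. f' x v)" and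
    g': "\<forall>x\<in>U. (g has_derivative g' x) (at x within U)" "\<forall>v\<in>E. Ck_on k E U (\<lambda>x. g' x v)"
    by auto
  show ?case unfolding Ck_on.simps
    by (rule exI[of _ "\<lambda>x v. pr (f x) (g' x v) + pr (f' x v) (g x)"])
      (use f' g' Suc.IH m in \<open>auto intro!: bounded_bilinear.FDERIV[OF assms(1)] Ck_on_add\<close>)
qed

lemma Ck_on_linear_comp:
  assumes "bounded_linear h" "Ck_on k E U f"
  shows "Ck_on k E U (\<lambda>x. h (f x))"
  using assms(2)
proof (induction k arbitrary: f)
  case 0
  then show ?case using assms(1) by (auto intro: bounded_linear.continuous_on)
next
  case (Suc k)
  from Suc.prems obtain f' where
    f': "\<forall>x\<in>U. (f has_derivative f' x) (at x within U)" "\<forall>v\<in>E. Ck_on k E U (\<lambda>x. f' x v)"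
    by auto
  show ?case unfolding Ck_on.simps
    by (rule exI[of _ "\<lambda>x v. h (f' x v)"])
      (use f' Suc.IH in \<open>auto intro: bounded_linear.has_derivative[OF assms(1)]\<close>)
qed

lemma Ck_on_sum:
  assumes "\<And>i. i \<in> S \<Longrightarrow> Ck_on k E U (f i)"
  shows "Ck_on k E U (\<lambda>x. \<Sum>i\<in>S. f i x)"
  using assms by (induction S rule: infinite_finite_induct) (auto intro: Ck_on_const Ck_on_add)

text \<open>A map into \<open>E'\<close> is unchanged by the orthogonal projection to
  \<open>E'\<close>. Differentiating the projected map gives a derivative of \<open>f\<close> that
  visibly takes values in \<open>E'\<close>.\<close>

lemma dir_deriv_in:
  fixes f :: "'e::euclidean_space \<Rightarrow> 'f::euclidean_space"
  assumes "rel_open E U" "x \<in> U" "v \<in> E" "f differentiable (at x within U)" "subspace E'" "f ` U \<subseteq> E'"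
  shows "dir_deriv f v x \<in> E'"
proof -
  obtain B where B: "finite B" "B \<subseteq> E'" "\<And>v. v \<in> E' \<Longrightarrow> (\<Sum>b\<in>B. (v \<bullet> b) *\<^sub>R b) = v"
    using subspace_onb assms(5) by metis
  obtain f' where f': "(f has_derivative f') (at x within U)"
    using assms(4) by (auto simp: differentiable_def)
  have "((\<lambda>x. \<Sum>b\<in>B. (f x \<bullet> b) *\<^sub>R b) has_derivative (\<lambda>v. \<Sum>b\<in>B. (f' v \<bullet> b) *\<^sub>R b)) (at x within U)"
    by (auto intro!: derivative_eq_intros f')
  then have "(f has_derivative (\<lambda>v. \<Sum>b\<in>B. (f' v \<bullet> b) *\<^sub>R b)) (at x within U)"
    by (rule has_derivative_transform[OF assms(2), rotated]) (use B assms in auto)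
  from dir_deriv_eq[OF assms(1-3) this] show ?thesis
    using B(2) assms(5) by (auto intro!: subspace_sum subspace_mul)
qed

lemma differentiable_compose_rel:
  assumes "f differentiable (at x within U)" "g differentiable (at (f x) within V)" "f ` U \<subseteq> V"
  shows "(\<lambda>x. g (f x)) differentiable (at x within U)"
proof -
  obtain f' g' where f': "(f has_derivative f') (at x within U)" and g': "(g has_derivative g') (at (f x) within V)"
    using assms(1,2) by (auto simp: differentiable_def)
  show ?thesis
    using has_derivative_in_compose[OF f' has_derivative_subset[OF g' assms(3)]] differentiableI by blast
qed

lemma dir_deriv_chain:
  assumes "rel_open E U" "rel_open E' V" "x \<in> U" "v \<in> E" "f ` U \<subseteq> V"
    and f: "f differentiable (at x within U)" and g: "g differentiable (at (f x) within V)"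
  shows "dir_deriv (\<lambda>x. g (f x)) v x = dir_deriv g (dir_deriv f v x) (f x)"
proof -
  obtain f' g' where f': "(f has_derivative f') (at x within U)" and g': "(g has_derivative g') (at (f x) within V)"
    using f g by (auto simp: differentiable_def)
  have "((\<lambda>x. g (f x)) has_derivative (\<lambda>v. g' (f' v))) (at x within U)"
    by (rule has_derivative_in_compose[OF f' has_derivative_subset[OF g' assms(5)]])
  then have "dir_deriv (\<lambda>x. g (f x)) v x = g' (f' v)" by (rule dir_deriv_eq[OF assms(1,3,4)])
  moreover have "dir_deriv f v x = f' v" by (rule dir_deriv_eq[OF assms(1,3,4) f'])
  moreover have "dir_deriv f v x \<in> E'"
    using dir_deriv_in[OF assms(1,3,4) f] assms(2,5) rel_open_subset[OF assms(2)] by blast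
  ultimately show ?thesis using dir_deriv_eq[OF assms(2) _ _ g'] assms(3,5) by auto
qed

text \<open>In the chain rule the direction in which \<open>g\<close> is differentiated varies with
  the point. Expanding it in a fixed basis of \<open>E'\<close> leaves derivatives of
  \<open>g\<close> in constant directions, to which the induction hypothesis applies.\<close>

lemma Ck_on_compose:
  assumes U: "rel_open E U" and V: "rel_open E' V" and "f ` U \<subseteq> V" "Ck_on k E U f" "Ck_on k E' V g"
  shows "Ck_on k E U (\<lambda>x. g (f x))"
  using assms(4,5)
proof (induction k arbitrary: g)
  case 0
  then show ?case using assms(3) continuous_on_compose2[of V g U f] by simp
next
  case (Suc k)
  have f: "f differentiable (at x within U)" if "x \<in> U" for x using Ck_on_SucD(1)[OF U Suc.prems(1) that] .
  have g: "g differentiable (at y within V)" if "y \<in> V" for y using Ck_on_SucD(1)[OF V Suc.prems(2) that] .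
  obtain B where B: "finite B" "B \<subseteq> E'" "\<And>v. v \<in> E' \<Longrightarrow> (\<Sum>b\<in>B. (v \<bullet> b) *\<^sub>R b) = v"
    using subspace_onb V by metis
  have E': "dir_deriv f v x \<in> E'" if "x \<in> U" "v \<in> E" for x v
    using dir_deriv_in[OF U that f] that assms(3) V rel_open_subset[OF V] by blast
  have eq: "dir_deriv (\<lambda>x. g (f x)) v x = (\<Sum>b\<in>B. (dir_deriv f v x \<bullet> b) *\<^sub>R dir_deriv g b (f x))"
    if "x \<in> U" "v \<in> E" for x v
  proof -
    have fx: "f x \<in> V" using that assms(3) by auto
    have "dir_deriv (\<lambda>x. g (f x)) v x = dir_deriv g (dir_deriv f v x) (f x)"
      using dir_deriv_chain[OF U V that assms(3) f g] that fx by blast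
    also have "\<dots> = dir_deriv g (\<Sum>b\<in>B. (dir_deriv f v x \<bullet> b) *\<^sub>R b) (f x)" using B(3) E' that by simp
    also have "\<dots> = (\<Sum>b\<in>B. (dir_deriv f v x \<bullet> b) *\<^sub>R dir_deriv g b (f x))"
      by (rule dir_deriv_sum[OF V fx g[OF fx] B(1)]) (use B(2) in auto)
    finally show ?thesis .
  qed
  have "Ck_on k E U (dir_deriv (\<lambda>x. g (f x)) v)" if v: "v \<in> E" for v
  proof -
    have "Ck_on k E U (\<lambda>x. (dir_deriv f v x \<bullet> b) *\<^sub>R dir_deriv g b (f x))" if "b \<in> B" for b
    proof (intro Ck_on_bilinear[OF bounded_bilinear_scaleR])
      show "Ck_on k E U (\<lambda>x. dir_deriv f v x \<bullet> b)"
        by (rule Ck_on_linear_comp[OF bounded_linear_inner_left Ck_on_SucD(2)[OF U Suc.prems(1) v]])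
      show "Ck_on k E U (\<lambda>x. dir_deriv g b (f x))"
        using Suc.IH[OF Ck_on_mono[OF Suc.prems(1)] Ck_on_SucD(2)[OF V Suc.prems(2)]] that B(2) by blast
    qed
    then have "Ck_on k E U (\<lambda>x. \<Sum>b\<in>B. (dir_deriv f v x \<bullet> b) *\<^sub>R dir_deriv g b (f x))"
      by (rule Ck_on_sum)
    then show ?thesis by (rule Ck_on_cong[THEN iffD1, rotated]) (simp add: eq v)
  qed
  moreover have "(\<lambda>x. g (f x)) differentiable (at x within U)" if "x \<in> U" for x
    using differentiable_compose_rel[OF f g assms(3)] that assms(3) by blast
  ultimately show ?case by (intro Ck_on_SucI[OF U])
qed

section \<open>Smooth functions and the rules for directional derivatives\<close>

lemma smooth_on_differentiable:
  "rel_open E U \<Longrightarrow> smooth_on E U f \<Longrightarrow> x \<in> U \<Longrightarrow> f differentiable (at x within U)"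
  by (rule Ck_on_SucD(1)[where k = 0], assumption) (simp only: smooth_on_def)

lemma smooth_on_dir_deriv: "rel_open E U \<Longrightarrow> smooth_on E U f \<Longrightarrow> v \<in> E \<Longrightarrow> smooth_on E U (dir_deriv f v)"
  unfolding smooth_on_def using Ck_on_SucD(2) by blast

lemma smooth_on_cong: "(\<And>x. x \<in> U \<Longrightarrow> f x = g x) \<Longrightarrow> smooth_on E U f \<longleftrightarrow> smooth_on E U g"
  unfolding smooth_on_def using Ck_on_cong[of U f g] by blast

lemma smooth_on_subset: "smooth_on E U f \<Longrightarrow> U' \<subseteq> U \<Longrightarrow> smooth_on E U' f"
  unfolding smooth_on_def using Ck_on_subset by blast

lemma smooth_on_continuous: "smooth_on E U f \<Longrightarrow> continuous_on U f"
  unfolding smooth_on_def using Ck_on_continuous by blast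

lemma smooth_on_const: "smooth_on E U (\<lambda>x. c)"
  unfolding smooth_on_def by (simp add: Ck_on_const)

lemma smooth_on_bounded_linear: "bounded_linear h \<Longrightarrow> smooth_on E U h"
  unfolding smooth_on_def by (simp add: Ck_on_bounded_linear)

lemma smooth_on_linear: "linear (h :: 'e::euclidean_space \<Rightarrow> 'f::real_normed_vector) \<Longrightarrow> smooth_on E U h"
  by (simp add: linear_conv_bounded_linear smooth_on_bounded_linear)

lemma smooth_on_add: "smooth_on E U f \<Longrightarrow> smooth_on E U g \<Longrightarrow> smooth_on E U (\<lambda>x. f x + g x)"
  unfolding smooth_on_def using Ck_on_add by blast

lemma smooth_on_bilinear:
  "bounded_bilinear b \<Longrightarrow> smooth_on E U f \<Longrightarrow> smooth_on E U g \<Longrightarrow> smooth_on E U (\<lambda>x. b (f x) (g x))"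
  unfolding smooth_on_def by (simp add: Ck_on_bilinear)

lemmas smooth_on_scaleR = smooth_on_bilinear[OF bounded_bilinear_scaleR]
lemmas smooth_on_mult = smooth_on_bilinear[OF bounded_bilinear_mult]
lemmas smooth_on_inner = smooth_on_bilinear[OF bounded_bilinear_inner]

lemma smooth_on_linear_comp:
  "bounded_linear h \<Longrightarrow> smooth_on E U f \<Longrightarrow> smooth_on E U (\<lambda>x. h (f x))"
  unfolding smooth_on_def by (simp add: Ck_on_linear_comp)

lemmas smooth_on_minus = smooth_on_linear_comp[OF bounded_linear_minus[OF bounded_linear_ident]]

lemma smooth_on_diff: "smooth_on E U f \<Longrightarrow> smooth_on E U g \<Longrightarrow> smooth_on E U (\<lambda>x. f x - g x)"
  using smooth_on_add[OF _ smooth_on_minus, of E U f g] by simp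

lemma smooth_on_sum: "(\<And>i. i \<in> S \<Longrightarrow> smooth_on E U (f i)) \<Longrightarrow> smooth_on E U (\<lambda>x. \<Sum>i\<in>S. f i x)"
  unfolding smooth_on_def by (simp add: Ck_on_sum)

lemma smooth_on_compose:
  "rel_open E U \<Longrightarrow> rel_open E' V \<Longrightarrow> f ` U \<subseteq> V \<Longrightarrow> smooth_on E U f \<Longrightarrow> smooth_on E' V g
    \<Longrightarrow> smooth_on E U (\<lambda>x. g (f x))"
  unfolding smooth_on_def by (intro allI, rule Ck_on_compose[of E U E' V f]) simp_all

lemma dir_deriv_cong:
  assumes "rel_open E U" "x \<in> U" "v \<in> E" "\<And>x. x \<in> U \<Longrightarrow> f x = g x"
  shows "dir_deriv f v x = dir_deriv g v x"
proof -
  obtain e where e: "e > 0" "\<And>t. \<bar>t\<bar> < e \<Longrightarrow> x + t *\<^sub>R v \<in> U"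
    using rel_open_line[OF assms(1-3)] by blast
  have "\<forall>\<^sub>F t in nhds (0::real). f (x + t *\<^sub>R v) = g (x + t *\<^sub>R v)"
    unfolding eventually_nhds by (rule exI[of _ "ball 0 e"]) (use e assms(4) in auto)
  then show ?thesis unfolding dir_deriv_def by (intro vector_derivative_cong_eq) auto
qed

lemma dir_deriv_const: "dir_deriv (\<lambda>x. c) v x = 0"
  by (simp add: dir_deriv_def)

lemma dir_deriv_linear_map:
  fixes h :: "'e::euclidean_space \<Rightarrow> 'f::real_normed_vector"
  assumes "bounded_linear h" shows "dir_deriv h v x = h v"
proof -
  have "(h has_derivative h) (at x within UNIV)"
    using assms bounded_linear_imp_has_derivative by blast
  then show ?thesis by (intro dir_deriv_eq[of UNIV UNIV]) auto
qed

lemma dir_deriv_add: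
  assumes "rel_open E U" "x \<in> U" "v \<in> E" "f differentiable (at x within U)" "g differentiable (at x within U)"
  shows "dir_deriv (\<lambda>x. f x + g x) v x = dir_deriv f v x + dir_deriv g v x"
proof -
  obtain f' g' where f': "(f has_derivative f') (at x within U)" and g': "(g has_derivative g') (at x within U)"
    using assms(4,5) by (auto simp: differentiable_def)
  show ?thesis
    unfolding dir_deriv_eq[OF assms(1-3) f'] dir_deriv_eq[OF assms(1-3) g']
    by (rule dir_deriv_eq[OF assms(1-3) has_derivative_add[OF f' g']])
qed

lemma dir_deriv_bilinear:
  assumes "bounded_bilinear b" "rel_open E U" "x \<in> U" "v \<in> E"
    "f differentiable (at x within U)" "g differentiable (at x within U)"
  shows "dir_deriv (\<lambda>x. b (f x) (g x)) v x = b (f x) (dir_deriv g v x) + b (dir_deriv f v x) (g x)"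
proof -
  obtain f' g' where f': "(f has_derivative f') (at x within U)" and g': "(g has_derivative g') (at x within U)"
    using assms(5,6) by (auto simp: differentiable_def)
  show ?thesis
    unfolding dir_deriv_eq[OF assms(2-4) f'] dir_deriv_eq[OF assms(2-4) g']
    by (rule dir_deriv_eq[OF assms(2-4) bounded_bilinear.FDERIV[OF assms(1) f' g']])
qed

lemmas dir_deriv_mult = dir_deriv_bilinear[OF bounded_bilinear_mult]

lemma dir_deriv_linear_comp:
  assumes "bounded_linear h" "rel_open E U" "x \<in> U" "v \<in> E" "f differentiable (at x within U)"
  shows "dir_deriv (\<lambda>x. h (f x)) v x = h (dir_deriv f v x)"
proof -
  obtain f' where f': "(f has_derivative f') (at x within U)"
    using assms(5) by (auto simp: differentiable_def)
  show ?thesis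
    unfolding dir_deriv_eq[OF assms(2-4) f']
    by (rule dir_deriv_eq[OF assms(2-4) bounded_linear.has_derivative[OF assms(1) f']])
qed

lemma dir_deriv_sum_fun:
  assumes "rel_open E U" "x \<in> U" "v \<in> E" "\<And>i. i \<in> S \<Longrightarrow> f i differentiable (at x within U)"
  shows "dir_deriv (\<lambda>x. \<Sum>i\<in>S. f i x) v x = (\<Sum>i\<in>S. dir_deriv (f i) v x)"
  using assms(4)
proof (induction S rule: infinite_finite_induct)
  case (insert i S)
  have "(\<lambda>x. \<Sum>i\<in>S. f i x) differentiable (at x within U)"
    using insert by (intro differentiable_sum) auto
  then show ?case using insert dir_deriv_add[OF assms(1-3), of "f i" "\<lambda>x. \<Sum>i\<in>S. f i x"] by simp
qed (simp_all add: dir_deriv_const)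

section \<open>Linear systems with variable coefficients\<close>

lemma Ck_on_inverse:
  fixes f :: "'e::real_normed_vector \<Rightarrow> real"
  assumes "\<And>x. x \<in> U \<Longrightarrow> f x \<noteq> 0" "Ck_on k E U f"
  shows "Ck_on k E U (\<lambda>x. inverse (f x))"
  using assms(2)
proof (induction k)
  case 0
  then show ?case using assms by (auto intro: continuous_intros)
next
  case (Suc k)
  from Suc.prems obtain f' where
    f': "\<forall>x\<in>U. (f has_derivative f' x) (at x within U)" "\<forall>v\<in>E. Ck_on k E U (\<lambda>x. f' x v)"
    by auto
  note I = Suc.IH[OF Ck_on_mono[OF Suc.prems]]
  have "Ck_on k E U (\<lambda>x. - (inverse (f x) * f' x v * inverse (f x)))" if "v \<in> E" for v
    using f' that by (intro Ck_on_linear_comp[OF bounded_linear_minus[OF bounded_linear_ident]]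
        Ck_on_bilinear[OF bounded_bilinear_mult] I) auto
  moreover have "\<forall>x\<in>U. ((\<lambda>x. inverse (f x)) has_derivative (\<lambda>v. - (inverse (f x) * f' x v * inverse (f x)))) (at x within U)"
    using f' assms(1) by (auto intro: has_derivative_inverse)
  ultimately show ?case unfolding Ck_on.simps
    by (intro exI[of _ "\<lambda>x v. - (inverse (f x) * f' x v * inverse (f x))"]) simp
qed

text \<open>Gaussian elimination: the last vector is projected out of the others.\<close>

lemma Ck_on_coefficients:
  fixes a :: "'i \<Rightarrow> 'e::real_normed_vector \<Rightarrow> 'f::euclidean_space"
  assumes "finite B" "\<And>b. b \<in> B \<Longrightarrow> Ck_on k E U (a b)" "Ck_on k E U r"
    and "\<And>x. x \<in> U \<Longrightarrow> r x = (\<Sum>b\<in>B. c b x *\<^sub>R a b x)"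
    and "\<And>x d b. x \<in> U \<Longrightarrow> (\<Sum>b\<in>B. d b *\<^sub>R a b x) = 0 \<Longrightarrow> b \<in> B \<Longrightarrow> d b = 0"
    and "b \<in> B"
  shows "Ck_on k E U (c b)"
  using assms
proof (induction B arbitrary: a r b rule: finite_induct)
  case empty
  then show ?case by simp
next
  case (insert b0 B)
  define n where "n x = inverse (a b0 x \<bullet> a b0 x)" for x
  define pr where "pr y x = y - ((y \<bullet> a b0 x) * n x) *\<^sub>R a b0 x" for y x
  have nz: "a b0 x \<noteq> 0" if "x \<in> U" for x
  proof
    assume "a b0 x = 0"
    then have "(\<Sum>b\<in>insert b0 B. (if b = b0 then 1 else 0) *\<^sub>R a b x) = 0"
      by (intro sum.neutral) auto
    from insert.prems(4)[OF that this, of b0] show False by simp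
  qed
  have Cb0: "Ck_on k E U (a b0)" using insert.prems by auto
  have Cn: "Ck_on k E U n" unfolding n_def
    using nz by (intro Ck_on_inverse Ck_on_bilinear[OF bounded_bilinear_inner] Cb0) auto
  have Cpr: "Ck_on k E U (\<lambda>x. pr (f x) x)" if "Ck_on k E U f" for f
  proof -
    have "Ck_on k E U (\<lambda>x. f x + - (((f x \<bullet> a b0 x) * n x) *\<^sub>R a b0 x))"
      by (intro Ck_on_add that Ck_on_linear_comp[OF bounded_linear_minus[OF bounded_linear_ident]]
          Ck_on_bilinear[OF bounded_bilinear_mult] Ck_on_bilinear[OF bounded_bilinear_inner]
          Ck_on_bilinear[OF bounded_bilinear_scaleR] Cb0 Cn)
    then show ?thesis by (simp add: pr_def)
  qed
  have pr_lin: "pr (\<Sum>b\<in>S. d b *\<^sub>R w b) x = (\<Sum>b\<in>S. d b *\<^sub>R pr (w b) x)" for S d and w :: "'i \<Rightarrow> 'f" and x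
    by (simp add: pr_def inner_sum_left sum_distrib_left scaleR_sum_left algebra_simps sum_subtractf)
  have pr0: "pr (a b0 x) x = 0" if "x \<in> U" for x
    using nz[OF that] by (simp add: pr_def n_def)
  have main: "Ck_on k E U (c b)" if b: "b \<in> B" for b
  proof (rule insert.IH[of "\<lambda>b x. pr (a b x) x" "\<lambda>x. pr (r x) x"])
    show "Ck_on k E U (\<lambda>x. pr (a b x) x)" if "b \<in> B" for b
      using that insert.prems(1) by (intro Cpr) auto
    show "Ck_on k E U (\<lambda>x. pr (r x) x)" by (intro Cpr insert.prems(2))
    show "pr (r x) x = (\<Sum>b\<in>B. c b x *\<^sub>R pr (a b x) x)" if "x \<in> U" for x
      using insert.prems(3)[OF that] insert.hyps pr0[OF that] by (simp add: pr_lin del: sum.insert) simp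
    show "d b = 0" if "x \<in> U" "(\<Sum>b\<in>B. d b *\<^sub>R pr (a b x) x) = 0" "b \<in> B" for x d b
    proof -
      \<comment> \<open>A relation between the projected vectors says that \<open>y\<close> is a
        multiple of \<open>a b0 x\<close>. This is a relation between the original vectors, so all
        its coefficients vanish.\<close>
      define y where "y = (\<Sum>b\<in>B. d b *\<^sub>R a b x)"
      have "pr y x = 0" using that(2) by (simp add: y_def pr_lin)
      then have "y = ((y \<bullet> a b0 x) * n x) *\<^sub>R a b0 x" by (simp add: pr_def)
      then have "(\<Sum>b\<in>insert b0 B. (if b = b0 then - ((y \<bullet> a b0 x) * n x) else d b) *\<^sub>R a b x) = 0"
        using insert.hyps by (simp add: y_def[symmetric] cong: sum.cong)
          (smt (verit, del_insts) sum.cong y_def add.commute neg_eq_iff_add_eq_0)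
      from insert.prems(4)[OF that(1) this, of b] that(3) insert.hyps show ?thesis by (auto split: if_splits)
    qed
  qed (use b in auto)
  show ?case
  proof (cases "b = b0")
    case False
    then show ?thesis by (intro main) (use insert.prems(5) in auto)
  next
    case True
    \<comment> \<open>Once the other coefficients are known to be regular, the last one is read off
      by pairing the remainder with \<open>a b0\<close>.\<close>
    have eq: "c b0 x = ((r x + - (\<Sum>b\<in>B. c b x *\<^sub>R a b x)) \<bullet> a b0 x) * n x" if "x \<in> U" for x
      using insert.prems(3)[OF that] insert.hyps nz[OF that] by (simp add: n_def)
    have "Ck_on k E U (\<lambda>x. ((r x + - (\<Sum>b\<in>B. c b x *\<^sub>R a b x)) \<bullet> a b0 x) * n x)"
      using insert.prems(1,2) main
      by (intro Ck_on_add Ck_on_linear_comp[OF bounded_linear_minus[OF bounded_linear_ident]] Ck_on_sum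
          Ck_on_bilinear[OF bounded_bilinear_mult] Ck_on_bilinear[OF bounded_bilinear_inner]
          Ck_on_bilinear[OF bounded_bilinear_scaleR] Cb0 Cn) auto
    then show ?thesis unfolding True by (rule Ck_on_cong[THEN iffD1, rotated]) (simp add: eq)
  qed
qed

lemma smooth_on_coefficients:
  fixes a :: "'i \<Rightarrow> 'e::real_normed_vector \<Rightarrow> 'f::euclidean_space"
  assumes "finite B" "\<And>b. b \<in> B \<Longrightarrow> smooth_on E U (a b)" "smooth_on E U r"
    and "\<And>x. x \<in> U \<Longrightarrow> r x = (\<Sum>b\<in>B. c b x *\<^sub>R a b x)"
    and "\<And>x d b. x \<in> U \<Longrightarrow> (\<Sum>b\<in>B. d b *\<^sub>R a b x) = 0 \<Longrightarrow> b \<in> B \<Longrightarrow> d b = 0"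
    and "b \<in> B"
  shows "smooth_on E U (c b)"
  unfolding smooth_on_def
  by (intro allI, rule Ck_on_coefficients[of B _ E U a r c b]) (use assms in \<open>auto simp: smooth_on_def\<close>)

section \<open>Symmetry of second derivatives\<close>

lemma second_difference:
  fixes f :: "'e::euclidean_space \<Rightarrow> real"
  assumes U: "rel_open E U" and f: "smooth_on E U f" and vw: "v \<in> E" "w \<in> E" and h: "0 < h"
    and box: "\<And>s t. 0 \<le> s \<Longrightarrow> s \<le> h \<Longrightarrow> 0 \<le> t \<Longrightarrow> t \<le> h \<Longrightarrow> x + s *\<^sub>R v + t *\<^sub>R w \<in> U"
  obtains s t where "0 < s" "s < h" "0 < t" "t < h"
    "f (x + h *\<^sub>R v + h *\<^sub>R w) - f (x + h *\<^sub>R v) - f (x + h *\<^sub>R w) + f x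
      = h * h * dir_deriv (dir_deriv f v) w (x + s *\<^sub>R v + t *\<^sub>R w)"
proof -
  note df = smooth_on_differentiable[OF U f] smooth_on_differentiable[OF U smooth_on_dir_deriv[OF U f vw(1)]]
  have d1: "((\<lambda>s. f (x + s *\<^sub>R v + t *\<^sub>R w)) has_real_derivative dir_deriv f v (x + s *\<^sub>R v + t *\<^sub>R w)) (at s)"
    if "0 \<le> s" "s \<le> h" "0 \<le> t" "t \<le> h" for s t
    using line_has_vector_derivative[OF U _ vw(1), of "x + t *\<^sub>R w" s f] box[OF that] df(1)
    by (simp add: has_real_derivative_iff_has_vector_derivative algebra_simps)
  have d2: "((\<lambda>t. dir_deriv f v (x + s *\<^sub>R v + t *\<^sub>R w)) has_real_derivative
      dir_deriv (dir_deriv f v) w (x + s *\<^sub>R v + t *\<^sub>R w)) (at t)"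
    if "0 \<le> s" "s \<le> h" "0 \<le> t" "t \<le> h" for s t
    using line_has_vector_derivative[OF U _ vw(2), of "x + s *\<^sub>R v" t "dir_deriv f v"] box[OF that] df(2)
    by (simp add: has_real_derivative_iff_has_vector_derivative algebra_simps)
  \<comment> \<open>The mean value theorem is applied to this difference in the variable
    \<open>s\<close>, and then in \<open>t\<close> to the derivative that it produces.\<close>
  define \<phi> where "\<phi> s = f (x + s *\<^sub>R v + h *\<^sub>R w) - f (x + s *\<^sub>R v + 0 *\<^sub>R w)" for s
  have "(\<phi> has_real_derivative dir_deriv f v (x + s *\<^sub>R v + h *\<^sub>R w) - dir_deriv f v (x + s *\<^sub>R v + 0 *\<^sub>R w)) (at s)"
    if "0 \<le> s" "s \<le> h" for s
    unfolding \<phi>_def using that h by (intro DERIV_diff d1) auto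
  from MVT2[OF h this] obtain s where s: "0 < s" "s < h"
    "\<phi> h - \<phi> 0 = h * (dir_deriv f v (x + s *\<^sub>R v + h *\<^sub>R w) - dir_deriv f v (x + s *\<^sub>R v + 0 *\<^sub>R w))"
    by auto
  have "\<exists>t>0. t < h \<and> dir_deriv f v (x + s *\<^sub>R v + h *\<^sub>R w) - dir_deriv f v (x + s *\<^sub>R v + 0 *\<^sub>R w)
    = (h - 0) * dir_deriv (dir_deriv f v) w (x + s *\<^sub>R v + t *\<^sub>R w)"
    by (rule MVT2[OF h]) (use s d2 in auto)
  then show ?thesis using s that[of s] by (auto simp: \<phi>_def)
qed

text \<open>The second difference over a small parallelogram is symmetric in the two directions. By
  \<open>second_difference\<close> it computes either mixed derivative at some point of the
  parallelogram, and both are continuous.\<close>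

lemma dir_deriv_commute_real:
  fixes f :: "'e::euclidean_space \<Rightarrow> real"
  assumes U: "rel_open E U" and f: "smooth_on E U f" and vw: "v \<in> E" "w \<in> E" and x: "x \<in> U"
  shows "dir_deriv (dir_deriv f v) w x = dir_deriv (dir_deriv f w) v x"
proof (rule ccontr)
  assume ne: "\<not> ?thesis"
  let ?p = "dir_deriv (dir_deriv f v) w" and ?q = "dir_deriv (dir_deriv f w) v"
  \<comment> \<open>Half the supposed gap: the two mixed derivatives agree at nearby points, and two
    errors below \<open>e\<close> cannot bridge the gap.\<close>
  define e where "e = \<bar>?p x - ?q x\<bar> / 2"
  have e: "e > 0" using ne by (simp add: e_def)
  have "continuous_on U ?p" "continuous_on U ?q"
    using f vw by (auto intro!: smooth_on_continuous[where E = E] smooth_on_dir_deriv[OF U])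
  then obtain d1 d2 where d: "d1 > 0" "\<And>y. y \<in> U \<Longrightarrow> dist y x < d1 \<Longrightarrow> dist (?p y) (?p x) < e"
    "d2 > 0" "\<And>y. y \<in> U \<Longrightarrow> dist y x < d2 \<Longrightarrow> dist (?q y) (?q x) < e"
    using x e unfolding continuous_on_iff by metis
  obtain T where T: "open T" "U = E \<inter> T"
    using U by (auto simp: openin_open)
  then obtain d3 where d3: "d3 > 0" "ball x d3 \<subseteq> T" using x open_contains_ball by blast
  define d where "d = min d1 (min d2 d3)"
  define h where "h = d / (2 * (norm v + norm w + 1))"
  have pos: "norm v + norm w + 1 > 0" by (simp add: add_nonneg_pos)
  have "d > 0" using d d3 by (simp add: d_def)
  then have h: "h > 0" using pos by (simp add: h_def)
  have hd: "h * (norm v + norm w) < d"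
  proof -
    have "h * (norm v + norm w) < h * (2 * (norm v + norm w + 1))"
      using h by (intro mult_strict_left_mono) (auto simp: add_nonneg_pos)
    also have "\<dots> = d" using pos by (simp add: h_def)
    finally show ?thesis .
  qed
  have near: "dist (x + s *\<^sub>R v + t *\<^sub>R w) x < d" if "0 \<le> s" "s \<le> h" "0 \<le> t" "t \<le> h" for s t
  proof -
    have "dist (x + s *\<^sub>R v + t *\<^sub>R w) x \<le> s * norm v + t * norm w"
      using that norm_triangle_ineq[of "s *\<^sub>R v" "t *\<^sub>R w"] by (simp add: dist_norm add.assoc)
    also have "\<dots> \<le> h * norm v + h * norm w" using that by (intro add_mono mult_right_mono) auto
    also have "\<dots> < d" using hd by (simp add: algebra_simps)
    finally show ?thesis .
  qed
  have box: "x + s *\<^sub>R v + t *\<^sub>R w \<in> U" if "0 \<le> s" "s \<le> h" "0 \<le> t" "t \<le> h" for s t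
  proof -
    have "x + s *\<^sub>R v + t *\<^sub>R w \<in> E"
      using x vw U rel_open_subset[OF U] by (blast intro: subspace_add subspace_mul)
    moreover have "x + s *\<^sub>R v + t *\<^sub>R w \<in> T"
      using near[OF that] d3(2) by (auto simp: d_def dist_commute)
    ultimately show ?thesis using T by blast
  qed
  have box': "x + s *\<^sub>R w + t *\<^sub>R v \<in> U" if "0 \<le> s" "s \<le> h" "0 \<le> t" "t \<le> h" for s t
    using box[of t s] that by (simp add: algebra_simps)
  obtain s t where st: "0 < s" "s < h" "0 < t" "t < h"
    "f (x + h *\<^sub>R v + h *\<^sub>R w) - f (x + h *\<^sub>R v) - f (x + h *\<^sub>R w) + f x = h * h * ?p (x + s *\<^sub>R v + t *\<^sub>R w)"
    using second_difference[OF U f vw h box] by blast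
  obtain s' t' where st': "0 < s'" "s' < h" "0 < t'" "t' < h"
    "f (x + h *\<^sub>R w + h *\<^sub>R v) - f (x + h *\<^sub>R w) - f (x + h *\<^sub>R v) + f x = h * h * ?q (x + s' *\<^sub>R w + t' *\<^sub>R v)"
    using second_difference[OF U f vw(2,1) h box'] by blast
  have "h * h * ?p (x + s *\<^sub>R v + t *\<^sub>R w) = h * h * ?q (x + s' *\<^sub>R w + t' *\<^sub>R v)"
    using st(5) st'(5) by (simp add: algebra_simps)
  then have eq: "?p (x + s *\<^sub>R v + t *\<^sub>R w) = ?q (x + t' *\<^sub>R v + s' *\<^sub>R w)"
    using h by (simp add: algebra_simps)
  have "dist (?p (x + s *\<^sub>R v + t *\<^sub>R w)) (?p x) < e" "dist (?q (x + t' *\<^sub>R v + s' *\<^sub>R w)) (?q x) < e"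
    using near[of s t] near[of t' s'] box[of s t] box[of t' s'] st st' d by (auto simp: d_def)
  then have "dist (?p x) (?q x) < 2 * e"
    unfolding eq by - (rule dist_triangle_half_r[of "?q (x + t' *\<^sub>R v + s' *\<^sub>R w)"], simp_all)
  then show False unfolding e_def dist_real_def by simp
qed

lemma dir_deriv_commute:
  fixes f :: "'e::euclidean_space \<Rightarrow> 'f::euclidean_space"
  assumes U: "rel_open E U" and f: "smooth_on E U f" and vw: "v \<in> E" "w \<in> E" and x: "x \<in> U"
  shows "dir_deriv (dir_deriv f v) w x = dir_deriv (dir_deriv f w) v x"
proof (rule euclidean_eqI)
  fix b :: 'f assume "b \<in> Basis"
  note bl = bounded_linear_inner_left[of b]
  have 1: "dir_deriv (\<lambda>x. f x \<bullet> b) v y = dir_deriv f v y \<bullet> b" if "v \<in> E" "y \<in> U" for v y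
    using dir_deriv_linear_comp[OF bl U that(2,1) smooth_on_differentiable[OF U f that(2)]] .
  have 2: "dir_deriv (dir_deriv (\<lambda>x. f x \<bullet> b) v) w x = dir_deriv (dir_deriv f v) w x \<bullet> b"
    if vw: "v \<in> E" "w \<in> E" for v w
  proof -
    have "dir_deriv (dir_deriv (\<lambda>x. f x \<bullet> b) v) w x = dir_deriv (\<lambda>x. dir_deriv f v x \<bullet> b) w x"
      by (rule dir_deriv_cong[OF U x vw(2)]) (simp add: 1 vw)
    also have "\<dots> = dir_deriv (dir_deriv f v) w x \<bullet> b"
      by (rule dir_deriv_linear_comp[OF bl U x vw(2) smooth_on_differentiable[OF U smooth_on_dir_deriv[OF U f vw(1)] x]])
    finally show ?thesis .
  qed
  show "dir_deriv (dir_deriv f v) w x \<bullet> b = dir_deriv (dir_deriv f w) v x \<bullet> b"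
    using 2 vw dir_deriv_commute_real[OF U smooth_on_linear_comp[OF bl f] vw x] by simp
qed

text \<open>The inverse function theorem needs an open subset of the whole space. The map is
  therefore extended by the identity on the orthogonal complement of \<open>E\<close>, and
  afterwards the local inverse is shown to preserve \<open>E\<close>.\<close>

theorem smooth_inverse_function:
  fixes \<tau> :: "'e::euclidean_space \<Rightarrow> 'e"
  assumes U: "rel_open E U" and \<tau>: "smooth_on E U \<tau>" "\<tau> ` U \<subseteq> E" and x0: "x0 \<in> U"
    and inj: "\<And>v. v \<in> E \<Longrightarrow> dir_deriv \<tau> v x0 = 0 \<Longrightarrow> v = 0"
  obtains U' g where "rel_open E U'" "U' \<subseteq> U" "x0 \<in> U'" "rel_open E (\<tau> ` U')"
    "smooth_on E (\<tau> ` U') g" "\<And>x. x \<in> U' \<Longrightarrow> g (\<tau> x) = x"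
proof -
  have E: "subspace E" using U by blast
  obtain B where B: "finite B" "B \<subseteq> E" "\<And>a b. a \<in> B \<Longrightarrow> b \<in> B \<Longrightarrow> a \<bullet> b = (if a = b then 1 else 0)"
    "\<And>v. v \<in> E \<Longrightarrow> (\<Sum>b\<in>B. (v \<bullet> b) *\<^sub>R b) = v"
    using subspace_onb[OF E] by metis
  define P where "P v = (\<Sum>b\<in>B. (v \<bullet> b) *\<^sub>R b)" for v
  have PE: "P v \<in> E" for v unfolding P_def using B(2) E by (auto intro!: subspace_sum subspace_mul)
  have P_id: "P v = v" if "v \<in> E" for v using B(4)[OF that] by (simp add: P_def)
  have P_lin: "linear P" unfolding P_def
    by (auto simp: linear_iff inner_add_left scaleR_add_left sum.distrib scaleR_sum_right)
  have P_bl: "bounded_linear P" using P_lin linear_conv_bounded_linear by blast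
  have P_inner: "P v \<bullet> b = v \<bullet> b" if "b \<in> B" for v b
  proof -
    have "P v \<bullet> b = (\<Sum>a\<in>B. (v \<bullet> a) * (a \<bullet> b))" by (simp add: P_def inner_sum_left)
    also have "\<dots> = (\<Sum>a\<in>B. if a = b then v \<bullet> a else 0)" by (rule sum.cong) (auto simp: B(3) that)
    also have "\<dots> = v \<bullet> b" using B(1) that by simp
    finally show ?thesis .
  qed
  obtain T where T: "open T" "U = E \<inter> T" using U by (auto simp: openin_open)
  define UU where "UU = P -` T"
  have UU: "open UU" unfolding UU_def
    by (intro open_vimage T(1) linear_continuous_on P_bl)
  have PU: "P y \<in> U" if "y \<in> UU" for y using that T(2) PE by (auto simp: UU_def)
  have U_UU: "U \<subseteq> UU" using T(2) P_id by (auto simp: UU_def)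
  \<comment> \<open>With \<open>P\<close> the orthogonal projection to \<open>E\<close>, this
    extension equals \<tau> on \<open>E\<close> and leaves the component \<open>y - P y\<close>
    unchanged; \<open>L y\<close> is its derivative.\<close>
  define \<sigma> where "\<sigma> y = \<tau> (P y) + (y - P y)" for y
  define L where "L y v = (\<Sum>b\<in>B. (v \<bullet> b) *\<^sub>R dir_deriv \<tau> b (P y)) + (v - P v)" for y v
  have L_E: "L x v = dir_deriv \<tau> v x" if "x \<in> U" "v \<in> E" for x v
  proof -
    have "x \<in> E" using that(1) T by auto
    have "dir_deriv \<tau> (\<Sum>b\<in>B. (v \<bullet> b) *\<^sub>R b) x = (\<Sum>b\<in>B. (v \<bullet> b) *\<^sub>R dir_deriv \<tau> b x)"
      by (rule dir_deriv_sum[OF U that(1) smooth_on_differentiable[OF U \<tau>(1) that(1)] B(1)]) (use B(2) in auto)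
    then show ?thesis using B(4)[OF that(2)] P_id[OF that(2)] P_id[OF \<open>x \<in> E\<close>] by (simp add: L_def)
  qed
  have L_lin: "linear (L y)" for y unfolding L_def
    by (auto simp: linear_iff inner_add_left scaleR_add_left sum.distrib scaleR_sum_right
        scaleR_diff_right scaleR_add_right linear_add[OF P_lin] linear_cmul[OF P_lin])
  have L_bl: "bounded_linear (L y)" for y using L_lin linear_conv_bounded_linear by blast
  have der: "(\<sigma> has_derivative blinfun_apply (Blinfun (L y))) (at y)" if y: "y \<in> UU" for y
  proof -
    obtain \<tau>' where \<tau>': "(\<tau> has_derivative \<tau>') (at (P y) within U)"
      using smooth_on_differentiable[OF U \<tau>(1) PU[OF y]] by (auto simp: differentiable_def)
    have "(P has_derivative P) (at y within UU)" using P_bl by (rule bounded_linear_imp_has_derivative)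
    from has_derivative_in_compose[OF this has_derivative_subset[OF \<tau>'], unfolded image_subset_iff]
    have "((\<lambda>y. \<tau> (P y)) has_derivative (\<lambda>v. \<tau>' (P v))) (at y within UU)" using PU by blast
    moreover have "((\<lambda>y. y - P y) has_derivative (\<lambda>v. v - P v)) (at y within UU)"
      using P_bl by (intro has_derivative_diff has_derivative_ident bounded_linear_imp_has_derivative)
    ultimately have d1: "(\<sigma> has_derivative (\<lambda>v. \<tau>' (P v) + (v - P v))) (at y within UU)"
      unfolding \<sigma>_def by (rule has_derivative_add)
    have d2: "\<tau>' (P v) + (v - P v) = L y v" for v
    proof -
      have "\<tau>' (P v) = dir_deriv \<tau> (P v) (P y)" by (rule dir_deriv_eq[OF U PU[OF y] PE \<tau>', symmetric])
      also have "\<dots> = L (P y) (P v)" using L_E[OF PU[OF y] PE] by simp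
      also have "\<dots> = (\<Sum>b\<in>B. (v \<bullet> b) *\<^sub>R dir_deriv \<tau> b (P y))"
        by (simp add: L_def P_id[OF PE] P_inner)
      finally show ?thesis by (simp add: L_def)
    qed
    have "(\<sigma> has_derivative L y) (at y within UU)" using d1 unfolding d2 .
    then show ?thesis
      unfolding bounded_linear_Blinfun_apply[OF L_bl] at_within_open[OF y UU] .
  qed
  have cont: "continuous_on UU (\<lambda>y. Blinfun (L y))"
  proof (rule continuous_on_blinfun_componentwise)
    fix i :: 'e
    have "continuous_on UU (\<lambda>y. dir_deriv \<tau> b (P y))" if "b \<in> B" for b
    proof (rule continuous_on_compose2[of U _ UU P])
      show "continuous_on U (dir_deriv \<tau> b)"
        using that B(2) by (intro smooth_on_continuous[OF smooth_on_dir_deriv[OF U \<tau>(1)]]) auto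
      show "continuous_on UU P" by (rule linear_continuous_on[OF P_bl])
    qed (use PU in auto)
    then have "continuous_on UU (\<lambda>y. L y i)" unfolding L_def by (intro continuous_intros)
    then show "continuous_on UU (\<lambda>y. blinfun_apply (Blinfun (L y)) i)"
      by (simp add: bounded_linear_Blinfun_apply[OF L_bl])
  qed
  \<comment> \<open>Applying \<open>P\<close> to \<open>L x0 v = 0\<close> separates the part in
    \<open>E\<close>, where injectivity is assumed, from the complement, on which
    \<open>L x0\<close> acts as the identity.\<close>
  have "inj (L x0)"
  proof (subst linear_injective_0[OF L_lin], intro allI impI)
    fix v assume v: "L x0 v = 0"
    have "(\<Sum>b\<in>B. (v \<bullet> b) *\<^sub>R dir_deriv \<tau> b (P x0)) = L x0 (P v)"
      by (simp add: L_def P_id[OF PE] P_inner)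
    also have "\<dots> = dir_deriv \<tau> (P v) x0" by (rule L_E[OF x0 PE])
    finally have eq: "dir_deriv \<tau> (P v) x0 + (v - P v) = 0" using v by (simp add: L_def)
    have "dir_deriv \<tau> (P v) x0 \<in> E"
      by (rule dir_deriv_in[OF U x0 PE smooth_on_differentiable[OF U \<tau>(1) x0] E \<tau>(2)])
    then have "P (dir_deriv \<tau> (P v) x0 + (v - P v)) = dir_deriv \<tau> (P v) x0"
      by (simp add: linear_add[OF P_lin] linear_diff[OF P_lin] P_id P_id[OF PE])
    then have "dir_deriv \<tau> (P v) x0 = 0" using eq linear_0[OF P_lin] by simp
    then have "P v = 0" using inj[OF PE] by blast
    then show "v = 0" using eq \<open>dir_deriv \<tau> (P v) x0 = 0\<close> by simp
  qed
  then obtain K where K: "linear K" "K \<circ> L x0 = id"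
    using linear_injective_left_inverse[OF L_lin] by blast
  have Kinv: "Blinfun K o\<^sub>L Blinfun (L x0) = id_blinfun"
    using K L_bl linear_conv_bounded_linear[of K]
    by (intro blinfun_eqI) (simp add: bounded_linear_Blinfun_apply o_def id_def fun_eq_iff)
  obtain U1 V g g' where G: "open U1" "U1 \<subseteq> UU" "x0 \<in> U1" "open V" "homeomorphism U1 V \<sigma> g"
    "\<And>y. y \<in> V \<Longrightarrow> (g has_derivative (g' y)) (at y)"
    "\<And>y. y \<in> V \<Longrightarrow> bij (blinfun_apply (Blinfun (L (g y))))"
    using inverse_function_theorem[OF UU der cont _ Kinv] x0 U_UU by (metis subsetD)
  have g\<sigma>: "g (\<sigma> x) = x" "\<sigma> x \<in> V" if "x \<in> U1" for x using G(5) that by (auto simp: homeomorphism_def)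
  have \<sigma>g: "\<sigma> (g y) = y" "g y \<in> U1" if "y \<in> V" for y using G(5) that by (auto simp: homeomorphism_def)
  have \<sigma>E: "\<sigma> x = \<tau> x" if "x \<in> E" for x using P_id[OF that] by (simp add: \<sigma>_def)
  define U' where "U' = E \<inter> U1"
  have U': "rel_open E U'" using E G(1) by (auto simp: U'_def openin_open)
  have U'U: "U' \<subseteq> U" using G(2) PU P_id by (fastforce simp: U'_def)
  \<comment> \<open>The complementary component of \<open>g y\<close> equals y - \<tau>(P(g y)),
    which lies in \<open>E\<close>; being in \<open>E\<close> and in its orthogonal complement, it
    is zero.\<close>
  have gE: "g y \<in> U'" if "y \<in> E" "y \<in> V" for y
  proof -
    have 1: "g y - P (g y) = y - \<tau> (P (g y))" using \<sigma>g(1)[OF that(2)] by (simp add: \<sigma>_def algebra_simps)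
    have "\<tau> (P (g y)) \<in> E" using \<tau>(2) PU G(2) \<sigma>g(2)[OF that(2)] by blast
    then have "g y - P (g y) \<in> E" unfolding 1 by (intro subspace_diff E that(1))
    then have "g y - P (g y) = P (g y - P (g y))" by (simp add: P_id)
    also have "\<dots> = 0" by (simp add: linear_diff[OF P_lin] P_id[OF PE])
    finally have "g y = P (g y)" by simp
    then have "g y \<in> E" using PE by metis
    then show ?thesis using \<sigma>g(2)[OF that(2)] by (simp add: U'_def)
  qed
  have \<tau>U': "\<tau> ` U' = E \<inter> V"
  proof
    show "\<tau> ` U' \<subseteq> E \<inter> V" using \<tau>(2) U'U \<sigma>E g\<sigma>(2) by (fastforce simp: U'_def)
    show "E \<inter> V \<subseteq> \<tau> ` U'"
    proof
      fix y assume y: "y \<in> E \<inter> V"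
      have "y = \<tau> (g y)" using y gE[of y] \<sigma>E[of "g y"] \<sigma>g(1)[of y] by (auto simp: U'_def)
      then show "y \<in> \<tau> ` U'" using gE[of y] y by blast
    qed
  qed
  have V': "rel_open E (\<tau> ` U')" unfolding \<tau>U' using E G(4) by (auto simp: openin_open)
  have g\<tau>: "g (\<tau> x) = x" if "x \<in> U'" for x using that \<sigma>E[of x] g\<sigma>(1)[of x] by (auto simp: U'_def)
  have \<tau>g: "\<tau> (g y) = y" if "y \<in> \<tau> ` U'" for y using that g\<tau> by auto
  have gU': "g ` (\<tau> ` U') \<subseteq> U'" using g\<tau> by auto
  have gU: "g ` (\<tau> ` U') \<subseteq> U" using gU' U'U by blast
  have gdiff: "g differentiable (at y within \<tau> ` U')" if "y \<in> \<tau> ` U'" for y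
    using G(6)[of y] that unfolding \<tau>U' by (auto simp: differentiable_def intro: has_derivative_at_withinI)
  have Linj: "v = 0" if "x \<in> U'" "v \<in> E" "dir_deriv \<tau> v x = 0" for x v
  proof -
    have "\<tau> x \<in> V" using that(1) \<tau>U' by blast
    from G(7)[OF this] have "inj (L x)"
      by (simp add: g\<tau>[OF that(1)] bounded_linear_Blinfun_apply[OF L_bl] bij_def)
    moreover have "L x v = 0" using L_E[of x v] that U'U by auto
    ultimately show ?thesis using linear_injective_0[OF L_lin] by blast
  qed
  \<comment> \<open>Bootstrapping: the derivative of \<open>g\<close> solves a linear system whose
    coefficients are derivatives of \<tau> at \<open>g y\<close>. If \<open>g\<close> is of class k,
    these coefficients are too, hence so is the solution.\<close>
  have "Ck_on k E (\<tau> ` U') g" for k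
  proof (induction k)
    case 0
    have "continuous_on V g" using G(5) by (simp add: homeomorphism_def)
    then show ?case unfolding \<tau>U' by (auto intro: continuous_on_subset)
  next
    case (Suc k)
    show ?case
    proof (rule Ck_on_SucI[OF V' gdiff])
      fix v assume v: "v \<in> E"
      have DE: "dir_deriv g v y \<in> E" if "y \<in> \<tau> ` U'" for y
        using dir_deriv_in[OF V' that v gdiff[OF that] E] gU rel_open_subset[OF U] by blast
      have C: "Ck_on k E (\<tau> ` U') (\<lambda>y. dir_deriv g v y \<bullet> b)" if "b \<in> B" for b
      proof (rule Ck_on_coefficients[where a = "\<lambda>b y. dir_deriv \<tau> b (g y)" and r = "\<lambda>_. v" and B = B])
        show "Ck_on k E (\<tau> ` U') (\<lambda>y. dir_deriv \<tau> b (g y))" if "b \<in> B" for b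
        proof (rule Ck_on_compose[OF V' U gU Suc])
          show "Ck_on k E U (dir_deriv \<tau> b)"
            using smooth_on_dir_deriv[OF U \<tau>(1), of b] that B(2) by (auto simp: smooth_on_def)
        qed
        show "v = (\<Sum>b\<in>B. (dir_deriv g v y \<bullet> b) *\<^sub>R dir_deriv \<tau> b (g y))" if y: "y \<in> \<tau> ` U'" for y
        proof -
          have gy: "g y \<in> U" using gU y by blast
          note dt = smooth_on_differentiable[OF U \<tau>(1) gy]
          have "v = dir_deriv (\<lambda>y. y) v y" by (simp add: dir_deriv_linear_map bounded_linear_ident)
          also have "\<dots> = dir_deriv (\<lambda>y. \<tau> (g y)) v y"
            by (rule dir_deriv_cong[OF V' y v]) (simp add: \<tau>g)
          also have "\<dots> = dir_deriv \<tau> (dir_deriv g v y) (g y)"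
            by (rule dir_deriv_chain[OF V' U y v gU gdiff[OF y] dt])
          also have "\<dots> = dir_deriv \<tau> (\<Sum>b\<in>B. (dir_deriv g v y \<bullet> b) *\<^sub>R b) (g y)" using B(4)[OF DE[OF y]] by simp
          also have "\<dots> = (\<Sum>b\<in>B. (dir_deriv g v y \<bullet> b) *\<^sub>R dir_deriv \<tau> b (g y))"
            by (rule dir_deriv_sum[OF U gy dt B(1)]) (use B(2) in auto)
          finally show ?thesis .
        qed
        show "d b = 0" if y: "y \<in> \<tau> ` U'" and d: "(\<Sum>b\<in>B. d b *\<^sub>R dir_deriv \<tau> b (g y)) = 0" and b: "b \<in> B"
          for y d b
        proof -
          have gy: "g y \<in> U" "g y \<in> U'" using gU gU' y by blast+
          have "dir_deriv \<tau> (\<Sum>b\<in>B. d b *\<^sub>R b) (g y) = 0" unfolding d[symmetric]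
            by (rule dir_deriv_sum[OF U gy(1) smooth_on_differentiable[OF U \<tau>(1) gy(1)] B(1)]) (use B(2) in auto)
          then have "(\<Sum>b\<in>B. d b *\<^sub>R b) = 0"
            using B(2) by (intro Linj[OF gy(2) _ \<open>dir_deriv \<tau> (\<Sum>b\<in>B. d b *\<^sub>R b) (g y) = 0\<close>] subspace_sum subspace_mul E) auto
          then have "(\<Sum>a\<in>B. d a *\<^sub>R a) \<bullet> b = 0" by simp
          then have "(\<Sum>a\<in>B. d a * (a \<bullet> b)) = 0" by (simp add: inner_sum_left)
          moreover have "(\<Sum>a\<in>B. d a * (a \<bullet> b)) = (\<Sum>a\<in>B. if a = b then d a else 0)"
            by (rule sum.cong) (auto simp: B(3) b)
          ultimately show ?thesis using B(1) b by simp
        qed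
      qed (use that B(1) Ck_on_const in auto)
      have "Ck_on k E (\<tau> ` U') (\<lambda>y. \<Sum>b\<in>B. (dir_deriv g v y \<bullet> b) *\<^sub>R b)"
        by (intro Ck_on_sum Ck_on_bilinear[OF bounded_bilinear_scaleR] C Ck_on_const)
      then show "Ck_on k E (\<tau> ` U') (dir_deriv g v)"
        by (rule Ck_on_cong[THEN iffD1, rotated]) (simp add: B(4) DE)
    qed
  qed
  then have "smooth_on E (\<tau> ` U') g" by (simp add: smooth_on_def)
  moreover have "x0 \<in> U'" using x0 T G(3) by (auto simp: U'_def)
  ultimately show ?thesis using that[OF U' U'U _ V'] g\<tau> by blast
qed

section \<open>Complex structures on a subspace\<close>

definition complex_structure_on :: "'e::euclidean_space set \<Rightarrow> ('e \<Rightarrow> 'e) \<Rightarrow> bool" where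
  "complex_structure_on E I \<longleftrightarrow>
     (\<forall>u\<in>E. I u \<in> E \<and> I (I u) = - u \<and> (\<forall>v\<in>E. \<forall>a. I (u + a *\<^sub>R v) = I u + a *\<^sub>R I v))"

lemma complex_structure_onD:
  assumes "complex_structure_on E I" "subspace E"
  shows "u \<in> E \<Longrightarrow> I u \<in> E" "u \<in> E \<Longrightarrow> I (I u) = - u"
    "u \<in> E \<Longrightarrow> v \<in> E \<Longrightarrow> I (u + v) = I u + I v" "I 0 = 0"
    "u \<in> E \<Longrightarrow> I (a *\<^sub>R u) = a *\<^sub>R I u" "u \<in> E \<Longrightarrow> I (- u) = - I u"
proof -
  note * = assms(1)[unfolded complex_structure_on_def, rule_format]
  have 0: "0 \<in> E" using assms(2) by (rule subspace_0)
  show "u \<in> E \<Longrightarrow> I u \<in> E" "u \<in> E \<Longrightarrow> I (I u) = - u" using * by auto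
  show "u \<in> E \<Longrightarrow> v \<in> E \<Longrightarrow> I (u + v) = I u + I v" for u v using *[of u, THEN conjunct2, THEN conjunct2, rule_format, of v 1] by simp
  show I0: "I 0 = 0" using *[OF 0, THEN conjunct2, THEN conjunct2, rule_format, OF 0, of 1] by simp
  show s: "u \<in> E \<Longrightarrow> I (a *\<^sub>R u) = a *\<^sub>R I u" for u a
    using *[OF 0, THEN conjunct2, THEN conjunct2, rule_format, of u a] I0 by simp
  show "u \<in> E \<Longrightarrow> I (- u) = - I u" using s[of u "-1"] by simp
qed

lemma complex_structure_on_sum:
  assumes "complex_structure_on E I" "subspace E" "finite S" "\<And>b. b \<in> S \<Longrightarrow> w b \<in> E"
  shows "I (\<Sum>b\<in>S. a b *\<^sub>R w b) = (\<Sum>b\<in>S. a b *\<^sub>R I (w b))"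
  using assms(3,4)
proof (induction S rule: finite_induct)
  case empty
  then show ?case using complex_structure_onD(4)[OF assms(1,2)] by simp
next
  case (insert b S)
  then have "a b *\<^sub>R w b \<in> E" "(\<Sum>b\<in>S. a b *\<^sub>R w b) \<in> E"
    using assms(2) by (auto intro!: subspace_mul subspace_sum)
  then show ?case
    using insert complex_structure_onD(3,5)[OF assms(1,2)] by simp
qed

section \<open>Derivatives in complex directions\<close>

text \<open>For \<open>c = - \<i>\<close> and \<open>c = \<i>\<close> this is the derivative in the direction of the (1,0)-part and of the
  (0,1)-part of \<open>v\<close>.\<close>

definition cdd :: "complex \<Rightarrow> ('e::euclidean_space \<Rightarrow> 'e) \<Rightarrow> 'e \<Rightarrow> ('e \<Rightarrow> complex) \<Rightarrow> 'e \<Rightarrow> complex" where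
  "cdd c I v f x = (dir_deriv f v x + c * dir_deriv f (I v) x) / 2"

lemma cdd_cong:
  assumes "rel_open E U" "complex_structure_on E I" "x \<in> U" "v \<in> E" "\<And>x. x \<in> U \<Longrightarrow> f x = g x"
  shows "cdd c I v f x = cdd c I v g x"
  using dir_deriv_cong[OF assms(1,3) _ assms(5)] complex_structure_onD(1)[OF assms(2)] assms(1,4)
  by (simp add: cdd_def)

lemma cdd_smooth:
  assumes "rel_open E U" "complex_structure_on E I" "smooth_on E U f" "v \<in> E"
  shows "smooth_on E U (cdd c I v f)"
proof -
  have "smooth_on E U (\<lambda>x. (dir_deriv f v x + c * dir_deriv f (I v) x) * (1 / 2))"
    using assms complex_structure_onD(1)[OF assms(2)]
    by (intro smooth_on_mult smooth_on_add smooth_on_const smooth_on_dir_deriv) auto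
  then show ?thesis by (simp add: cdd_def[abs_def])
qed

lemma cdd_add:
  assumes "rel_open E U" "complex_structure_on E I" "x \<in> U" "v \<in> E" "smooth_on E U f" "smooth_on E U g"
  shows "cdd c I v (\<lambda>x. f x + g x) x = cdd c I v f x + cdd c I v g x"
  using dir_deriv_add[OF assms(1,3) _ smooth_on_differentiable[OF assms(1,5,3)] smooth_on_differentiable[OF assms(1,6,3)]]
    complex_structure_onD(1)[OF assms(2)] assms(1,4)
  by (simp add: cdd_def algebra_simps add_divide_distrib)

lemma cdd_mult:
  assumes "rel_open E U" "complex_structure_on E I" "x \<in> U" "v \<in> E" "smooth_on E U f" "smooth_on E U g"
  shows "cdd c I v (\<lambda>x. f x * g x) x = f x * cdd c I v g x + cdd c I v f x * g x"
  using dir_deriv_mult[OF assms(1,3) _ smooth_on_differentiable[OF assms(1,5,3)] smooth_on_differentiable[OF assms(1,6,3)]]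
    complex_structure_onD(1)[OF assms(2)] assms(1,4)
  by (simp add: cdd_def field_simps)

lemma cdd_sum:
  assumes "rel_open E U" "complex_structure_on E I" "x \<in> U" "v \<in> E" "\<And>i. i \<in> S \<Longrightarrow> smooth_on E U (f i)"
  shows "cdd c I v (\<lambda>x. \<Sum>i\<in>S. f i x) x = (\<Sum>i\<in>S. cdd c I v (f i) x)"
proof -
  have "I v \<in> E" using assms complex_structure_onD by blast
  moreover have "dir_deriv (\<lambda>x. \<Sum>i\<in>S. f i x) w x = (\<Sum>i\<in>S. dir_deriv (f i) w x)" if "w \<in> E" for w
    by (rule dir_deriv_sum_fun[OF assms(1,3) that]) (rule smooth_on_differentiable[OF assms(1,5,3)])
  ultimately show ?thesis
    using assms(4) by (simp add: cdd_def sum.distrib sum_distrib_left flip: sum_divide_distrib)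
qed

lemma dir_deriv_lincomb:
  fixes f g :: "'e::euclidean_space \<Rightarrow> complex"
  assumes "rel_open E U" "x \<in> U" "v \<in> E" "smooth_on E U f" "smooth_on E U g"
  shows "dir_deriv (\<lambda>x. (f x + c * g x) / 2) v x = (dir_deriv f v x + c * dir_deriv g v x) / 2"
proof -
  note df = smooth_on_differentiable[OF assms(1,4,2)] and dg = smooth_on_differentiable[OF assms(1,5,2)]
  have bl: "bounded_linear (\<lambda>z::complex. c * z)" "bounded_linear (\<lambda>z::complex. z / 2)"
    by (simp_all add: bounded_linear_mult_right bounded_linear_divide)
  have "(\<lambda>x. f x + c * g x) differentiable (at x within U)" "(\<lambda>x. c * g x) differentiable (at x within U)"
    using df dg by (auto intro!: differentiable_add differentiable_mult)
  then show ?thesis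
    by (simp add: dir_deriv_linear_comp[OF bl(2) assms(1-3)] dir_deriv_add[OF assms(1-3)] df dg
        dir_deriv_linear_comp[OF bl(1) assms(1-3)])
qed

lemma dir_deriv_cdd_expand:
  assumes "rel_open E U" "complex_structure_on E I" "x \<in> U" "v \<in> E" "w \<in> E" "smooth_on E U f"
  shows "dir_deriv (cdd c I v f) w x = (dir_deriv (dir_deriv f v) w x + c * dir_deriv (dir_deriv f (I v)) w x) / 2"
proof -
  have Iv: "I v \<in> E" using assms complex_structure_onD by blast
  show ?thesis
    unfolding cdd_def[abs_def]
    by (rule dir_deriv_lincomb[OF assms(1,3,5)]) (use assms Iv in \<open>auto intro: smooth_on_dir_deriv\<close>)
qed

lemma dir_deriv_cdd:
  assumes "rel_open E U" "complex_structure_on E I" "x \<in> U" "v \<in> E" "w \<in> E" "smooth_on E U f"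
  shows "dir_deriv (cdd c I v f) w x = cdd c I v (dir_deriv f w) x"
proof -
  have Iv: "I v \<in> E" using assms complex_structure_onD by blast
  show ?thesis unfolding dir_deriv_cdd_expand[OF assms]
    using dir_deriv_commute[OF assms(1,6) assms(4,5,3)] dir_deriv_commute[OF assms(1,6) Iv assms(5,3)]
    by (simp add: cdd_def)
qed

lemma cdd_commute:
  assumes "rel_open E U" "complex_structure_on E I" "x \<in> U" "v \<in> E" "w \<in> E" "smooth_on E U f"
  shows "cdd c I v (cdd d I w f) x = cdd d I w (cdd c I v f) x"
proof -
  have Iv: "I v \<in> E" "I w \<in> E" using assms complex_structure_onD by blast+
  have "cdd c I v (cdd d I w f) x = (cdd d I w (dir_deriv f v) x + c * cdd d I w (dir_deriv f (I v)) x) / 2"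
    using dir_deriv_cdd[OF assms(1-3,5) assms(4,6)] dir_deriv_cdd[OF assms(1-3,5) Iv(1) assms(6)]
    by (simp add: cdd_def[of c])
  also have "\<dots> = cdd d I w (cdd c I v f) x"
    unfolding cdd_def[of d] dir_deriv_cdd_expand[OF assms(1-3,4) assms(5,6)]
      dir_deriv_cdd_expand[OF assms(1-3,4) Iv(2) assms(6)]
    by (simp add: field_simps)
  finally show ?thesis .
qed

lemma cdd_dir_sum:
  assumes "rel_open E U" "complex_structure_on E I" "x \<in> U" "finite S" "\<And>b. b \<in> S \<Longrightarrow> w b \<in> E" "smooth_on E U f"
  shows "cdd c I (\<Sum>b\<in>S. a b *\<^sub>R w b) f x = (\<Sum>b\<in>S. of_real (a b) * cdd c I (w b) f x)"
proof -
  have E: "subspace E" using assms by blast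
  note df = smooth_on_differentiable[OF assms(1,6,3)]
  note cs = complex_structure_onD[OF assms(2) E]
  have "I (\<Sum>b\<in>S. a b *\<^sub>R w b) = (\<Sum>b\<in>S. a b *\<^sub>R I (w b))"
    by (rule complex_structure_on_sum[OF assms(2) E assms(4,5)])
  then show ?thesis
    using dir_deriv_sum[OF assms(1,3) df assms(4), of w a] dir_deriv_sum[OF assms(1,3) df assms(4), of "\<lambda>b. I (w b)" a]
      assms(5) cs(1)
    by (simp add: cdd_def sum_distrib_left sum_divide_distrib sum.distrib[symmetric] scaleR_conv_of_real field_simps)
qed

text \<open>Expresses that the (1,0)-derivative is complex linear and the (0,1)-derivative complex
  antilinear in the direction: the factor is \<i> for c = -\<i> and -\<i> for c = \<i>.\<close>

lemma cdd_rotate: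
  assumes "rel_open E U" "complex_structure_on E I" "x \<in> U" "v \<in> E" "smooth_on E U f" "c * c = -1"
  shows "cdd c I (I v) f x = - c * cdd c I v f x"
proof -
  have "dir_deriv f (I (I v)) x = - dir_deriv f v x"
    using assms complex_structure_onD(2)[OF assms(2), of v] dir_deriv_linear(3)[OF assms(1,3) smooth_on_differentiable[OF assms(1,5,3)], of v v]
    by simp
  moreover have "c * (c * z) = - z" for z using assms(6) by (simp add: mult.assoc[symmetric])
  ultimately show ?thesis by (simp add: cdd_def ring_distribs add_divide_distrib)
qed

text \<open>A differential that commutes with the complex structures preserves types, so the type of
  the derivative is the same on both sides. The commutation is required only at the point and
  direction in question.\<close>

lemma cdd_chain:
  assumes U: "rel_open E U" and V: "rel_open E' V" and cs: "complex_structure_on E J" "complex_structure_on E' I"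
    and F: "smooth_on E U F" "F ` U \<subseteq> V" and f: "smooth_on E' V f" and x: "x \<in> U" and v: "v \<in> E"
    and JI: "dir_deriv F (J v) x = I (dir_deriv F v x)"
  shows "cdd c J v (\<lambda>x. f (F x)) x = cdd c I (dir_deriv F v x) f (F x)"
proof -
  have Jv: "J v \<in> E" using cs(1) v U complex_structure_onD by blast
  have "F x \<in> V" using F x by auto
  note d = dir_deriv_chain[OF U V x _ F(2) smooth_on_differentiable[OF U F(1) x] smooth_on_differentiable[OF V f this]]
  show ?thesis using d[OF v] d[OF Jv] JI by (simp add: cdd_def)
qed

section \<open>Jets and weights\<close>

abbreviation iter_deriv :: "nat \<Rightarrow> 'e::euclidean_space \<Rightarrow> ('e \<Rightarrow> 'f::euclidean_space) \<Rightarrow> 'e \<Rightarrow> 'f" where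
  "iter_deriv n X \<equiv> (\<lambda>f. dir_deriv f X) ^^ n"

text \<open>As a function of \<open>X\<close> this is the homogeneous part of degree
  \<open>n\<close> of the Taylor series of \<open>u\<close> at 0; differentiating along the line
  through \<open>X\<close> avoids multi-indices.\<close>

definition jet :: "nat \<Rightarrow> ('e::euclidean_space \<Rightarrow> complex) \<Rightarrow> 'e \<Rightarrow> complex" where
  "jet n u X = iter_deriv n X u 0 / fact n"

lemma iter_deriv_smooth:
  "rel_open E U \<Longrightarrow> X \<in> E \<Longrightarrow> smooth_on E U u \<Longrightarrow> smooth_on E U (iter_deriv n X u)"
  by (induction n) (auto intro: smooth_on_dir_deriv)

lemma iter_deriv_cong:
  assumes "rel_open E U" "X \<in> E" "\<And>x. x \<in> U \<Longrightarrow> u x = v x" "x \<in> U"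
  shows "iter_deriv n X u x = iter_deriv n X v x"
  using assms(4)
proof (induction n arbitrary: x)
  case (Suc n)
  then show ?case using dir_deriv_cong[OF assms(1) Suc.prems assms(2) Suc.IH] by simp
qed (simp add: assms(3))

lemma iter_deriv_lincomb:
  fixes u v :: "'e::euclidean_space \<Rightarrow> complex"
  assumes "rel_open E U" "X \<in> E" "smooth_on E U u" "smooth_on E U v" "x \<in> U"
  shows "iter_deriv n X (\<lambda>x. (u x + c * v x) / 2) x = (iter_deriv n X u x + c * iter_deriv n X v x) / 2"
  using assms(5)
proof (induction n arbitrary: x)
  case (Suc n)
  have "iter_deriv (Suc n) X (\<lambda>x. (u x + c * v x) / 2) x
      = dir_deriv (\<lambda>x. (iter_deriv n X u x + c * iter_deriv n X v x) / 2) X x"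
    using dir_deriv_cong[OF assms(1) Suc.prems assms(2) Suc.IH] by simp
  also have "\<dots> = (iter_deriv (Suc n) X u x + c * iter_deriv (Suc n) X v x) / 2"
    using dir_deriv_lincomb[OF assms(1) Suc.prems assms(2) iter_deriv_smooth[OF assms(1-3)] iter_deriv_smooth[OF assms(1,2,4)]]
    by simp
  finally show ?case .
qed simp

lemma iter_deriv_diff:
  fixes u v :: "'e::euclidean_space \<Rightarrow> complex"
  assumes "rel_open E U" "X \<in> E" "smooth_on E U u" "smooth_on E U v" "x \<in> U"
  shows "iter_deriv n X (\<lambda>x. u x - v x) x = iter_deriv n X u x - iter_deriv n X v x"
  using assms(5)
proof (induction n arbitrary: x)
  case (Suc n)
  note s = iter_deriv_smooth[OF assms(1-3)] iter_deriv_smooth[OF assms(1,2,4)]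
  have "iter_deriv (Suc n) X (\<lambda>x. u x - v x) x = dir_deriv (\<lambda>x. iter_deriv n X u x + - iter_deriv n X v x) X x"
    using dir_deriv_cong[OF assms(1) Suc.prems assms(2) Suc.IH] by simp
  also have "\<dots> = iter_deriv (Suc n) X u x - iter_deriv (Suc n) X v x"
    using dir_deriv_add[OF assms(1) Suc.prems assms(2) smooth_on_differentiable[OF assms(1) s(1) Suc.prems]
        smooth_on_differentiable[OF assms(1) smooth_on_minus[OF s(2)] Suc.prems]]
      dir_deriv_linear_comp[OF bounded_linear_minus[OF bounded_linear_ident] assms(1) Suc.prems assms(2)
        smooth_on_differentiable[OF assms(1) s(2) Suc.prems]]
    by simp
  finally show ?case .
qed simp

lemma iter_deriv_Suc_right: "iter_deriv (Suc n) X u = iter_deriv n X (dir_deriv u X)"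
  unfolding funpow_Suc_right by simp

text \<open>The n-th derivative is a symmetric multilinear form evaluated on the diagonal. Splitting
  one factor X + s Y linearly gives a term handled by induction and a term with the factor s, whose
  derivative at s = 0 is the form itself.\<close>

lemma iter_deriv_direction:
  fixes u :: "'e::euclidean_space \<Rightarrow> complex"
  assumes U: "rel_open E U" and XY: "X \<in> E" "Y \<in> E" and x: "x \<in> U" and u: "smooth_on E U u"
  shows "((\<lambda>s. iter_deriv n (X + s *\<^sub>R Y) u x) has_vector_derivative
           of_nat n * iter_deriv (n - 1) X (dir_deriv u Y) x) (at 0)"
  using u
proof (induction n arbitrary: u)
  case 0
  then show ?case by simp
next
  case (Suc n)
  have E: "X + s *\<^sub>R Y \<in> E" for s using XY U by (auto intro: subspace_add subspace_mul)
  note du = smooth_on_dir_deriv[OF U Suc.prems XY(1)] smooth_on_dir_deriv[OF U Suc.prems XY(2)]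
  have eq: "iter_deriv (Suc n) (X + s *\<^sub>R Y) u x =
      iter_deriv n (X + s *\<^sub>R Y) (dir_deriv u X) x + s *\<^sub>R iter_deriv n (X + s *\<^sub>R Y) (dir_deriv u Y) x" for s
  proof -
    have sY: "s *\<^sub>R Y \<in> E" using XY U by (auto intro: subspace_mul)
    have "iter_deriv (Suc n) (X + s *\<^sub>R Y) u x = iter_deriv n (X + s *\<^sub>R Y) (dir_deriv u (X + s *\<^sub>R Y)) x"
      by (simp only: iter_deriv_Suc_right)
    \<comment> \<open>The factors 2 only bring the sum into the shape (u + c v) / 2 of
      \<open>iter_deriv_lincomb\<close>.\<close>
    also have "\<dots> = iter_deriv n (X + s *\<^sub>R Y) (\<lambda>x. (2 * dir_deriv u X x + of_real s * (2 * dir_deriv u Y x)) / 2) x"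
    proof (rule iter_deriv_cong[OF U E _ x])
      fix y assume y: "y \<in> U"
      note d = smooth_on_differentiable[OF U Suc.prems y]
      show "dir_deriv u (X + s *\<^sub>R Y) y = (2 * dir_deriv u X y + of_real s * (2 * dir_deriv u Y y)) / 2"
        using dir_deriv_linear(1)[OF U y d XY(1) sY] dir_deriv_linear(2)[OF U y d XY(2) XY(2), of s]
        by (simp add: scaleR_conv_of_real)
    qed
    also have "\<dots> = (iter_deriv n (X + s *\<^sub>R Y) (\<lambda>x. 2 * dir_deriv u X x) x
        + of_real s * iter_deriv n (X + s *\<^sub>R Y) (\<lambda>x. 2 * dir_deriv u Y x) x) / 2"
      by (rule iter_deriv_lincomb[OF U E _ _ x]) (use du in \<open>auto intro!: smooth_on_mult smooth_on_const\<close>)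
    \<comment> \<open>The value c = 3 with both functions equal gives (u + 3 u) / 2 = 2 u, so the
      same lemma pulls out the factor 2.\<close>
    also have "iter_deriv n (X + s *\<^sub>R Y) (\<lambda>x. 2 * dir_deriv u X x) x = 2 * iter_deriv n (X + s *\<^sub>R Y) (dir_deriv u X) x"
      using iter_deriv_lincomb[OF U E[of s] du(1) du(1) x, where c = 3 and n = n] by simp
    also have "iter_deriv n (X + s *\<^sub>R Y) (\<lambda>x. 2 * dir_deriv u Y x) x = 2 * iter_deriv n (X + s *\<^sub>R Y) (dir_deriv u Y) x"
      using iter_deriv_lincomb[OF U E[of s] du(2) du(2) x, where c = 3 and n = n] by simp
    also have "(2 * iter_deriv n (X + s *\<^sub>R Y) (dir_deriv u X) x
        + of_real s * (2 * iter_deriv n (X + s *\<^sub>R Y) (dir_deriv u Y) x)) / 2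
        = iter_deriv n (X + s *\<^sub>R Y) (dir_deriv u X) x + s *\<^sub>R iter_deriv n (X + s *\<^sub>R Y) (dir_deriv u Y) x"
      by (simp add: scaleR_conv_of_real field_simps)
    finally show ?thesis .
  qed
  have d: "((\<lambda>s. iter_deriv n (X + s *\<^sub>R Y) (dir_deriv u X) x + s *\<^sub>R iter_deriv n (X + s *\<^sub>R Y) (dir_deriv u Y) x)
      has_vector_derivative
      of_nat n * iter_deriv (n - 1) X (dir_deriv (dir_deriv u X) Y) x
      + (0 *\<^sub>R (of_nat n * iter_deriv (n - 1) X (dir_deriv (dir_deriv u Y) Y) x)
        + 1 *\<^sub>R iter_deriv n (X + 0 *\<^sub>R Y) (dir_deriv u Y) x)) (at 0)"
    by (intro has_vector_derivative_add has_vector_derivative_scaleR Suc.IH du DERIV_ident)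
  \<comment> \<open>For n = 0 the truncated \<open>n - 1\<close> is harmless because of the factor
    n; otherwise the derivatives along \<open>X\<close> and \<open>Y\<close> commute.\<close>
  have e: "of_nat n * iter_deriv (n - 1) X (dir_deriv (dir_deriv u X) Y) x
      = of_nat n * iter_deriv n X (dir_deriv u Y) x"
  proof (cases n)
    case (Suc m)
    have "iter_deriv m X (dir_deriv (dir_deriv u X) Y) x = iter_deriv m X (dir_deriv (dir_deriv u Y) X) x"
      by (rule iter_deriv_cong[OF U XY(1) _ x]) (rule dir_deriv_commute[OF U Suc.prems XY])
    then show ?thesis unfolding Suc iter_deriv_Suc_right by simp
  qed simp
  show ?case unfolding eq using d[unfolded e] by (simp add: algebra_simps)
qed

lemma dir_deriv_jet:
  assumes U: "rel_open E U" and XY: "X \<in> E" "Y \<in> E" and x: "0 \<in> U" and u: "smooth_on E U u"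
  shows "dir_deriv (jet (Suc n) u) Y X = jet n (dir_deriv u Y) X"
proof -
  have "((\<lambda>s. iter_deriv (Suc n) (X + s *\<^sub>R Y) u 0 / fact (Suc n)) has_vector_derivative
          (of_nat (Suc n) * iter_deriv n X (dir_deriv u Y) 0) / fact (Suc n)) (at 0)"
    by (rule bounded_linear.has_vector_derivative[OF bounded_linear_divide])
      (use iter_deriv_direction[OF U XY x u, of "Suc n"] in simp)
  then have "vector_derivative (\<lambda>s. jet (Suc n) u (X + s *\<^sub>R Y)) (at 0)
      = (of_nat (Suc n) * iter_deriv n X (dir_deriv u Y) 0) / fact (Suc n)"
    unfolding jet_def by (rule vector_derivative_at)
  also have "\<dots> = jet n (dir_deriv u Y) X"
    unfolding jet_def fact_Suc of_nat_mult by (simp del: of_nat_Suc)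
  finally show ?thesis unfolding dir_deriv_def[of "jet (Suc n) u"] .
qed

text \<open>Differentiation commutes with Taylor expansion and lowers the degree by one. This turns
  statements about bidegrees of Taylor polynomials into statements about derivatives of
  \<open>u\<close>.\<close>

lemma jet_cdd:
  assumes U: "rel_open E U" and cs: "complex_structure_on E I" and XY: "X \<in> E" "Y \<in> E" and x: "0 \<in> U"
    and u: "smooth_on E U u"
  shows "jet n (cdd c I Y u) X = cdd c I Y (jet (Suc n) u) X"
proof -
  have IY: "I Y \<in> E" using cs XY U complex_structure_onD by blast
  have "jet n (cdd c I Y u) X = (jet n (dir_deriv u Y) X + c * jet n (dir_deriv u (I Y)) X) / 2"
    unfolding jet_def cdd_def[abs_def]
    using iter_deriv_lincomb[OF U XY(1) smooth_on_dir_deriv[OF U u XY(2)] smooth_on_dir_deriv[OF U u IY] x, of n c]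
    by (simp add: field_simps)
  then show ?thesis
    using dir_deriv_jet[OF U XY(1) XY(2) x u] dir_deriv_jet[OF U XY(1) IY x u] by (simp add: cdd_def)
qed

text \<open>A function has weight \<open>k\<close> if it is multiplied by \<open>exp (\<i> k t)\<close> under the rotation \<open>exp (t I)\<close>.
  The components of weight at most \<open>m\<close> of a Taylor polynomial of degree \<open>n\<close> are those of bidegree
  \<open>(a, b)\<close> with \<open>a + b = n\<close> and \<open>a - b \<le> m\<close>.\<close>

definition has_weight :: "'e::euclidean_space set \<Rightarrow> ('e \<Rightarrow> 'e) \<Rightarrow> int \<Rightarrow> ('e \<Rightarrow> complex) \<Rightarrow> bool" where
  "has_weight E I k z \<longleftrightarrow> smooth_on E E z \<and> (\<forall>X\<in>E. dir_deriv z (I X) X = \<i> * of_int k * z X)"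

definition weights_le :: "'e::euclidean_space set \<Rightarrow> ('e \<Rightarrow> 'e) \<Rightarrow> int \<Rightarrow> ('e \<Rightarrow> complex) \<Rightarrow> bool" where
  "weights_le E I m q \<longleftrightarrow> (\<exists>S z. finite S \<and> (\<forall>k\<in>S. k \<le> m \<and> has_weight E I k (z k)) \<and>
     (\<forall>X\<in>E. q X = (\<Sum>k\<in>S. z k X)))"

lemma rel_open_self: "subspace E \<Longrightarrow> rel_open E E" by simp

text \<open>Differentiating the weight identity of \<open>z\<close> along W gives an extra term,
  since the rotation field I X depends on X. On (0,1)-combinations (c = \<i>) this term raises the
  weight by one, on (1,0)-combinations (c = -\<i>) it lowers it by one.\<close>

lemma has_weight_cdd:
  assumes E: "subspace E" and cs: "complex_structure_on E I" and Y: "Y \<in> E" and z: "has_weight E I k z"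
    and c: "c = \<i> \<or> c = - \<i>" and k': "of_int k' = of_int k - \<i> * c"
  shows "has_weight E I k' (cdd c I Y z)"
proof -
  note U = rel_open_self[OF E]
  have zs: "smooth_on E E z" and zw: "\<And>X. X \<in> E \<Longrightarrow> dir_deriv z (I X) X = \<i> * of_int k * z X"
    using z by (auto simp: has_weight_def)
  note I = complex_structure_onD[OF cs E]
  have d: "dir_deriv (dir_deriv z W) (I X) X = \<i> * of_int k * dir_deriv z W X - dir_deriv z (I W) X"
    if W: "W \<in> E" and X: "X \<in> E" for W X
  proof -
    have "((\<lambda>s. dir_deriv z (I X) (X + s *\<^sub>R W) + s *\<^sub>R dir_deriv z (I W) (X + s *\<^sub>R W)) has_vector_derivative
        dir_deriv (dir_deriv z (I X)) W (X + 0 *\<^sub>R W) + (0 *\<^sub>R dir_deriv (dir_deriv z (I W)) W (X + 0 *\<^sub>R W)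
          + 1 *\<^sub>R dir_deriv z (I W) (X + 0 *\<^sub>R W))) (at 0)"
      using X W I(1)
      by (intro has_vector_derivative_add has_vector_derivative_scaleR line_has_vector_derivative[OF U]
          smooth_on_differentiable[OF U] smooth_on_dir_deriv[OF U zs] DERIV_ident) auto
    moreover have "dir_deriv z (I X) (X + s *\<^sub>R W) + s *\<^sub>R dir_deriv z (I W) (X + s *\<^sub>R W)
        = \<i> * of_int k * z (X + s *\<^sub>R W)" for s
    proof -
      have XW: "X + s *\<^sub>R W \<in> E" "s *\<^sub>R W \<in> E" using X W E by (auto intro: subspace_add subspace_mul)
      note dz = smooth_on_differentiable[OF U zs XW(1)]
      have "dir_deriv z (I (X + s *\<^sub>R W)) (X + s *\<^sub>R W) = dir_deriv z (I X) (X + s *\<^sub>R W) + s *\<^sub>R dir_deriv z (I W) (X + s *\<^sub>R W)"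
        using dir_deriv_linear(1)[OF U XW(1) dz, of "I X" "s *\<^sub>R I W"] dir_deriv_linear(2)[OF U XW(1) dz, of "I W" "I W" s]
          I X W XW(2) E by (simp add: subspace_mul)
      then show ?thesis using zw[OF XW(1)] by simp
    qed
    ultimately have "((\<lambda>s. \<i> * of_int k * z (X + s *\<^sub>R W)) has_vector_derivative
        dir_deriv (dir_deriv z (I X)) W X + dir_deriv z (I W) X) (at 0)" by simp
    moreover have "((\<lambda>s. \<i> * of_int k * z (X + s *\<^sub>R W)) has_vector_derivative
        \<i> * of_int k * dir_deriv z W (X + 0 *\<^sub>R W)) (at 0)"
      using X W by (intro bounded_linear.has_vector_derivative[OF bounded_linear_mult_right]
          line_has_vector_derivative[OF U] smooth_on_differentiable[OF U zs]) auto
    ultimately have "dir_deriv (dir_deriv z (I X)) W X + dir_deriv z (I W) X = \<i> * of_int k * dir_deriv z W X"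
      using vector_derivative_unique_at by fastforce
    then show ?thesis
      using dir_deriv_commute[OF U zs I(1)[OF X] W X] by (simp add: algebra_simps)
  qed
  have "dir_deriv (cdd c I Y z) (I X) X = \<i> * of_int k' * cdd c I Y z X" if X: "X \<in> E" for X
  proof -
    have IY: "I Y \<in> E" and IX: "I X \<in> E" using I(1) X Y by auto
    have "dir_deriv (cdd c I Y z) (I X) X = (dir_deriv (dir_deriv z Y) (I X) X + c * dir_deriv (dir_deriv z (I Y)) (I X) X) / 2"
      unfolding cdd_def[abs_def]
      by (rule dir_deriv_lincomb[OF U X IX]) (use Y IY zs in \<open>auto intro: smooth_on_dir_deriv[OF U]\<close>)
    moreover have "dir_deriv z (I (I Y)) X = - dir_deriv z Y X"
      using I(2)[OF Y] dir_deriv_linear(3)[OF U X smooth_on_differentiable[OF U zs X] Y Y] by simp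
    ultimately have "dir_deriv (cdd c I Y z) (I X) X = (\<i> * of_int k * dir_deriv z Y X - dir_deriv z (I Y) X
        + c * (\<i> * of_int k * dir_deriv z (I Y) X + dir_deriv z Y X)) / 2"
      by (simp add: d[OF Y X] d[OF IY X])
    then show ?thesis using c unfolding k' by (auto simp: cdd_def field_simps)
  qed
  then show ?thesis using cdd_smooth[OF U cs zs Y] by (simp add: has_weight_def)
qed

lemma weights_le_cdd:
  assumes E: "subspace E" and cs: "complex_structure_on E I" and Y: "Y \<in> E" and q: "weights_le E I m q"
    and c: "c = \<i> \<and> e = 1 \<or> c = - \<i> \<and> e = -1"
  shows "weights_le E I (m + e) (cdd c I Y q)"
proof -
  note U = rel_open_self[OF E]
  obtain S z where S: "finite S" "\<And>k. k \<in> S \<Longrightarrow> k \<le> m" "\<And>k. k \<in> S \<Longrightarrow> has_weight E I k (z k)"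
    "\<And>X. X \<in> E \<Longrightarrow> q X = (\<Sum>k\<in>S. z k X)" using q by (auto simp: weights_le_def)
  have "cdd c I Y q X = (\<Sum>k\<in>(\<lambda>k. k + e) ` S. cdd c I Y (z (k - e)) X)" if "X \<in> E" for X
  proof -
    have "cdd c I Y q X = cdd c I Y (\<lambda>X. \<Sum>k\<in>S. z k X) X" by (rule cdd_cong[OF U cs that Y S(4)])
    also have "\<dots> = (\<Sum>k\<in>S. cdd c I Y (z k) X)"
      by (rule cdd_sum[OF U cs that Y]) (use S(3) in \<open>auto simp: has_weight_def\<close>)
    finally show ?thesis by (subst sum.reindex) (auto simp: inj_on_def)
  qed
  moreover have "has_weight E I k (cdd c I Y (z (k - e)))" if "k \<in> (\<lambda>k. k + e) ` S" for k
    using that c S(3) by (intro has_weight_cdd[OF E cs Y, of "k - e"]) auto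
  ultimately show ?thesis
    unfolding weights_le_def
    by (intro exI[of _ "(\<lambda>k. k + e) ` S"] exI[of _ "\<lambda>k. cdd c I Y (z (k - e))"]) (use S in auto)
qed

text \<open>For bidegree (a, b) with a + b = n the bound a - b \<le> n - c means 2 b \<ge> c: every
  Taylor term contains at least c / 2 antiholomorphic factors.\<close>

definition jet_weights :: "'e::euclidean_space set \<Rightarrow> ('e \<Rightarrow> 'e) \<Rightarrow> int \<Rightarrow> ('e \<Rightarrow> complex) \<Rightarrow> bool" where
  "jet_weights E I c u \<longleftrightarrow> (\<forall>n. weights_le E I (int n - c) (jet n u))"

lemma weights_le_cong:
  "(\<And>X. X \<in> E \<Longrightarrow> q X = q' X) \<Longrightarrow> weights_le E I m q = weights_le E I m q'"
  unfolding weights_le_def by simp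

text \<open>Either derivative lowers the degree by one. A (0,1)-derivative raises the weight by one,
  so the defect drops by 2; a (1,0)-derivative lowers the weight as well, so the defect is
  kept.\<close>

lemma jet_weights_cdd:
  assumes U: "rel_open E U" "0 \<in> U" and cs: "complex_structure_on E I" and Y: "Y \<in> E"
    and u: "smooth_on E U u" "jet_weights E I m u" and c: "c = \<i> \<and> e = 2 \<or> c = - \<i> \<and> e = 0"
  shows "jet_weights E I (m - e) (cdd c I Y u)"
  unfolding jet_weights_def
proof
  fix n
  have "weights_le E I (int n - (m - e)) (cdd c I Y (jet (Suc n) u))"
    using weights_le_cdd[OF _ cs Y u(2)[unfolded jet_weights_def, rule_format, of "Suc n"], of c "e - 1"] U c
    by (auto simp: algebra_simps)
  then show "weights_le E I (int n - (m - e)) (jet n (cdd c I Y u))"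
    by (rule weights_le_cong[THEN iffD1, rotated]) (rule jet_cdd[OF U(1) cs _ Y U(2) u(1), symmetric])
qed

text \<open>The constant term has only components of negative weight. The rotation fixes the origin,
  so a component of nonzero weight vanishes there.\<close>

lemma jet_weights_zero:
  assumes E: "subspace E" and cs: "complex_structure_on E I" and "jet_weights E I m u" "m > 0"
  shows "u 0 = 0"
proof -
  have 0: "0 \<in> E" using E by (rule subspace_0)
  have "weights_le E I (int 0 - m) (jet 0 u)" using assms(3) unfolding jet_weights_def by blast
  then obtain S z where S: "\<And>k. k \<in> S \<Longrightarrow> k \<le> - m" "\<And>k. k \<in> S \<Longrightarrow> has_weight E I k (z k)"
    "\<And>X. X \<in> E \<Longrightarrow> jet 0 u X = (\<Sum>k\<in>S. z k X)" by (auto simp: weights_le_def)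
  have "z k 0 = 0" if "k \<in> S" for k
  proof -
    have "dir_deriv (z k) (I 0) 0 = \<i> * of_int k * z k 0" using S(2)[OF that] 0 by (simp add: has_weight_def)
    moreover have "dir_deriv (z k) (I 0) 0 = 0"
      by (simp add: complex_structure_onD(4)[OF cs E] dir_deriv_def)
    ultimately show ?thesis using S(1)[OF that] assms(4) by auto
  qed
  then show ?thesis using S(3)[OF 0] by (simp add: jet_def)
qed

section \<open>Vanishing of iterated derivatives\<close>

text \<open>Requires all derivatives up to order k to vanish at 0, not only the k-th: the Leibniz
  rule needs the lower orders too. The recursion hands \<open>D u\<close> to the induction, as
  proofs about differential equations require.\<close>

primrec vanishes :: "(('e::real_vector \<Rightarrow> complex) \<Rightarrow> 'e \<Rightarrow> complex) \<Rightarrow> nat \<Rightarrow> ('e \<Rightarrow> complex) \<Rightarrow> bool" where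
  "vanishes D 0 u \<longleftrightarrow> u 0 = 0"
| "vanishes D (Suc k) u \<longleftrightarrow> u 0 = 0 \<and> vanishes D k (D u)"

lemma vanishes_lower: "vanishes D (Suc k) u \<Longrightarrow> vanishes D k u"
  by (induction k arbitrary: u) auto

lemma vanishes_funpow: "vanishes D k u \<Longrightarrow> (D ^^ k) u 0 = 0"
  by (induction k arbitrary: u) (auto simp: funpow_swap1)

context
  fixes E U :: "'e::euclidean_space set" and I :: "'e \<Rightarrow> 'e" and X :: 'e and c :: complex
  assumes U: "rel_open E U" and U0: "0 \<in> U" and cs: "complex_structure_on E I" and X: "X \<in> E"
begin

lemma vanishes_cong:
  assumes "\<And>x. x \<in> U \<Longrightarrow> u x = v x"
  shows "vanishes (cdd c I X) k u \<longleftrightarrow> vanishes (cdd c I X) k v"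
  using assms
proof (induction k arbitrary: u v)
  case (Suc k)
  have "vanishes (cdd c I X) k (cdd c I X u) \<longleftrightarrow> vanishes (cdd c I X) k (cdd c I X v)"
    by (rule Suc.IH) (rule cdd_cong[OF U cs _ X Suc.prems])
  then show ?case using Suc.prems[OF U0] by simp
qed (use U0 in simp)

lemma vanishes_add:
  assumes "smooth_on E U u" "smooth_on E U v" "vanishes (cdd c I X) k u" "vanishes (cdd c I X) k v"
  shows "vanishes (cdd c I X) k (\<lambda>x. u x + v x)"
  using assms
proof (induction k arbitrary: u v)
  case (Suc k)
  have "vanishes (cdd c I X) k (\<lambda>x. cdd c I X u x + cdd c I X v x)"
    using Suc by (intro Suc.IH cdd_smooth[OF U cs _ X]) auto
  then have "vanishes (cdd c I X) k (cdd c I X (\<lambda>x. u x + v x))"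
    by (rule vanishes_cong[THEN iffD1, rotated]) (rule cdd_add[OF U cs _ X Suc.prems(1,2), symmetric])
  then show ?case using Suc.prems by simp
qed simp

text \<open>By the Leibniz rule the functions with vanishing jet form an ideal, so the linear
  systems below may have arbitrary smooth coefficients.\<close>

lemma vanishes_mult:
  assumes "smooth_on E U u" "smooth_on E U v" "vanishes (cdd c I X) k v"
  shows "vanishes (cdd c I X) k (\<lambda>x. u x * v x)"
  using assms
proof (induction k arbitrary: u v)
  case (Suc k)
  have "vanishes (cdd c I X) k (\<lambda>x. u x * cdd c I X v x + cdd c I X u x * v x)"
    using Suc.prems vanishes_lower[OF Suc.prems(3)]
    by (intro vanishes_add Suc.IH smooth_on_mult cdd_smooth[OF U cs _ X]) auto
  then have "vanishes (cdd c I X) k (cdd c I X (\<lambda>x. u x * v x))"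
    by (rule vanishes_cong[THEN iffD1, rotated]) (rule cdd_mult[OF U cs _ X Suc.prems(1,2), symmetric])
  then show ?case using Suc.prems by simp
qed simp

lemma vanishes_sum:
  assumes "finite S" "\<And>i. i \<in> S \<Longrightarrow> smooth_on E U (u i)" "\<And>i. i \<in> S \<Longrightarrow> vanishes (cdd c I X) k (u i)"
  shows "vanishes (cdd c I X) k (\<lambda>x. \<Sum>i\<in>S. u i x)"
  using assms
proof (induction S rule: finite_induct)
  case empty
  have "vanishes (cdd c I X) k (\<lambda>x. 0)" by (induction k) (simp_all add: cdd_def[abs_def] dir_deriv_const)
  then show ?case by simp
next
  case (insert i S)
  have "vanishes (cdd c I X) k (\<lambda>x. u i x + (\<Sum>i\<in>S. u i x))"
    using insert by (intro vanishes_add smooth_on_sum) auto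
  then show ?case using insert.hyps by simp
qed

end

text \<open>A function satisfying the Cauchy-Riemann equation in the complex direction of \<open>X\<close> is
  holomorphic on the complex line through \<open>X\<close>, so its jet at the origin determines its value at \<open>X\<close>.\<close>

lemma holomorphic_vanishes:
  assumes U: "rel_open E U" "0 \<in> U" "convex U" and cs: "complex_structure_on E I" and X: "X \<in> U"
    and u: "smooth_on E U u" and CR: "\<And>x. x \<in> U \<Longrightarrow> dir_deriv u (I X) x = \<i> * dir_deriv u X x"
    and van: "\<And>k. vanishes (cdd (-\<i>) I X) k u"
  shows "u X = 0"
proof -
  have XE: "X \<in> E" "I X \<in> E" using X U rel_open_subset[OF U(1)] complex_structure_onD(1)[OF cs] by auto
  \<comment> \<open>Parametrizes the complex line through \<open>X\<close>, with L 0 = 0 and L 1 =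
    X; convexity of \<open>U\<close> makes its preimage \<open>S\<close> connected, as the identity
    theorem requires.\<close>
  define L where "L s = Re s *\<^sub>R X + Im s *\<^sub>R I X" for s
  have L_bl: "bounded_linear L" unfolding L_def
    by (intro bounded_linear_add bounded_linear_compose[OF bounded_linear_scaleR_left] bounded_linear_Re bounded_linear_Im)
  have LE: "L s \<in> E" for s using XE U by (auto simp: L_def intro: subspace_add subspace_mul)
  define S where "S = L -` U"
  obtain T where T: "open T" "U = E \<inter> T" using U by (auto simp: openin_open)
  have "S = L -` T" using LE T by (auto simp: S_def)
  then have opS: "open S" by (simp add: open_vimage[OF T(1)] linear_continuous_on[OF L_bl])
  have conS: "connected S" unfolding S_def
    by (intro convex_connected convex_linear_vimage bounded_linear.linear L_bl U)
  let ?D = "cdd (-\<i>) I X"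
  have line: "((\<lambda>s. v (L s)) has_field_derivative ?D v (L s)) (at s)"
    and eqD: "?D v (L s) = dir_deriv v X (L s)"
    if s: "s \<in> S" and v: "smooth_on E U v" and CRv: "\<And>x. x \<in> U \<Longrightarrow> dir_deriv v (I X) x = \<i> * dir_deriv v X x" for v s
  proof -
    have Ls: "L s \<in> U" using s by (simp add: S_def)
    show eqD: "?D v (L s) = dir_deriv v X (L s)" using CRv[OF Ls] by (simp add: cdd_def)
    obtain v' where v': "(v has_derivative v') (at (L s) within U)"
      using smooth_on_differentiable[OF U(1) v Ls] by (auto simp: differentiable_def)
    have "(L has_derivative L) (at s within S)" using L_bl by (rule bounded_linear_imp_has_derivative)
    from has_derivative_in_compose[OF this has_derivative_subset[OF v']]
    have "((\<lambda>s. v (L s)) has_derivative (\<lambda>h. v' (L h))) (at s)"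
      unfolding at_within_open[OF s opS] by (auto simp: S_def)
    moreover have "v' (L h) = ?D v (L s) * h" for h
    proof -
      have lin: "linear v'" using v' by (rule has_derivative_linear)
      have "v' (L h) = Re h *\<^sub>R v' X + Im h *\<^sub>R v' (I X)"
        by (simp add: L_def linear_add[OF lin] linear_cmul[OF lin])
      also have "v' X = dir_deriv v X (L s)" by (rule dir_deriv_eq[OF U(1) Ls XE(1) v', symmetric])
      also have "v' (I X) = \<i> * dir_deriv v X (L s)"
        unfolding CRv[OF Ls, symmetric] by (rule dir_deriv_eq[OF U(1) Ls XE(2) v', symmetric])
      also have "Re h *\<^sub>R dir_deriv v X (L s) + Im h *\<^sub>R (\<i> * dir_deriv v X (L s))
          = dir_deriv v X (L s) * (of_real (Re h) + \<i> * of_real (Im h))"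
        by (simp add: scaleR_conv_of_real algebra_simps)
      also have "of_real (Re h) + \<i> * of_real (Im h) = h" by (rule complex_eq[symmetric])
      finally show ?thesis using eqD by simp
    qed
    ultimately show "((\<lambda>s. v (L s)) has_field_derivative ?D v (L s)) (at s)"
      by (simp add: has_field_derivative_def)
  qed
  \<comment> \<open>The Cauchy-Riemann equation passes to all iterated derivatives, so each of them
    is the complex derivative of the previous one along the line.\<close>
  have iter: "smooth_on E U ((?D ^^ k) u) \<and> (\<forall>x\<in>U. dir_deriv ((?D ^^ k) u) (I X) x = \<i> * dir_deriv ((?D ^^ k) u) X x)" for k
  proof (induction k)
    case 0
    then show ?case using u CR by simp
  next
    case (Suc k)
    let ?v = "(?D ^^ k) u"
    have sv: "smooth_on E U ?v" and CRv: "\<And>x. x \<in> U \<Longrightarrow> dir_deriv ?v (I X) x = \<i> * dir_deriv ?v X x" using Suc by auto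
    have "dir_deriv (?D ?v) (I X) x = \<i> * dir_deriv (?D ?v) X x" if x: "x \<in> U" for x
    proof -
      have "dir_deriv (?D ?v) (I X) x = ?D (dir_deriv ?v (I X)) x"
        by (rule dir_deriv_cdd[OF U(1) cs x XE sv])
      also have "\<dots> = ?D (\<lambda>x. \<i> * dir_deriv ?v X x) x"
        by (rule cdd_cong[OF U(1) cs x XE(1) CRv])
      also have "\<dots> = \<i> * ?D (dir_deriv ?v X) x"
        using cdd_mult[OF U(1) cs x XE(1) smooth_on_const smooth_on_dir_deriv[OF U(1) sv XE(1)], of "-\<i>" \<i>]
        by (simp add: cdd_def dir_deriv_const)
      also have "?D (dir_deriv ?v X) x = dir_deriv (?D ?v) X x"
        by (rule dir_deriv_cdd[OF U(1) cs x XE(1) XE(1) sv, symmetric])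
      finally show ?thesis .
    qed
    then show ?case using cdd_smooth[OF U(1) cs sv XE(1)] by simp
  qed
  define H where "H s = u (L s)" for s
  have der: "(deriv ^^ k) H s = (?D ^^ k) u (L s)" if "s \<in> S" for k s
    using that
  proof (induction k arbitrary: s)
    case (Suc k)
    have "deriv ((deriv ^^ k) H) s = deriv (\<lambda>s. (?D ^^ k) u (L s)) s"
      by (intro deriv_cong_ev eventually_mono[OF eventually_nhds_in_open[OF opS Suc.prems]]) (use Suc.IH in auto)
    also have "\<dots> = ?D ((?D ^^ k) u) (L s)"
      by (rule DERIV_imp_deriv, rule line[OF Suc.prems]) (use iter[of k] in auto)
    finally show ?case by simp
  qed (simp add: H_def)
  have "H 1 = 0"
  proof (rule holomorphic_fun_eq_0_on_connected[of H S 0 1, OF _ opS conS])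
    show "H holomorphic_on S"
      unfolding holomorphic_on_open[OF opS] H_def using line[OF _ u CR] by blast
    have S0: "0 \<in> S" using U(2) by (simp add: S_def L_def)
    then show "0 \<in> S" .
    show "1 \<in> S" using X by (simp add: S_def L_def)
    show "(deriv ^^ k) H 0 = 0" for k
      using der[OF S0] vanishes_funpow[OF van] by (simp add: L_def)
  qed
  then show ?thesis by (simp add: H_def L_def)
qed

section \<open>The metric in normal coordinates\<close>

locale metric_chart =
  fixes E U :: "'e::euclidean_space set" and g :: "'e \<Rightarrow> 'e \<Rightarrow> 'e \<Rightarrow> real"
  assumes U: "rel_open E U"
    and g_sym: "\<And>x u w. x \<in> U \<Longrightarrow> u \<in> E \<Longrightarrow> w \<in> E \<Longrightarrow> g x u w = g x w u"
    and g_lin: "\<And>x u v w a. x \<in> U \<Longrightarrow> u \<in> E \<Longrightarrow> v \<in> E \<Longrightarrow> w \<in> E \<Longrightarrow> g x (u + a *\<^sub>R v) w = g x u w + a * g x v w"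
    and g_pos: "\<And>x u. x \<in> U \<Longrightarrow> u \<in> E \<Longrightarrow> u \<noteq> 0 \<Longrightarrow> g x u u > 0"
    and g_smooth: "\<And>u w. u \<in> E \<Longrightarrow> w \<in> E \<Longrightarrow> smooth_on E U (\<lambda>x. g x u w)"
begin

lemma E: "subspace E" using U by blast

lemma g_simps:
  assumes "x \<in> U" "u \<in> E" "v \<in> E" "w \<in> E"
  shows "g x (u + v) w = g x u w + g x v w" "g x u (v + w) = g x u v + g x u w"
    "g x (a *\<^sub>R u) w = a * g x u w" "g x u (a *\<^sub>R w) = a * g x u w"
    "g x 0 w = 0" "g x u 0 = 0" "g x (- u) w = - g x u w" "g x u (- w) = - g x u w"
    "g x (u - v) w = g x u w - g x v w"
proof -
  have 0: "0 \<in> E" and m: "- u \<in> E" "- v \<in> E" and vw: "v + w \<in> E" "a *\<^sub>R w \<in> E"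
    using assms E by (auto intro: subspace_0 subspace_neg subspace_add subspace_mul)
  show z: "g x 0 w = 0" using g_lin[OF assms(1) 0 0 assms(4), of 1] by simp
  show z': "g x u 0 = 0" using g_lin[OF assms(1) 0 0 assms(2), of 1] g_sym[OF assms(1,2) 0] by simp
  show "g x (u + v) w = g x u w + g x v w" using g_lin[OF assms, of 1] by simp
  show "g x u (v + w) = g x u v + g x u w"
    using g_lin[OF assms(1,3,4,2), of 1] g_sym[OF assms(1,2)] assms vw by simp
  have s: "g x (a *\<^sub>R u) w = a * g x u w" for a using g_lin[OF assms(1) 0 assms(2,4), of a] z by simp
  have s': "g x u (a *\<^sub>R w) = a * g x u w" for a
  proof -
    have "a *\<^sub>R w \<in> E" using assms E by (auto intro: subspace_mul)
    then show ?thesis using g_lin[OF assms(1) 0 assms(4,2), of a] g_sym[OF assms(1,2)] assms(4) 0 z' by simp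
  qed
  show "g x (a *\<^sub>R u) w = a * g x u w" "g x u (a *\<^sub>R w) = a * g x u w" by (rule s s')+
  show "g x (- u) w = - g x u w" using s[of "-1"] by simp
  show "g x u (- w) = - g x u w" using s'[of "-1"] by simp
  show "g x (u - v) w = g x u w - g x v w" using g_lin[OF assms, of "-1"] by simp
qed

lemma g_sum:
  assumes "x \<in> U" "finite S" "\<And>i. i \<in> S \<Longrightarrow> v i \<in> E" "w \<in> E"
  shows "g x (\<Sum>i\<in>S. a i *\<^sub>R v i) w = (\<Sum>i\<in>S. a i * g x (v i) w)"
    "g x w (\<Sum>i\<in>S. a i *\<^sub>R v i) = (\<Sum>i\<in>S. a i * g x w (v i))"
proof -
  have "(\<Sum>i\<in>T. a i *\<^sub>R v i) \<in> E \<and> g x (\<Sum>i\<in>T. a i *\<^sub>R v i) w = (\<Sum>i\<in>T. a i * g x (v i) w)" if "T \<subseteq> S" for T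
    using finite_subset[OF that assms(2)] that
  proof (induction T rule: finite_induct)
    case empty
    then show ?case using g_simps(5)[OF assms(1,4,4,4)] subspace_0[OF E] by simp
  next
    case (insert i T)
    have "a i *\<^sub>R v i \<in> E" using insert assms(3) E by (auto intro: subspace_mul)
    then show ?case using insert assms E
      by (simp add: g_simps(1,3)[where w = w] subspace_add)
  qed
  then have 1: "(\<Sum>i\<in>S. a i *\<^sub>R v i) \<in> E" and 2: "g x (\<Sum>i\<in>S. a i *\<^sub>R v i) w = (\<Sum>i\<in>S. a i * g x (v i) w)" by auto
  show "g x (\<Sum>i\<in>S. a i *\<^sub>R v i) w = (\<Sum>i\<in>S. a i * g x (v i) w)" by (rule 2)
  show "g x w (\<Sum>i\<in>S. a i *\<^sub>R v i) = (\<Sum>i\<in>S. a i * g x w (v i))"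
    using 2 g_sym[OF assms(1,4)] 1 assms(3) by simp
qed

lemma g_eq_zero: "x \<in> U \<Longrightarrow> u \<in> E \<Longrightarrow> (\<And>z. z \<in> E \<Longrightarrow> g x u z = 0) \<Longrightarrow> u = 0"
  using g_pos[of x u] by force

lemma g_cancel:
  assumes "x \<in> U" "u \<in> E" "v \<in> E" "\<And>z. z \<in> E \<Longrightarrow> g x u z = g x v z"
  shows "u = v"
proof -
  have "u - v \<in> E" using assms E by (auto intro: subspace_diff)
  moreover have "g x (u - v) z = 0" if "z \<in> E" for z using assms g_simps(9)[OF assms(1-3) that] that by simp
  ultimately show ?thesis using g_eq_zero[OF assms(1), of "u - v"] by auto
qed

text \<open>Positive definiteness makes the Gram map of \<open>g\<close> injective on
  \<open>E\<close>, hence surjective for reasons of dimension. Uniqueness follows from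
  nondegeneracy.\<close>

lemma riesz:
  assumes x: "x \<in> U" and l: "\<And>z z' a. z \<in> E \<Longrightarrow> z' \<in> E \<Longrightarrow> l (z + a *\<^sub>R z') = l z + a * l z'"
  shows "\<exists>!y. y \<in> E \<and> (\<forall>z\<in>E. g x y z = l z)"
proof -
  obtain B where B: "finite B" "B \<subseteq> E" "\<And>a b. a \<in> B \<Longrightarrow> b \<in> B \<Longrightarrow> a \<bullet> b = (if a = b then 1 else 0)"
    "\<And>v. v \<in> E \<Longrightarrow> (\<Sum>b\<in>B. (v \<bullet> b) *\<^sub>R b) = v" using subspace_onb[OF E] by metis
  have BE: "b \<in> E" if "b \<in> B" for b using that B(2) by blast
  \<comment> \<open>The Gram map: \<open>G y\<close> has the coordinates \<open>g x y b\<close>. It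
    is written through the coordinates of \<open>y\<close> because \<open>g x\<close> is linear on
    \<open>E\<close> only.\<close>
  define G where "G y = (\<Sum>b\<in>B. (\<Sum>a\<in>B. (y \<bullet> a) * g x a b) *\<^sub>R b)" for y
  have G_lin: "linear G"
    by (auto simp: G_def linear_iff inner_add_left sum.distrib scaleR_add_left scaleR_sum_right sum_distrib_left algebra_simps)
  have G_in: "G y \<in> E" for y unfolding G_def using BE by (intro subspace_sum subspace_mul E) auto
  have coord: "(\<Sum>b\<in>B. d b *\<^sub>R b) \<bullet> c = d c" if "c \<in> B" for d c
  proof -
    have "(\<Sum>b\<in>B. d b *\<^sub>R b) \<bullet> c = (\<Sum>b\<in>B. if b = c then d b else 0)"
      unfolding inner_sum_left by (rule sum.cong) (auto simp: B(3) that)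
    then show ?thesis using B(1) that by simp
  qed
  have G_inner: "G y \<bullet> c = g x y c" if "y \<in> E" "c \<in> B" for y c
    unfolding G_def coord[OF that(2)]
    using g_sum(1)[OF x B(1) BE BE[OF that(2)], where v = "\<lambda>b. b" and a = "\<lambda>b. y \<bullet> b"] B(4)[OF that(1)] by simp
  have g_expand: "g x y z = (\<Sum>b\<in>B. (z \<bullet> b) * g x y b)" if "y \<in> E" "z \<in> E" for y z
    using g_sum(2)[OF x B(1) BE that(1), where v = "\<lambda>b. b" and a = "\<lambda>b. z \<bullet> b"] B(4)[OF that(2)] by simp
  have G0: "y = 0" if "y \<in> E" "G y = 0" for y
    using g_eq_zero[OF x that(1)] g_expand[OF that(1)] G_inner[OF that(1)] that(2) by simp
  have "inj_on G (span E)"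
    unfolding span_eq_iff[THEN iffD2, OF E]
    by (rule linear_injective_on_subspace_0[THEN iffD2, OF G_lin E]) (use G0 in blast)
  then have "dim (G ` E) = dim E" using dim_image_eq[OF G_lin] by blast
  moreover have "G ` E \<subseteq> E" using G_in by blast
  ultimately have GE: "G ` E = E"
    using subspace_dim_equal[of "G ` E" E] linear_subspace_image[OF G_lin E] E by simp
  have "(\<Sum>b\<in>B. l b *\<^sub>R b) \<in> G ` E" unfolding GE using BE by (intro subspace_sum subspace_mul E) auto
  then obtain y where y: "y \<in> E" "G y = (\<Sum>b\<in>B. l b *\<^sub>R b)" by auto
  have l0: "l 0 = 0" using l[of 0 0 1] subspace_0[OF E] by simp
  have l_sum: "(\<Sum>b\<in>T. d b *\<^sub>R b) \<in> E \<and> l (\<Sum>b\<in>T. d b *\<^sub>R b) = (\<Sum>b\<in>T. d b * l b)" if "T \<subseteq> B" for T d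
    using finite_subset[OF that B(1)] that
  proof (induction T rule: finite_induct)
    case empty
    then show ?case using l0 subspace_0[OF E] by simp
  next
    case (insert b T)
    then have b: "b \<in> E" and s: "(\<Sum>b\<in>T. d b *\<^sub>R b) \<in> E" using BE by auto
    have "l (d b *\<^sub>R b + (\<Sum>b\<in>T. d b *\<^sub>R b)) = d b * l b + l (\<Sum>b\<in>T. d b *\<^sub>R b)"
      using l[OF s b, of "d b"] by (simp add: add.commute)
    then show ?case using insert b s subspace_add[OF E] subspace_mul[OF E] by simp
  qed
  have "g x y z = l z" if z: "z \<in> E" for z
  proof -
    have "g x y z = (\<Sum>b\<in>B. (z \<bullet> b) * (G y \<bullet> b))" using g_expand[OF y(1) z] G_inner[OF y(1)] by simp
    also have "\<dots> = (\<Sum>b\<in>B. (z \<bullet> b) * l b)" using coord y(2) by simp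
    also have "\<dots> = l z" using l_sum[OF order_refl, of "\<lambda>b. z \<bullet> b"] B(4)[OF z] by simp
    finally show ?thesis .
  qed
  then show ?thesis using y(1) g_cancel[OF x] by (intro ex1I[of _ y]) auto
qed

text \<open>Existence and uniqueness here justify the definite description in
  \<open>christoffel\<close>. The point is that the Koszul expression is linear in
  \<open>z\<close>.\<close>

lemma koszul_unique:
  assumes x: "x \<in> U" and u: "u \<in> E" and w: "w \<in> E"
  shows "\<exists>!y. y \<in> E \<and> (\<forall>z\<in>E. g x y z =
    (dir_deriv (\<lambda>x. g x w z) u x + dir_deriv (\<lambda>x. g x u z) w x - dir_deriv (\<lambda>x. g x u w) z x) / 2)"
proof (rule riesz[OF x])
  fix z z' a assume z: "z \<in> E" "z' \<in> E"
  have az: "a *\<^sub>R z' \<in> E" using z(2) E by (auto intro: subspace_mul)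
  have lin: "dir_deriv (\<lambda>x. g x v (z + a *\<^sub>R z')) t x = dir_deriv (\<lambda>x. g x v z) t x + a * dir_deriv (\<lambda>x. g x v z') t x"
    if v: "v \<in> E" and t: "t \<in> E" for v t
  proof -
    note dif = smooth_on_differentiable[OF U _ x]
    have "dir_deriv (\<lambda>x. g x v (z + a *\<^sub>R z')) t x = dir_deriv (\<lambda>x. g x v z + a * g x v z') t x"
      by (rule dir_deriv_cong[OF U x t]) (simp add: g_simps(2)[OF _ v z(1) az] g_simps(4)[OF _ v v z(2)])
    also have "\<dots> = dir_deriv (\<lambda>x. g x v z) t x + dir_deriv (\<lambda>x. a * g x v z') t x"
      by (intro dir_deriv_add[OF U x t] dif g_smooth smooth_on_mult smooth_on_const v z)
    also have "dir_deriv (\<lambda>x. a * g x v z') t x = a * dir_deriv (\<lambda>x. g x v z') t x"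
      by (rule dir_deriv_linear_comp[OF bounded_linear_mult_right U x t dif[OF g_smooth[OF v z(2)]]])
    finally show ?thesis .
  qed
  note dg = smooth_on_differentiable[OF U g_smooth[OF u w] x]
  show "(dir_deriv (\<lambda>x. g x w (z + a *\<^sub>R z')) u x + dir_deriv (\<lambda>x. g x u (z + a *\<^sub>R z')) w x
      - dir_deriv (\<lambda>x. g x u w) (z + a *\<^sub>R z') x) / 2
    = (dir_deriv (\<lambda>x. g x w z) u x + dir_deriv (\<lambda>x. g x u z) w x - dir_deriv (\<lambda>x. g x u w) z x) / 2
    + a * ((dir_deriv (\<lambda>x. g x w z') u x + dir_deriv (\<lambda>x. g x u z') w x - dir_deriv (\<lambda>x. g x u w) z' x) / 2)"
    unfolding lin[OF w u] lin[OF u w] dir_deriv_linear(1)[OF U x dg z(1) az] dir_deriv_linear(2)[OF U x dg z(2) z(2)]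
    by (simp add: field_simps)
qed

end

text \<open>The coordinate picture of M in normal coordinates at p = 0. The complex structure
  \<open>I\<close> does not depend on the point, so its parallelism becomes
  \<open>\<Gamma>_I\<close>. The 4 in \<open>taylor\<close> encodes at least two antiholomorphic
  factors.\<close>

locale kaehler_chart = metric_chart E U g
  for E U :: "'e::euclidean_space set" and g :: "'e \<Rightarrow> 'e \<Rightarrow> 'e \<Rightarrow> real" +
  fixes I :: "'e \<Rightarrow> 'e" and \<Gamma> :: "'e \<Rightarrow> 'e \<Rightarrow> 'e \<Rightarrow> 'e" and \<Theta> :: "'e \<Rightarrow> complex"
  assumes U0: "0 \<in> U" and cs: "complex_structure_on E I"
    and g_I: "\<And>x u w. x \<in> U \<Longrightarrow> u \<in> E \<Longrightarrow> w \<in> E \<Longrightarrow> g x (I u) (I w) = g x u w"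
    and \<Gamma>_in: "\<And>x u w. x \<in> U \<Longrightarrow> u \<in> E \<Longrightarrow> w \<in> E \<Longrightarrow> \<Gamma> x u w \<in> E"
    and koszul: "\<And>x u w z. x \<in> U \<Longrightarrow> u \<in> E \<Longrightarrow> w \<in> E \<Longrightarrow> z \<in> E \<Longrightarrow> g x (\<Gamma> x u w) z =
      (dir_deriv (\<lambda>x. g x w z) u x + dir_deriv (\<lambda>x. g x u z) w x - dir_deriv (\<lambda>x. g x u w) z x) / 2"
    and \<Gamma>_I: "\<And>x u w. x \<in> U \<Longrightarrow> u \<in> E \<Longrightarrow> w \<in> E \<Longrightarrow> \<Gamma> x u (I w) = I (\<Gamma> x u w)"
    and \<Theta>: "smooth_on E U \<Theta>"
    and potential: "\<And>x u w. x \<in> U \<Longrightarrow> u \<in> E \<Longrightarrow> w \<in> E \<Longrightarrow> of_real (g x (I u) w) =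
      \<i> / 2 * (cdd (-\<i>) I u (cdd \<i> I w \<Theta>) x - cdd (-\<i>) I w (cdd \<i> I u \<Theta>) x)"
    and taylor: "jet_weights E I 4 (\<lambda>x. \<Theta> x - of_real (g 0 x x))"
begin

lemmas I = complex_structure_onD[OF cs E]

lemma \<Gamma>_sym:
  assumes "x \<in> U" "u \<in> E" "w \<in> E" shows "\<Gamma> x u w = \<Gamma> x w u"
proof (rule g_cancel[OF assms(1)])
  fix z assume z: "z \<in> E"
  have "dir_deriv (\<lambda>x. g x u w) z x = dir_deriv (\<lambda>x. g x w u) z x"
    by (rule dir_deriv_cong[OF U assms(1) z]) (rule g_sym[OF _ assms(2,3)])
  then show "g x (\<Gamma> x u w) z = g x (\<Gamma> x w u) z" using koszul[OF assms z] koszul[OF assms(1,3,2) z] by simp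
qed (use assms in \<open>auto intro: \<Gamma>_in\<close>)

text \<open>The Koszul formulas for (a, b; c) and (a, c; b) are added; by symmetry of
  \<open>g\<close> all terms other than the derivative along \<open>a\<close> cancel.\<close>

lemma metric_compatible:
  assumes "x \<in> U" "a \<in> E" "b \<in> E" "c \<in> E"
  shows "dir_deriv (\<lambda>x. g x b c) a x = g x (\<Gamma> x a b) c + g x b (\<Gamma> x a c)"
proof -
  have sw: "dir_deriv (\<lambda>x. g x u w) z x = dir_deriv (\<lambda>x. g x w u) z x" if "u \<in> E" "w \<in> E" "z \<in> E" for u w z
    by (rule dir_deriv_cong[OF U assms(1) that(3)]) (rule g_sym[OF _ that(1,2)])
  have "g x b (\<Gamma> x a c) = g x (\<Gamma> x a c) b" using assms by (intro g_sym \<Gamma>_in) auto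
  then show ?thesis
    using koszul[OF assms] koszul[OF assms(1,2,4,3)] sw[OF assms(3,4,2)] by (simp add: field_simps)
qed

text \<open>The sign makes the form complex linear in \<open>u\<close> and antilinear in
  \<open>n\<close>; the cancellation of the covariant derivatives of \<open>n\<close> rests on
  this.\<close>

definition h :: "'e \<Rightarrow> 'e \<Rightarrow> 'e \<Rightarrow> complex" where
  "h x u n = of_real (g x u n) - \<i> * of_real (g x (I u) n)"

lemma g_I_right: "x \<in> U \<Longrightarrow> u \<in> E \<Longrightarrow> n \<in> E \<Longrightarrow> g x u (I n) = - g x (I u) n"
  using g_I[of x u "I n"] I(1,2)[of n] I(1)[of u] g_simps(8)[of x "I u" n n] by simp

lemma h_I:
  assumes "x \<in> U" "u \<in> E" "n \<in> E"
  shows "h x (I u) n = \<i> * h x u n" "h x u (I n) = - \<i> * h x u n"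
  using g_simps(7)[OF assms(1,2,2,3)] g_I_right[OF assms] g_I[OF assms] I(2)[OF assms(2)]
  by (simp_all add: h_def algebra_simps)

lemma h_sum:
  assumes "x \<in> U" "finite S" "\<And>i. i \<in> S \<Longrightarrow> v i \<in> E" "n \<in> E"
  shows "h x (\<Sum>i\<in>S. a i *\<^sub>R v i) n = (\<Sum>i\<in>S. of_real (a i) * h x (v i) n)"
proof -
  have "I (\<Sum>i\<in>S. a i *\<^sub>R v i) = (\<Sum>i\<in>S. a i *\<^sub>R I (v i))"
    by (rule complex_structure_on_sum[OF cs E assms(2,3)])
  then show ?thesis
    using g_sum(1)[OF assms(1-4), where a = a] g_sum(1)[OF assms(1,2) _ assms(4), where v = "\<lambda>i. I (v i)" and a = a] assms(3) I(1)
    by (simp add: h_def sum_subtractf[symmetric] sum_distrib_left algebra_simps)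
qed

text \<open>The potential equation gives only the imaginary part of \<open>h\<close>. Applied to
  \<open>I u\<close> in place of \<open>u\<close> it also gives \<open>g x u n\<close>, and in the
  combination the mixed derivative with exchanged arguments drops out.\<close>

lemma h_eq_potential:
  assumes x: "x \<in> U" and un: "u \<in> E" "n \<in> E"
  shows "h x u n = cdd (-\<i>) I u (cdd \<i> I n \<Theta>) x"
proof -
  let ?A = "cdd (-\<i>) I u (cdd \<i> I n \<Theta>) x" and ?B = "cdd (-\<i>) I n (cdd \<i> I u \<Theta>) x"
  note s = cdd_smooth[OF U cs \<Theta>]
  have Iu: "I u \<in> E" using un I by blast
  have 1: "cdd (-\<i>) I (I u) (cdd \<i> I n \<Theta>) x = \<i> * ?A"
    using cdd_rotate[OF U cs x un(1) s[OF un(2)], of "-\<i>"] by simp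
  have "cdd (-\<i>) I n (cdd \<i> I (I u) \<Theta>) x = cdd \<i> I (I u) (cdd (-\<i>) I n \<Theta>) x"
    by (rule cdd_commute[OF U cs x un(2) Iu \<Theta>])
  also have "\<dots> = - \<i> * cdd \<i> I u (cdd (-\<i>) I n \<Theta>) x"
    using cdd_rotate[OF U cs x un(1) s[OF un(2)], of "\<i>"] by simp
  also have "cdd \<i> I u (cdd (-\<i>) I n \<Theta>) x = ?B"
    by (rule cdd_commute[OF U cs x un \<Theta>])
  finally have 2: "cdd (-\<i>) I n (cdd \<i> I (I u) \<Theta>) x = - \<i> * ?B" .
  have "complex_of_real (- g x u n) = \<i> / 2 * (\<i> * ?A + \<i> * ?B)"
    using potential[OF x Iu un(2)] 1 2 I(2)[OF un(1)] g_simps(7)[OF x un(1,1,2)] by simp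
  moreover have "\<i> / 2 * (\<i> * ?A + \<i> * ?B) = - ((?A + ?B) / 2)"
    by (simp add: ring_distribs mult.assoc[symmetric] add_divide_distrib)
  ultimately have "complex_of_real (- g x u n) = - ((?A + ?B) / 2)" by (rule trans)
  then have g1: "complex_of_real (g x u n) = (?A + ?B) / 2"
    unfolding of_real_minus neg_equal_iff_equal .
  have "(?A + ?B) / 2 - \<i> * (\<i> / 2 * (?A - ?B)) = ?A"
    by (simp add: ring_distribs mult.assoc[symmetric] add_divide_distrib diff_divide_distrib)
  then show ?thesis unfolding h_def potential[OF x un] g1 .
qed

end

text \<open>\<open>F\<close> is a holomorphic parametrization of the submanifold and
  \<open>F_geodesic\<close> says that covariant derivatives of its coordinate fields stay tangent.
  Convexity of \<open>W\<close> serves the identity theorem on complex lines.\<close>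

locale kaehler_chart_map = kaehler_chart +
  fixes EN W :: "'a::euclidean_space set" and J :: "'a \<Rightarrow> 'a" and F :: "'a \<Rightarrow> 'a"
  assumes W: "rel_open EN W" and W0: "0 \<in> W" and W_convex: "convex W" and csN: "complex_structure_on EN J"
    and F_smooth: "smooth_on EN W F" and F_in: "F ` W \<subseteq> U" and F0: "F 0 = 0"
    and F_J: "\<And>x w. x \<in> W \<Longrightarrow> w \<in> EN \<Longrightarrow> dir_deriv F (J w) x = I (dir_deriv F w x)"
    and F_immersion: "\<And>x w. x \<in> W \<Longrightarrow> w \<in> EN \<Longrightarrow> dir_deriv F w x = 0 \<Longrightarrow> w = 0"
    and F_geodesic: "\<And>x u w. x \<in> W \<Longrightarrow> u \<in> EN \<Longrightarrow> w \<in> EN \<Longrightarrow>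
      \<exists>z\<in>EN. dir_deriv (dir_deriv F w) u x + \<Gamma> (F x) (dir_deriv F u x) (dir_deriv F w x) = dir_deriv F z x"
begin

lemma EN: "subspace EN" using W by blast
lemmas JN = complex_structure_onD[OF csN EN]

lemma F_differentiable: "x \<in> W \<Longrightarrow> F differentiable (at x within W)"
  by (rule smooth_on_differentiable[OF W F_smooth])

lemma Fx: "x \<in> W \<Longrightarrow> F x \<in> U" using F_in by blast

lemma in_E: "v ` W \<subseteq> E \<Longrightarrow> smooth_on EN W v \<Longrightarrow> x \<in> W \<Longrightarrow> w \<in> EN \<Longrightarrow> dir_deriv v w x \<in> E"
  by (rule dir_deriv_in[OF W _ _ smooth_on_differentiable[OF W] E])

lemma DF_in: "x \<in> W \<Longrightarrow> w \<in> EN \<Longrightarrow> dir_deriv F w x \<in> E"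
  using F_in rel_open_subset[OF U] by (intro in_E F_smooth) auto

lemma DF_smooth: "w \<in> EN \<Longrightarrow> smooth_on EN W (dir_deriv F w)"
  by (rule smooth_on_dir_deriv[OF W F_smooth])

lemma DF_image: "w \<in> EN \<Longrightarrow> dir_deriv F w ` W \<subseteq> E"
  using DF_in by blast

lemma dir_deriv_I:
  assumes v: "v ` W \<subseteq> E" "smooth_on EN W v" and x: "x \<in> W" and Y: "Y \<in> EN"
  shows "dir_deriv (\<lambda>x. I (v x)) Y x = I (dir_deriv v Y x)"
proof -
  obtain B where B: "finite B" "B \<subseteq> E" "\<And>v. v \<in> E \<Longrightarrow> (\<Sum>b\<in>B. (v \<bullet> b) *\<^sub>R b) = v"
    using subspace_onb[OF E] by metis
  define I' where "I' v = (\<Sum>b\<in>B. (v \<bullet> b) *\<^sub>R I b)" for v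
  have bl: "bounded_linear I'" unfolding I'_def
    by (intro bounded_linear_sum bounded_linear_compose[OF bounded_linear_scaleR_left] bounded_linear_inner_left)
  have eq: "I u = I' u" if "u \<in> E" for u
    using complex_structure_on_sum[OF cs E B(1), of "\<lambda>b. b" "\<lambda>b. u \<bullet> b"] B(2,3) that by (auto simp: I'_def)
  have "dir_deriv (\<lambda>x. I (v x)) Y x = dir_deriv (\<lambda>x. I' (v x)) Y x"
    by (rule dir_deriv_cong[OF W x Y]) (use v eq in auto)
  also have "\<dots> = I' (dir_deriv v Y x)"
    by (rule dir_deriv_linear_comp[OF bl W x Y smooth_on_differentiable[OF W v(2) x]])
  finally show ?thesis using eq[OF in_E[OF v x Y]] by simp
qed

text \<open>Metric compatibility for fields along \<open>F\<close> rather than fields on the ambient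
  chart. The product rule is applied to basis coefficients and the terms are then regrouped.\<close>

lemma g_along:
  assumes v: "v ` W \<subseteq> E" "smooth_on EN W v" and w: "w ` W \<subseteq> E" "smooth_on EN W w"
  shows "smooth_on EN W (\<lambda>y. g (F y) (v y) (w y))"
    and "x \<in> W \<Longrightarrow> X \<in> EN \<Longrightarrow> dir_deriv (\<lambda>y. g (F y) (v y) (w y)) X x =
      g (F x) (dir_deriv v X x + \<Gamma> (F x) (dir_deriv F X x) (v x)) (w x)
      + g (F x) (v x) (dir_deriv w X x + \<Gamma> (F x) (dir_deriv F X x) (w x))"
proof -
  obtain B where B: "finite B" "B \<subseteq> E" "\<And>v. v \<in> E \<Longrightarrow> (\<Sum>b\<in>B. (v \<bullet> b) *\<^sub>R b) = v"
    using subspace_onb[OF E] by metis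
  have expand: "g y a b = (\<Sum>i\<in>B. \<Sum>j\<in>B. (a \<bullet> i) * ((b \<bullet> j) * g y i j))" if "y \<in> U" "a \<in> E" "b \<in> E" for y a b
  proof -
    have "g y a b = g y (\<Sum>i\<in>B. (a \<bullet> i) *\<^sub>R i) b" using B(3)[OF that(2)] by simp
    also have "\<dots> = (\<Sum>i\<in>B. (a \<bullet> i) * g y i b)" by (rule g_sum(1)[OF that(1) B(1) _ that(3)]) (use B in auto)
    also have "\<dots> = (\<Sum>i\<in>B. \<Sum>j\<in>B. (a \<bullet> i) * ((b \<bullet> j) * g y i j))"
    proof (rule sum.cong[OF refl])
      fix i assume i: "i \<in> B"
      have "g y i b = g y i (\<Sum>j\<in>B. (b \<bullet> j) *\<^sub>R j)" using B(3)[OF that(3)] by simp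
      also have "\<dots> = (\<Sum>j\<in>B. (b \<bullet> j) * g y i j)" by (rule g_sum(2)[OF that(1) B(1)]) (use B i in auto)
      finally show "(a \<bullet> i) * g y i b = (\<Sum>j\<in>B. (a \<bullet> i) * ((b \<bullet> j) * g y i j))" by (simp add: sum_distrib_left)
    qed
    finally show ?thesis .
  qed
  have sgF: "smooth_on EN W (\<lambda>y. g (F y) i j)" if "i \<in> B" "j \<in> B" for i j
    using that B(2) by (intro smooth_on_compose[OF W U F_in F_smooth] g_smooth) auto
  have si: "smooth_on EN W (\<lambda>y. v y \<bullet> i)" "smooth_on EN W (\<lambda>y. w y \<bullet> i)" for i
    by (intro smooth_on_inner v w smooth_on_const)+
  have eq: "g (F y) (v y) (w y) = (\<Sum>i\<in>B. \<Sum>j\<in>B. (v y \<bullet> i) * ((w y \<bullet> j) * g (F y) i j))" if "y \<in> W" for y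
    using that v w by (intro expand Fx) auto
  have "smooth_on EN W (\<lambda>y. \<Sum>i\<in>B. \<Sum>j\<in>B. (v y \<bullet> i) * ((w y \<bullet> j) * g (F y) i j))"
    by (intro smooth_on_sum smooth_on_mult si sgF)
  then show "smooth_on EN W (\<lambda>y. g (F y) (v y) (w y))"
    by (rule smooth_on_cong[THEN iffD1, rotated]) (simp add: eq)
  assume x: "x \<in> W" and X: "X \<in> EN"
  note dif = smooth_on_differentiable[OF W _ x]
  let ?a = "dir_deriv F X x"
  have a: "?a \<in> E" using DF_in[OF x X] .
  have vx: "v x \<in> E" "w x \<in> E" using v w x by auto
  have Dv: "dir_deriv v X x \<in> E" "dir_deriv w X x \<in> E" using in_E v w x X by blast+
  have d_inner: "dir_deriv (\<lambda>y. u y \<bullet> i) X x = dir_deriv u X x \<bullet> i" if "smooth_on EN W u" for u :: "'a \<Rightarrow> 'a" and i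
    by (rule dir_deriv_linear_comp[OF bounded_linear_inner_left W x X dif[OF that]])
  have "dir_deriv (\<lambda>y. g (F y) (v y) (w y)) X x
      = dir_deriv (\<lambda>y. \<Sum>i\<in>B. \<Sum>j\<in>B. (v y \<bullet> i) * ((w y \<bullet> j) * g (F y) i j)) X x"
    by (rule dir_deriv_cong[OF W x X eq])
  also have "\<dots> = (\<Sum>i\<in>B. dir_deriv (\<lambda>y. \<Sum>j\<in>B. (v y \<bullet> i) * ((w y \<bullet> j) * g (F y) i j)) X x)"
    by (intro dir_deriv_sum_fun[OF W x X] dif smooth_on_sum smooth_on_mult si sgF)
  also have "\<dots> = (\<Sum>i\<in>B. \<Sum>j\<in>B. dir_deriv (\<lambda>y. (v y \<bullet> i) * ((w y \<bullet> j) * g (F y) i j)) X x)"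
    by (intro sum.cong refl dir_deriv_sum_fun[OF W x X] dif smooth_on_sum smooth_on_mult si sgF)
  also have "\<dots> = (\<Sum>i\<in>B. \<Sum>j\<in>B. (v x \<bullet> i) * ((w x \<bullet> j) * dir_deriv (\<lambda>y. g y i j) ?a (F x))
      + ((v x \<bullet> i) * ((dir_deriv w X x \<bullet> j) * g (F x) i j) + (dir_deriv v X x \<bullet> i) * ((w x \<bullet> j) * g (F x) i j)))"
  proof (intro sum.cong refl)
    fix i j assume ij: "i \<in> B" "j \<in> B"
    have ijE: "i \<in> E" "j \<in> E" using ij B by auto
    have c: "dir_deriv (\<lambda>y. g (F y) i j) X x = dir_deriv (\<lambda>y. g y i j) ?a (F x)"
      by (rule dir_deriv_chain[OF W U x X F_in F_differentiable[OF x] smooth_on_differentiable[OF U g_smooth[OF ijE] Fx[OF x]]])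
    have "dir_deriv (\<lambda>y. (v y \<bullet> i) * ((w y \<bullet> j) * g (F y) i j)) X x
      = (v x \<bullet> i) * dir_deriv (\<lambda>y. (w y \<bullet> j) * g (F y) i j) X x + (dir_deriv v X x \<bullet> i) * ((w x \<bullet> j) * g (F x) i j)"
      unfolding d_inner[OF v(2), symmetric]
      by (intro dir_deriv_mult[OF W x X] dif smooth_on_mult si sgF ij)
    also have "dir_deriv (\<lambda>y. (w y \<bullet> j) * g (F y) i j) X x
      = (w x \<bullet> j) * dir_deriv (\<lambda>y. g (F y) i j) X x + (dir_deriv w X x \<bullet> j) * g (F x) i j"
      unfolding d_inner[OF w(2), symmetric]
      by (intro dir_deriv_mult[OF W x X] dif smooth_on_mult si sgF ij)
    finally show "dir_deriv (\<lambda>y. (v y \<bullet> i) * ((w y \<bullet> j) * g (F y) i j)) X x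
      = (v x \<bullet> i) * ((w x \<bullet> j) * dir_deriv (\<lambda>y. g y i j) ?a (F x))
      + ((v x \<bullet> i) * ((dir_deriv w X x \<bullet> j) * g (F x) i j) + (dir_deriv v X x \<bullet> i) * ((w x \<bullet> j) * g (F x) i j))"
      unfolding c by (simp add: algebra_simps)
  qed
  also have "\<dots> = (\<Sum>i\<in>B. \<Sum>j\<in>B. (v x \<bullet> i) * ((w x \<bullet> j) * dir_deriv (\<lambda>y. g y i j) ?a (F x)))
      + (g (F x) (v x) (dir_deriv w X x) + g (F x) (dir_deriv v X x) (w x))"
    unfolding sum.distrib expand[OF Fx[OF x] vx(1) Dv(2)] expand[OF Fx[OF x] Dv(1) vx(2)] ..
  \<comment> \<open>The terms in which only the coefficients of the metric are differentiated form
    the derivative of \<open>g\<close> with \<open>v x\<close> and \<open>w x\<close> held fixed, to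
    which \<open>metric_compatible\<close> applies.\<close>
  also have "(\<Sum>i\<in>B. \<Sum>j\<in>B. (v x \<bullet> i) * ((w x \<bullet> j) * dir_deriv (\<lambda>y. g y i j) ?a (F x)))
      = dir_deriv (\<lambda>y. g y (v x) (w x)) ?a (F x)"
  proof -
    note difU = smooth_on_differentiable[OF U _ Fx[OF x]]
    have gs: "smooth_on E U (\<lambda>y. g y i j)" if "i \<in> B" "j \<in> B" for i j using that B by (intro g_smooth) auto
    have "dir_deriv (\<lambda>y. g y (v x) (w x)) ?a (F x)
      = dir_deriv (\<lambda>y. \<Sum>i\<in>B. \<Sum>j\<in>B. (v x \<bullet> i) * ((w x \<bullet> j) * g y i j)) ?a (F x)"
      by (rule dir_deriv_cong[OF U Fx[OF x] a]) (rule expand[OF _ vx])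
    also have "\<dots> = (\<Sum>i\<in>B. dir_deriv (\<lambda>y. \<Sum>j\<in>B. (v x \<bullet> i) * ((w x \<bullet> j) * g y i j)) ?a (F x))"
      by (intro dir_deriv_sum_fun[OF U Fx[OF x] a] difU smooth_on_sum smooth_on_mult smooth_on_const gs)
    also have "\<dots> = (\<Sum>i\<in>B. \<Sum>j\<in>B. dir_deriv (\<lambda>y. (v x \<bullet> i) * ((w x \<bullet> j) * g y i j)) ?a (F x))"
      by (intro sum.cong refl dir_deriv_sum_fun[OF U Fx[OF x] a] difU smooth_on_sum smooth_on_mult smooth_on_const gs)
    also have "\<dots> = (\<Sum>i\<in>B. \<Sum>j\<in>B. (v x \<bullet> i) * ((w x \<bullet> j) * dir_deriv (\<lambda>y. g y i j) ?a (F x)))"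
    proof (intro sum.cong refl)
      fix i j assume ij: "i \<in> B" "j \<in> B"
      show "dir_deriv (\<lambda>y. (v x \<bullet> i) * ((w x \<bullet> j) * g y i j)) ?a (F x)
        = (v x \<bullet> i) * ((w x \<bullet> j) * dir_deriv (\<lambda>y. g y i j) ?a (F x))"
        by (simp only: dir_deriv_linear_comp[OF bounded_linear_mult_right U Fx[OF x] a difU]
            smooth_on_mult[OF smooth_on_const gs[OF ij]] gs[OF ij])
    qed
    finally show ?thesis by simp
  qed
  also have "dir_deriv (\<lambda>y. g y (v x) (w x)) ?a (F x)
      = g (F x) (\<Gamma> (F x) ?a (v x)) (w x) + g (F x) (v x) (\<Gamma> (F x) ?a (w x))"
    by (rule metric_compatible[OF Fx[OF x] a vx])
  finally show "dir_deriv (\<lambda>y. g (F y) (v y) (w y)) X x =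
      g (F x) (dir_deriv v X x + \<Gamma> (F x) ?a (v x)) (w x) + g (F x) (v x) (dir_deriv w X x + \<Gamma> (F x) ?a (w x))"
    using g_simps(1)[OF Fx[OF x] Dv(1) \<Gamma>_in[OF Fx[OF x] a vx(1)] vx(2)]
      g_simps(2)[OF Fx[OF x] vx(1) Dv(2) \<Gamma>_in[OF Fx[OF x] a vx(2)]] by simp
qed

text \<open>The covariant derivative along \<open>F\<close> of the coordinate field of
  \<open>w\<close> in the direction \<open>u\<close>. Its normal part is the second fundamental
  form, which vanishes by \<open>F_geodesic\<close>.\<close>

definition second :: "'a \<Rightarrow> 'a \<Rightarrow> 'a \<Rightarrow> 'a" where
  "second u w x = dir_deriv (dir_deriv F w) u x + \<Gamma> (F x) (dir_deriv F u x) (dir_deriv F w x)"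

lemma second_in: "x \<in> W \<Longrightarrow> u \<in> EN \<Longrightarrow> w \<in> EN \<Longrightarrow> second u w x \<in> E"
  unfolding second_def by (intro subspace_add[OF E] in_E DF_smooth DF_image \<Gamma>_in Fx DF_in)

lemma second_sym: "x \<in> W \<Longrightarrow> u \<in> EN \<Longrightarrow> w \<in> EN \<Longrightarrow> second u w x = second w u x"
  unfolding second_def
  using dir_deriv_commute[OF W F_smooth, of w u x] \<Gamma>_sym[OF Fx[of x] DF_in[of x u] DF_in[of x w]] by simp

definition induced :: "'a \<Rightarrow> 'a \<Rightarrow> 'a \<Rightarrow> real" where
  "induced u w x = g (F x) (dir_deriv F u x) (dir_deriv F w x)"

lemma induced_smooth: "u \<in> EN \<Longrightarrow> w \<in> EN \<Longrightarrow> smooth_on EN W (induced u w)"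
  unfolding induced_def[abs_def] by (intro g_along DF_smooth DF_image)

lemma dir_deriv_induced:
  "x \<in> W \<Longrightarrow> X \<in> EN \<Longrightarrow> u \<in> EN \<Longrightarrow> w \<in> EN \<Longrightarrow> dir_deriv (induced u w) X x
    = g (F x) (second X u x) (dir_deriv F w x) + g (F x) (dir_deriv F u x) (second X w x)"
  unfolding induced_def[abs_def] second_def by (intro g_along DF_smooth DF_image)

text \<open>The Christoffel symbols of the submanifold are obtained from the induced metric by the Koszul
  formula, hence they are smooth.\<close>

lemma connection_coefficients:
  assumes u: "u \<in> EN" and w: "w \<in> EN"
  obtains Z where "\<And>x. x \<in> W \<Longrightarrow> Z x \<in> EN \<and> second u w x = dir_deriv F (Z x) x"
    "\<And>b. smooth_on EN W (\<lambda>x. Z x \<bullet> b)"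
proof -
  obtain Z where Z: "\<And>x. x \<in> W \<Longrightarrow> Z x \<in> EN" "\<And>x. x \<in> W \<Longrightarrow> second u w x = dir_deriv F (Z x) x"
    using F_geodesic[OF _ u w] unfolding second_def by metis
  obtain B where B: "finite B" "B \<subseteq> EN" "\<And>a b. a \<in> B \<Longrightarrow> b \<in> B \<Longrightarrow> a \<bullet> b = (if a = b then 1 else 0)"
    "\<And>v. v \<in> EN \<Longrightarrow> (\<Sum>b\<in>B. (v \<bullet> b) *\<^sub>R b) = v" using subspace_onb[OF EN] by metis
  have BE: "b \<in> EN" if "b \<in> B" for b using that B(2) by blast
  \<comment> \<open>The Koszul expression of the induced metric. Since \<open>second\<close> is
    symmetric in its directions, it equals the product of \<open>second u w\<close> with the
    coordinate field of \<open>c\<close>.\<close>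
  define k where "k c x = (dir_deriv (induced w c) u x + dir_deriv (induced u c) w x - dir_deriv (induced u w) c x) * (1 / 2)" for c x
  have k_smooth: "smooth_on EN W (k c)" if "c \<in> EN" for c
    unfolding k_def[abs_def] using that u w
    by (intro smooth_on_mult smooth_on_add smooth_on_diff smooth_on_const smooth_on_dir_deriv[OF W] induced_smooth)
  have DFsum: "dir_deriv F (\<Sum>b\<in>B. d b *\<^sub>R b) x = (\<Sum>b\<in>B. d b *\<^sub>R dir_deriv F b x)" if "x \<in> W" for d x
    by (rule dir_deriv_sum[OF W that F_differentiable[OF that] B(1)]) (use BE in auto)
  have ind_sum: "(\<Sum>b\<in>B. d b * induced b c x) = g (F x) (dir_deriv F (\<Sum>b\<in>B. d b *\<^sub>R b) x) (dir_deriv F c x)"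
    if "x \<in> W" "c \<in> EN" for d c x
    unfolding DFsum[OF that(1)] induced_def
    by (rule g_sum(1)[OF Fx[OF that(1)] B(1) _ DF_in[OF that], symmetric]) (use DF_in[OF that(1)] BE in auto)
  have k_eq: "k c x = (\<Sum>b\<in>B. (Z x \<bullet> b) * induced b c x)" if x: "x \<in> W" and c: "c \<in> EN" for c x
  proof -
    note s = second_in[OF x] DF_in[OF x]
    have "k c x = g (F x) (second u w x) (dir_deriv F c x)"
      unfolding k_def dir_deriv_induced[OF x u w c] dir_deriv_induced[OF x w u c] dir_deriv_induced[OF x c u w]
        second_sym[OF x w u] second_sym[OF x c u] second_sym[OF x c w]
      using g_sym[OF Fx[OF x] s(2)[OF w] s(1)[OF u c]] by simp
    then show ?thesis unfolding ind_sum[OF x c] B(4)[OF Z(1)[OF x]] Z(2)[OF x] .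
  qed
  \<comment> \<open>The Gram system with matrix \<open>induced b c\<close>, right-hand side
    \<open>k c\<close> and unknowns \<open>Z x \<bullet> b\<close> is packed into one vector
    equation along the orthonormal vectors \<open>c\<close>.\<close>
  have coeff: "smooth_on EN W (\<lambda>x. Z x \<bullet> b)" if b: "b \<in> B" for b
  proof (rule smooth_on_coefficients[where a = "\<lambda>b x. \<Sum>c\<in>B. induced b c x *\<^sub>R c" and B = B
        and r = "\<lambda>x. \<Sum>c\<in>B. k c x *\<^sub>R c"])
    show "smooth_on EN W (\<lambda>x. \<Sum>c\<in>B. induced b c x *\<^sub>R c)" if "b \<in> B" for b
      using that by (intro smooth_on_sum smooth_on_scaleR induced_smooth smooth_on_const BE)
    show "smooth_on EN W (\<lambda>x. \<Sum>c\<in>B. k c x *\<^sub>R c)"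
      by (intro smooth_on_sum smooth_on_scaleR k_smooth smooth_on_const BE)
    show "(\<Sum>c\<in>B. k c x *\<^sub>R c) = (\<Sum>b\<in>B. (Z x \<bullet> b) *\<^sub>R (\<Sum>c\<in>B. induced b c x *\<^sub>R c))" if x: "x \<in> W" for x
    proof -
      have "(\<Sum>b\<in>B. (Z x \<bullet> b) *\<^sub>R (\<Sum>c\<in>B. induced b c x *\<^sub>R c)) = (\<Sum>b\<in>B. \<Sum>c\<in>B. ((Z x \<bullet> b) * induced b c x) *\<^sub>R c)"
        by (simp add: scaleR_sum_right)
      also have "\<dots> = (\<Sum>c\<in>B. \<Sum>b\<in>B. ((Z x \<bullet> b) * induced b c x) *\<^sub>R c)" by (rule sum.swap)
      also have "\<dots> = (\<Sum>c\<in>B. k c x *\<^sub>R c)"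
        by (rule sum.cong) (auto simp: k_eq[OF x BE] scaleR_sum_left)
      finally show ?thesis by simp
    qed
    show "d b = 0" if x: "x \<in> W" and d: "(\<Sum>b\<in>B. d b *\<^sub>R (\<Sum>c\<in>B. induced b c x *\<^sub>R c)) = 0" and b: "b \<in> B" for x d b
    proof -
      let ?w = "\<Sum>b\<in>B. d b *\<^sub>R b"
      have w: "?w \<in> EN" using BE EN by (auto intro!: subspace_sum subspace_mul)
      have 0: "(\<Sum>b\<in>B. d b * induced b a x) = 0" if a: "a \<in> B" for a
      proof -
        have "0 = (\<Sum>b\<in>B. d b *\<^sub>R (\<Sum>c\<in>B. induced b c x *\<^sub>R c)) \<bullet> a" using d by simp
        also have "\<dots> = (\<Sum>b\<in>B. d b * (\<Sum>c\<in>B. induced b c x * (c \<bullet> a)))"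
          by (simp add: inner_sum_left)
        also have "\<dots> = (\<Sum>b\<in>B. d b * (\<Sum>c\<in>B. if c = a then induced b c x else 0))"
          by (intro sum.cong arg_cong2[where f = times] refl) (auto simp: B(3) a)
        also have "\<dots> = (\<Sum>b\<in>B. d b * induced b a x)" using B(1) a by simp
        finally show ?thesis by simp
      qed
      \<comment> \<open>A relation between the rows of the Gram matrix yields a tangent vector of
        length zero; since \<open>F\<close> is an immersion, the relation is trivial.\<close>
      have "g (F x) (dir_deriv F ?w x) (dir_deriv F ?w x) = (\<Sum>a\<in>B. d a * g (F x) (dir_deriv F ?w x) (dir_deriv F a x))"
        unfolding DFsum[OF x, of d]
        by (rule g_sum(2)[OF Fx[OF x] B(1)]) (use DF_in[OF x] BE w DFsum[OF x, of d] in \<open>auto intro!: subspace_sum[OF E] subspace_mul[OF E]\<close>)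
      also have "\<dots> = 0"
        using 0 ind_sum[OF x BE, of _ d] by (intro sum.neutral) auto
      finally have "dir_deriv F ?w x = 0"
        using g_pos[OF Fx[OF x] DF_in[OF x w]] by force
      then have "?w = 0" by (rule F_immersion[OF x w])
      then have "?w \<bullet> b = 0" by simp
      then have "(\<Sum>a\<in>B. d a * (a \<bullet> b)) = 0" by (simp add: inner_sum_left)
      moreover have "(\<Sum>a\<in>B. d a * (a \<bullet> b)) = (\<Sum>a\<in>B. if a = b then d a else 0)"
        by (rule sum.cong) (auto simp: B(3) b)
      ultimately show ?thesis using B(1) b by simp
    qed
  qed (use b B(1) in auto)
  have "smooth_on EN W (\<lambda>x. Z x \<bullet> b)" for b
  proof -
    have "smooth_on EN W (\<lambda>x. \<Sum>c\<in>B. (Z x \<bullet> c) * (c \<bullet> b))"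
      by (intro smooth_on_sum smooth_on_mult coeff smooth_on_const)
    moreover have "(\<Sum>c\<in>B. (Z x \<bullet> c) * (c \<bullet> b)) = Z x \<bullet> b" if "x \<in> W" for x
    proof -
      have "(\<Sum>c\<in>B. (Z x \<bullet> c) *\<^sub>R c) \<bullet> b = Z x \<bullet> b" using B(4)[OF Z(1)[OF that]] by simp
      then show ?thesis by (simp add: inner_sum_left)
    qed
    ultimately show ?thesis by (rule smooth_on_cong[THEN iffD1, rotated])
  qed
  then show ?thesis using Z that by blast
qed

lemma cdd_DF:
  assumes x: "x \<in> W" and X: "X \<in> EN" and f: "smooth_on E U f"
  shows "cdd c J X (\<lambda>x. f (F x)) x = cdd c I (dir_deriv F X x) f (F x)"
  by (rule cdd_chain[OF W U csN cs F_smooth F_in f x X F_J[OF x X]])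

text \<open>A (1,0)-derivative of f o F is a combination, with smooth coefficients, of
  (1,0)-derivatives of f composed with F, because F is holomorphic. These keep the defect
  \<open>m\<close>, so the induction closes over all such f.\<close>

lemma vanishes_compose:
  assumes X: "X \<in> EN" and f: "smooth_on E U f" "jet_weights E I m f" "m > 0"
  shows "vanishes (cdd (-\<i>) J X) k (\<lambda>x. f (F x))"
  using f(1,2)
proof (induction k arbitrary: f)
  case 0
  then show ?case using jet_weights_zero[OF E cs _ f(3)] F0 by simp
next
  case (Suc k)
  obtain B where B: "finite B" "B \<subseteq> E" "\<And>v. v \<in> E \<Longrightarrow> (\<Sum>b\<in>B. (v \<bullet> b) *\<^sub>R b) = v"
    using subspace_onb[OF E] by metis
  have sb: "smooth_on E U (cdd (-\<i>) I b f)" if "b \<in> B" for b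
    using that B(2) by (intro cdd_smooth[OF U cs Suc.prems(1)]) auto
  have s1: "smooth_on EN W (\<lambda>x. complex_of_real (dir_deriv F X x \<bullet> b))" for b
    by (intro smooth_on_linear_comp[OF bounded_linear_of_real] smooth_on_inner DF_smooth X smooth_on_const)
  have s2: "smooth_on EN W (\<lambda>x. cdd (-\<i>) I b f (F x))" if "b \<in> B" for b
    by (rule smooth_on_compose[OF W U F_in F_smooth sb[OF that]])
  have "vanishes (cdd (-\<i>) J X) k (\<lambda>x. \<Sum>b\<in>B. of_real (dir_deriv F X x \<bullet> b) * cdd (-\<i>) I b f (F x))"
  proof (rule vanishes_sum[OF W W0 csN X B(1)])
    fix b assume b: "b \<in> B"
    have "jet_weights E I (m - 0) (cdd (-\<i>) I b f)"
      by (rule jet_weights_cdd[OF U U0 cs _ Suc.prems]) (use b B(2) in auto)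
    then have "vanishes (cdd (-\<i>) J X) k (\<lambda>x. cdd (-\<i>) I b f (F x))"
      by (intro Suc.IH sb b) simp
    then show "vanishes (cdd (-\<i>) J X) k (\<lambda>x. of_real (dir_deriv F X x \<bullet> b) * cdd (-\<i>) I b f (F x))"
      by (rule vanishes_mult[OF W W0 csN X s1 s2[OF b]])
    show "smooth_on EN W (\<lambda>x. of_real (dir_deriv F X x \<bullet> b) * cdd (-\<i>) I b f (F x))"
      by (intro smooth_on_mult s1 s2 b)
  qed
  moreover have "(\<Sum>b\<in>B. of_real (dir_deriv F X x \<bullet> b) * cdd (-\<i>) I b f (F x)) = cdd (-\<i>) J X (\<lambda>x. f (F x)) x"
    if x: "x \<in> W" for x
  proof -
    have "cdd (-\<i>) J X (\<lambda>x. f (F x)) x = cdd (-\<i>) I (\<Sum>b\<in>B. (dir_deriv F X x \<bullet> b) *\<^sub>R b) f (F x)"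
      using cdd_DF[OF x X Suc.prems(1)] B(3)[OF DF_in[OF x X]] by simp
    also have "\<dots> = (\<Sum>b\<in>B. of_real (dir_deriv F X x \<bullet> b) * cdd (-\<i>) I b f (F x))"
      by (rule cdd_dir_sum[OF U cs Fx[OF x] B(1) _ Suc.prems(1)]) (use B(2) in auto)
    finally show ?thesis by simp
  qed
  ultimately have "vanishes (cdd (-\<i>) J X) k (cdd (-\<i>) J X (\<lambda>x. f (F x)))"
    by (rule vanishes_cong[OF W W0 csN X, THEN iffD1, rotated])
  then show ?case using jet_weights_zero[OF E cs Suc.prems(2) f(3)] F0 by simp
qed

text \<open>Since \<open>n\<close> is parallel in the (0,1)-directions and the submanifold is totally geodesic, the
  functions \<open>h (DF b) n\<close> satisfy a homogeneous linear system in the (1,0)-directions.\<close>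

lemma vanishes_normal:
  assumes X: "X \<in> EN" and n: "n \<in> E" and orth: "\<And>w. w \<in> EN \<Longrightarrow> g 0 (dir_deriv F w 0) n = 0" and b: "b \<in> EN"
  shows "vanishes (cdd (-\<i>) J X) k (\<lambda>x. h (F x) (dir_deriv F b x) n)"
  using b
proof (induction k arbitrary: b)
  case 0
  \<comment> \<open>The differential of \<open>J b\<close> is \<open>I\<close> applied to that of
    \<open>b\<close>, so orthogonality for \<open>b\<close> and for \<open>J b\<close> removes the
    real and the imaginary part.\<close>
  then show ?case using orth[OF 0] orth[OF JN(1)[OF 0], unfolded F_J[OF W0 0]] F0 by (simp add: h_def)
next
  case (Suc k)
  have JX: "J X \<in> EN" using X JN by blast
  have nc: "(\<lambda>x. n) ` W \<subseteq> E" "smooth_on EN W (\<lambda>x. n)" using n by (auto intro: smooth_on_const)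
  have h_smooth: "smooth_on EN W (\<lambda>x. h (F x) (dir_deriv F c x) n)" if c: "c \<in> EN" for c
  proof -
    have "smooth_on EN W (\<lambda>x. complex_of_real (g (F x) (dir_deriv F c x) n) - \<i> * complex_of_real (g (F x) (dir_deriv F (J c) x) n))"
      by (intro smooth_on_diff smooth_on_mult smooth_on_linear_comp[OF bounded_linear_of_real] smooth_on_const
          g_along(1) DF_smooth DF_image c JN(1) nc)
    then show ?thesis
      by (rule smooth_on_cong[THEN iffD1, rotated]) (simp add: h_def F_J[OF _ c])
  qed
  \<comment> \<open>The product rule for the Hermitian form. The constant field \<open>n\<close> has
    no ordinary derivative, so only its Christoffel term remains.\<close>
  have dh: "dir_deriv (\<lambda>x. h (F x) (dir_deriv F b x) n) Y x
      = h (F x) (second Y b x) n + h (F x) (dir_deriv F b x) (\<Gamma> (F x) (dir_deriv F Y x) n)"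
    if x: "x \<in> W" and Y: "Y \<in> EN" for x Y
  proof -
    note b = Suc.prems
    have Jb: "J b \<in> EN" using b JN by blast
    note gs = g_along(1)[OF DF_image[OF b] DF_smooth[OF b] nc] g_along(1)[OF DF_image[OF Jb] DF_smooth[OF Jb] nc]
    note gd = g_along(2)[OF DF_image[OF b] DF_smooth[OF b] nc x Y] g_along(2)[OF DF_image[OF Jb] DF_smooth[OF Jb] nc x Y]
    note dif = smooth_on_differentiable[OF W _ x]
    have bl: "bounded_linear (\<lambda>t. - \<i> * complex_of_real t)"
      by (intro bounded_linear_compose[OF bounded_linear_mult_right bounded_linear_of_real])
    have secJ: "second Y (J b) x = I (second Y b x)"
    proof -
      have "dir_deriv (dir_deriv F (J b)) Y x = dir_deriv (\<lambda>x. I (dir_deriv F b x)) Y x"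
        by (rule dir_deriv_cong[OF W x Y]) (rule F_J[OF _ b])
      also have "\<dots> = I (dir_deriv (dir_deriv F b) Y x)"
        by (rule dir_deriv_I[OF DF_image[OF b] DF_smooth[OF b] x Y])
      finally show ?thesis
        unfolding second_def F_J[OF x b] \<Gamma>_I[OF Fx[OF x] DF_in[OF x Y] DF_in[OF x b]]
        using I(3)[OF in_E[OF DF_image[OF b] DF_smooth[OF b] x Y] \<Gamma>_in[OF Fx[OF x] DF_in[OF x Y] DF_in[OF x b]]] by simp
    qed
    have "dir_deriv (\<lambda>x. h (F x) (dir_deriv F b x) n) Y x
        = dir_deriv (\<lambda>x. of_real (g (F x) (dir_deriv F b x) n) + - \<i> * of_real (g (F x) (dir_deriv F (J b) x) n)) Y x"
      by (rule dir_deriv_cong[OF W x Y]) (simp add: h_def F_J[OF _ b])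
    also have "\<dots> = of_real (dir_deriv (\<lambda>x. g (F x) (dir_deriv F b x) n) Y x)
        + - \<i> * of_real (dir_deriv (\<lambda>x. g (F x) (dir_deriv F (J b) x) n) Y x)"
      unfolding dir_deriv_add[OF W x Y dif[OF smooth_on_linear_comp[OF bounded_linear_of_real gs(1)]]
          dif[OF smooth_on_linear_comp[OF bl gs(2)]]]
        dir_deriv_linear_comp[OF bounded_linear_of_real W x Y dif[OF gs(1)]]
        dir_deriv_linear_comp[OF bl W x Y dif[OF gs(2)]] ..
    also have "\<dots> = h (F x) (second Y b x) n + h (F x) (dir_deriv F b x) (\<Gamma> (F x) (dir_deriv F Y x) n)"
      unfolding gd unfolding second_def[symmetric] secJ dir_deriv_const unfolding F_J[OF x b]
      by (simp add: h_def algebra_simps)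
    finally show ?thesis .
  qed
  obtain Z1 where Z1: "\<And>x. x \<in> W \<Longrightarrow> Z1 x \<in> EN \<and> second X b x = dir_deriv F (Z1 x) x" "\<And>b. smooth_on EN W (\<lambda>x. Z1 x \<bullet> b)"
    using connection_coefficients[OF X Suc.prems] by blast
  obtain Z2 where Z2: "\<And>x. x \<in> W \<Longrightarrow> Z2 x \<in> EN \<and> second (J X) b x = dir_deriv F (Z2 x) x" "\<And>b. smooth_on EN W (\<lambda>x. Z2 x \<bullet> b)"
    using connection_coefficients[OF JX Suc.prems] by blast
  obtain B where B: "finite B" "B \<subseteq> EN" "\<And>v. v \<in> EN \<Longrightarrow> (\<Sum>b\<in>B. (v \<bullet> b) *\<^sub>R b) = v" using subspace_onb[OF EN] by metis
  have BE: "c \<in> EN" if "c \<in> B" for c using that B(2) by blast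
  \<comment> \<open>Coefficients, with respect to the coordinate fields, of the covariant
    (1,0)-derivative in the direction \<open>X\<close>, assembled from those for \<open>X\<close>
    and \<open>J X\<close>.\<close>
  define C where "C c x = (complex_of_real (Z1 x \<bullet> c) - \<i> * complex_of_real (Z2 x \<bullet> c)) * (1 / 2)" for c x
  have C_smooth: "smooth_on EN W (C c)" for c
    unfolding C_def[abs_def]
    by (intro smooth_on_diff smooth_on_mult smooth_on_linear_comp[OF bounded_linear_of_real] smooth_on_const Z1 Z2)
  have hZ: "h (F x) (dir_deriv F z x) n = (\<Sum>c\<in>B. of_real (z \<bullet> c) * h (F x) (dir_deriv F c x) n)"
    if x: "x \<in> W" and z: "z \<in> EN" for x z
  proof -
    have "dir_deriv F z x = dir_deriv F (\<Sum>c\<in>B. (z \<bullet> c) *\<^sub>R c) x" using B(3)[OF z] by simp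
    also have "\<dots> = (\<Sum>c\<in>B. (z \<bullet> c) *\<^sub>R dir_deriv F c x)"
      by (rule dir_deriv_sum[OF W x F_differentiable[OF x] B(1) BE])
    finally show ?thesis using h_sum[OF Fx[OF x] B(1) DF_in[OF x BE] n] by simp
  qed
  have "vanishes (cdd (-\<i>) J X) k (\<lambda>x. \<Sum>c\<in>B. C c x * h (F x) (dir_deriv F c x) n)"
    by (intro vanishes_sum[OF W W0 csN X B(1)] vanishes_mult[OF W W0 csN X] smooth_on_mult C_smooth h_smooth BE Suc.IH)
  moreover have "(\<Sum>c\<in>B. C c x * h (F x) (dir_deriv F c x) n) = cdd (-\<i>) J X (\<lambda>x. h (F x) (dir_deriv F b x) n) x"
    if x: "x \<in> W" for x
  proof -
    note DX = DF_in[OF x X] and Db = DF_in[OF x Suc.prems]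
    \<comment> \<open>Replacing \<open>X\<close> by \<open>J X\<close> applies \<open>I\<close> to
      the covariant derivative of \<open>n\<close>. As \<open>h\<close> is antilinear in its second
      argument, the two contributions cancel in the (1,0)-combination, and the system is
      homogeneous.\<close>
    have \<Gamma>J: "\<Gamma> (F x) (dir_deriv F (J X) x) n = I (\<Gamma> (F x) (dir_deriv F X x) n)"
      unfolding F_J[OF x X] using \<Gamma>_sym[OF Fx[OF x] I(1)[OF DX] n] \<Gamma>_I[OF Fx[OF x] n DX] \<Gamma>_sym[OF Fx[OF x] n DX] by simp
    have "cdd (-\<i>) J X (\<lambda>x. h (F x) (dir_deriv F b x) n) x
        = (h (F x) (second X b x) n - \<i> * h (F x) (second (J X) b x) n) / 2"
      unfolding cdd_def dh[OF x X] dh[OF x JX] \<Gamma>J h_I(2)[OF Fx[OF x] Db \<Gamma>_in[OF Fx[OF x] DX n]]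
      by (simp add: algebra_simps)
    also have "\<dots> = (\<Sum>c\<in>B. C c x * h (F x) (dir_deriv F c x) n)"
      using Z1(1)[OF x] Z2(1)[OF x] hZ[OF x]
      by (simp add: C_def sum_distrib_left sum_subtractf[symmetric] sum_divide_distrib diff_divide_distrib algebra_simps)
    finally show ?thesis by simp
  qed
  ultimately have "vanishes (cdd (-\<i>) J X) k (cdd (-\<i>) J X (\<lambda>x. h (F x) (dir_deriv F b x) n))"
    by (rule vanishes_cong[OF W W0 csN X, THEN iffD1, rotated])
  moreover have "h (F 0) (dir_deriv F b 0) n = 0"
    using orth[OF Suc.prems] orth[OF JN(1)[OF Suc.prems], unfolded F_J[OF W0 Suc.prems]] F0 by (simp add: h_def)
  ultimately show ?case by simp
qed

text \<open>The (0,1)-derivative of the potential along \<open>n\<close> splits as \<psi> = \<rho> +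
  \<xi>, where \<xi> comes from the quadratic term and \<rho> has defect 2. Along F, the
  (1,0)-derivative of \<psi> is \<open>h (F x) (dir_deriv F X x) n\<close>. Its jet and that of
  \<rho> vanish, hence so does the jet of the holomorphic function \<xi> o F.\<close>

theorem normal_component_zero:
  assumes X: "X \<in> W" and n: "n \<in> E" and orth: "\<And>w. w \<in> EN \<Longrightarrow> g 0 (dir_deriv F w 0) n = 0"
  shows "h 0 (F X) n = 0"
proof -
  have XE: "X \<in> EN" using X rel_open_subset[OF W] by blast
  have In: "I n \<in> E" using I n by blast
  obtain B where B: "finite B" "B \<subseteq> E" "\<And>v. v \<in> E \<Longrightarrow> (\<Sum>b\<in>B. (v \<bullet> b) *\<^sub>R b) = v"
    using subspace_onb[OF E] by metis
  have BE: "b \<in> E" if "b \<in> B" for b using that B(2) by blast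
  \<comment> \<open>The form \<open>h 0 _ n\<close> on \<open>E\<close>, extended to a bounded
    linear map on the whole type.\<close>
  define \<xi> where "\<xi> v = (\<Sum>b\<in>B. of_real (v \<bullet> b) * h 0 b n)" for v
  have \<xi>h: "\<xi> v = h 0 v n" if "v \<in> E" for v
    using h_sum[OF U0 B(1) BE n, where a = "\<lambda>b. v \<bullet> b" and v = "\<lambda>b. b"] B(3)[OF that] by (simp add: \<xi>_def)
  have \<xi>_bl: "bounded_linear \<xi>" unfolding \<xi>_def
    by (intro bounded_linear_sum bounded_linear_compose[OF bounded_linear_mult_left]
        bounded_linear_compose[OF bounded_linear_of_real] bounded_linear_inner_left)
  define q where "q x = complex_of_real (g 0 x x)" for x
  have q_smooth: "smooth_on E U q"
  proof -
    have s0: "smooth_on E U (\<lambda>x. complex_of_real (\<Sum>i\<in>B. (x \<bullet> i) * (\<Sum>j\<in>B. (x \<bullet> j) * g 0 i j)))"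
      by (intro smooth_on_linear_comp[OF bounded_linear_of_real] smooth_on_sum smooth_on_mult smooth_on_const
          smooth_on_bounded_linear bounded_linear_inner_left)
    have eq: "(\<Sum>i\<in>B. (x \<bullet> i) * (\<Sum>j\<in>B. (x \<bullet> j) * g 0 i j)) = g 0 x x" if "x \<in> U" for x
    proof -
      have x: "x \<in> E" using that rel_open_subset[OF U] by blast
      have "(\<Sum>i\<in>B. (x \<bullet> i) * (\<Sum>j\<in>B. (x \<bullet> j) * g 0 i j)) = (\<Sum>i\<in>B. (x \<bullet> i) * g 0 i x)"
        using g_sum(2)[OF U0 B(1) BE, where a = "\<lambda>b. x \<bullet> b" and v = "\<lambda>b. b"] B(3)[OF x] BE by simp
      also have "\<dots> = g 0 x x" using g_sum(1)[OF U0 B(1) BE x, where a = "\<lambda>b. x \<bullet> b" and v = "\<lambda>b. b"] B(3)[OF x] by simp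
      finally show ?thesis .
    qed
    show ?thesis unfolding q_def[abs_def]
      by (rule smooth_on_cong[THEN iffD1, OF _ s0]) (simp only: eq)
  qed
  have Dq: "dir_deriv q v x = 2 * of_real (g 0 x v)" if x: "x \<in> U" and v: "v \<in> E" for x v
  proof -
    have xE: "x \<in> E" using x rel_open_subset[OF U] by blast
    have "q (x + t *\<^sub>R v) = of_real (g 0 x x + t * (2 * g 0 x v) + t * t * g 0 v v)" for t
    proof -
      have tv: "t *\<^sub>R v \<in> E" "x + t *\<^sub>R v \<in> E" using v xE E by (auto intro: subspace_mul subspace_add)
      show ?thesis using g_lin[OF U0 xE v tv(2), of t] g_simps(2)[OF U0 _ xE tv(1)] g_simps(4)[OF U0 _ v v] xE v g_sym[OF U0 xE v]
        by (simp add: q_def algebra_simps)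
    qed
    moreover have "((\<lambda>t. complex_of_real (g 0 x x + t * (2 * g 0 x v) + t * t * g 0 v v)) has_vector_derivative
        of_real (2 * g 0 x v)) (at 0)"
      by (intro has_vector_derivative_of_real) (auto intro!: derivative_eq_intros)
    ultimately show ?thesis unfolding dir_deriv_def by (simp add: vector_derivative_at)
  qed
  \<comment> \<open>The factor 2 from differentiating the quadratic form cancels against the 1/2 in
    \<open>cdd\<close>; the antisymmetry of \<open>g 0 x (I n)\<close> then gives the Hermitian form
    without a remainder.\<close>
  have cq: "cdd \<i> I n q x = \<xi> x" if x: "x \<in> U" for x
  proof -
    have xE: "x \<in> E" using x rel_open_subset[OF U] by blast
    show ?thesis unfolding cdd_def Dq[OF x n] Dq[OF x In] \<xi>h[OF xE] h_def g_I_right[OF U0 xE n] by (simp add: field_simps)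
  qed
  define \<psi> where "\<psi> = cdd \<i> I n \<Theta>"
  define \<rho> where "\<rho> = cdd \<i> I n (\<lambda>x. \<Theta> x - q x)"
  have s: "smooth_on E U \<psi>" "smooth_on E U \<rho>" "smooth_on E U (\<lambda>x. \<Theta> x - q x)"
    unfolding \<psi>_def \<rho>_def by (intro cdd_smooth[OF U cs _ n] smooth_on_diff \<Theta> q_smooth)+
  have \<rho>w: "jet_weights E I (4 - 2) \<rho>"
    unfolding \<rho>_def by (rule jet_weights_cdd[OF U U0 cs n s(3)]) (use taylor in \<open>auto simp: q_def\<close>)
  have \<rho>eq: "\<psi> x = \<rho> x + \<xi> x" if x: "x \<in> U" for x
    using cdd_add[OF U cs x n s(3) q_smooth, of \<i>] cq[OF x] by (simp add: \<psi>_def \<rho>_def)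
  let ?D = "cdd (-\<i>) J X"
  have \<xi>F: "smooth_on EN W (\<lambda>x. \<xi> (F x))" by (rule smooth_on_linear_comp[OF \<xi>_bl F_smooth])
  have \<rho>F: "smooth_on EN W (\<lambda>x. \<rho> (F x))" by (rule smooth_on_compose[OF W U F_in F_smooth s(2)])
  \<comment> \<open>The difference is written as a sum with a factor -1 so that
    \<open>vanishes_add\<close> and \<open>vanishes_mult\<close> apply.\<close>
  have Deq: "?D (\<lambda>x. \<xi> (F x)) x = h (F x) (dir_deriv F X x) n + (-1) * ?D (\<lambda>x. \<rho> (F x)) x" if x: "x \<in> W" for x
  proof -
    have "h (F x) (dir_deriv F X x) n = ?D (\<lambda>x. \<psi> (F x)) x"
      unfolding h_eq_potential[OF Fx[OF x] DF_in[OF x XE] n] cdd_DF[OF x XE s(1)] by (simp add: \<psi>_def)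
    also have "\<dots> = ?D (\<lambda>x. \<rho> (F x) + \<xi> (F x)) x"
      by (rule cdd_cong[OF W csN x XE]) (rule \<rho>eq[OF Fx])
    also have "\<dots> = ?D (\<lambda>x. \<rho> (F x)) x + ?D (\<lambda>x. \<xi> (F x)) x"
      by (rule cdd_add[OF W csN x XE \<rho>F \<xi>F])
    finally show ?thesis by simp
  qed
  have Dvan: "vanishes ?D k (\<lambda>x. h (F x) (dir_deriv F X x) n + (-1) * ?D (\<lambda>x. \<rho> (F x)) x)" for k
  proof -
    have "smooth_on EN W (?D (\<lambda>x. \<psi> (F x)))"
      by (intro cdd_smooth[OF W csN _ XE] smooth_on_compose[OF W U F_in F_smooth s(1)])
    then have hs: "smooth_on EN W (\<lambda>x. h (F x) (dir_deriv F X x) n)"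
      by (rule smooth_on_cong[THEN iffD1, rotated])
        (simp add: h_eq_potential[OF Fx DF_in[OF _ XE] n] cdd_DF[OF _ XE s(1)] \<psi>_def[symmetric])
    have "vanishes ?D (Suc k) (\<lambda>x. \<rho> (F x))" by (rule vanishes_compose[OF XE s(2) \<rho>w]) simp
    then have "vanishes ?D k (?D (\<lambda>x. \<rho> (F x)))" by simp
    then show ?thesis
      by (intro vanishes_add[OF W W0 csN XE] vanishes_mult[OF W W0 csN XE] vanishes_normal[OF XE n orth XE] hs
          smooth_on_mult smooth_on_const cdd_smooth[OF W csN \<rho>F XE])
  qed
  have van: "vanishes ?D k (?D (\<lambda>x. \<xi> (F x)))" for k
    by (rule vanishes_cong[OF W W0 csN XE, THEN iffD2, OF Deq Dvan])
  have "vanishes ?D k (\<lambda>x. \<xi> (F x))" for k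
  proof (cases k)
    case 0
    then show ?thesis using F0 linear_0[OF bounded_linear.linear[OF \<xi>_bl]] by simp
  next
    case (Suc k)
    then show ?thesis using van[of k] F0 linear_0[OF bounded_linear.linear[OF \<xi>_bl]] by simp
  qed
  moreover have "dir_deriv (\<lambda>x. \<xi> (F x)) (J X) x = \<i> * dir_deriv (\<lambda>x. \<xi> (F x)) X x" if x: "x \<in> W" for x
    unfolding dir_deriv_linear_comp[OF \<xi>_bl W x XE F_differentiable[OF x]]
      dir_deriv_linear_comp[OF \<xi>_bl W x JN(1)[OF XE] F_differentiable[OF x]] F_J[OF x XE]
    using DF_in[OF x XE] I(1) by (simp add: \<xi>h h_I(1)[OF U0 _ n])
  ultimately have "\<xi> (F X) = 0" by (intro holomorphic_vanishes[OF W W0 W_convex csN X \<xi>F])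
  then show ?thesis using \<xi>h[of "F X"] Fx[OF X] rel_open_subset[OF U] by auto
qed

end

section \<open>Charts and tangent vectors\<close>

lemma velocity_cong:
  fixes M :: "('m, 'e::euclidean_space, 'r) smooth_structure_scheme"
  assumes "\<forall>\<^sub>F t in nhds 0. \<gamma> t = \<delta> t"
  shows "velocity M \<gamma> = velocity M \<delta>"
proof -
  have 0: "\<gamma> 0 = \<delta> 0" using eventually_nhds_x_imp_x[OF assms] .
  have v: "vector_derivative (\<lambda>t. snd c (\<gamma> t)) (at 0) = vector_derivative (\<lambda>t. snd c (\<delta> t)) (at 0)" for c :: "('m, 'e) chart"
    using assms by (intro vector_derivative_cong_eq) (auto elim: eventually_mono)
  show ?thesis unfolding velocity_def 0 by (rule ext) (simp only: v)
qed

lemma eventually_line: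
  assumes "rel_open E U" "x \<in> U" "v \<in> E"
  shows "\<forall>\<^sub>F t in nhds 0. x + t *\<^sub>R v \<in> U"
proof -
  obtain e where e: "e > 0" "\<And>t. \<bar>t\<bar> < e \<Longrightarrow> x + t *\<^sub>R v \<in> U" using rel_open_line[OF assms] by blast
  show ?thesis unfolding eventually_nhds by (rule exI[of _ "ball 0 e"]) (use e in auto)
qed

section \<open>Charts, tangent spaces and anchored coordinates of a smooth manifold\<close>

context
  fixes M :: "('m, 'e::euclidean_space, 'r) smooth_structure_scheme"
  assumes M: "smooth_manifold M"
begin

lemma model_subspace: "subspace (model M)"
  using M by (simp add: smooth_manifold_def)

lemma chart_is_chart: "c \<in> charts M \<Longrightarrow> is_chart M c"
  using M by (simp add: smooth_manifold_def)

lemma chart_openin: "c \<in> charts M \<Longrightarrow> openin (mtop M) (fst c)"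
  using chart_is_chart by (simp add: is_chart_def)

lemma chart_homeomorphic:
  "c \<in> charts M \<Longrightarrow> homeomorphic_map (subtopology (mtop M) (fst c)) (top_of_set (snd c ` fst c)) (snd c)"
  using chart_is_chart by (simp add: is_chart_def)

lemma chart_rel_open: "c \<in> charts M \<Longrightarrow> rel_open (model M) (snd c ` fst c)"
  using chart_is_chart model_subspace by (simp add: is_chart_def)

lemma chart_inj: "c \<in> charts M \<Longrightarrow> inj_on (snd c) (fst c)"
  using homeomorphic_imp_injective_map[OF chart_homeomorphic, of c] openin_subset[OF chart_openin, of c]
  by (simp add: topspace_subtopology Int_absorb1)

lemma cpoint_chart: "c \<in> charts M \<Longrightarrow> q \<in> fst c \<Longrightarrow> cpoint c (snd c q) = q"
  by (simp add: cpoint_def inv_into_f_f chart_inj)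

lemma cpoint_in: "c \<in> charts M \<Longrightarrow> x \<in> snd c ` A \<Longrightarrow> A \<subseteq> fst c \<Longrightarrow> cpoint c x \<in> A \<and> snd c (cpoint c x) = x"
  by (auto simp: cpoint_chart subset_iff)

lemma chart_cpoint: "c \<in> charts M \<Longrightarrow> x \<in> snd c ` fst c \<Longrightarrow> snd c (cpoint c x) = x"
  using cpoint_in[of c x "fst c"] by simp

lemma chart_image_open:
  assumes c: "c \<in> charts M" and V: "openin (mtop M) V"
  shows "rel_open (model M) (snd c ` (fst c \<inter> V))"
proof -
  have "openin (subtopology (mtop M) (fst c)) (fst c \<inter> V)"
    using V by (auto simp: openin_subtopology)
  then have "openin (top_of_set (snd c ` fst c)) (snd c ` (fst c \<inter> V))"
    using homeomorphic_imp_open_map[OF chart_homeomorphic[OF c]] by (auto simp: open_map_def)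
  then show ?thesis using chart_rel_open[OF c] openin_trans by blast
qed

lemma chart_preimage_open:
  assumes c: "c \<in> charts M" and T: "openin (top_of_set (model M)) T"
  shows "openin (mtop M) {q \<in> fst c. snd c q \<in> T}"
proof -
  have sub: "snd c ` fst c \<subseteq> model M" using rel_open_subset[OF chart_rel_open[OF c]] .
  obtain O1 where O1: "open O1" "T = model M \<inter> O1" using T by (auto simp: openin_open)
  have "openin (top_of_set (snd c ` fst c)) (snd c ` fst c \<inter> O1)" using O1 by auto
  then have "openin (subtopology (mtop M) (fst c))
      {q \<in> topspace (subtopology (mtop M) (fst c)). snd c q \<in> snd c ` fst c \<inter> O1}"
    using homeomorphic_imp_continuous_map[OF chart_homeomorphic[OF c]] by (auto simp: continuous_map_def)
  moreover have "{q \<in> topspace (subtopology (mtop M) (fst c)). snd c q \<in> snd c ` fst c \<inter> O1} = {q \<in> fst c. snd c q \<in> T}"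
    using openin_subset[OF chart_openin[OF c]] sub O1(2) by auto
  ultimately show ?thesis using chart_openin[OF c] openin_trans_full by fastforce
qed

lemma transition_smooth:
  "c \<in> charts M \<Longrightarrow> d \<in> charts M \<Longrightarrow> smooth_on (model M) (snd c ` (fst c \<inter> fst d)) (\<lambda>x. snd d (cpoint c x))"
  using M by (simp add: smooth_manifold_def smooth_transition_def)

lemma charts_atD: "c \<in> charts_at M q \<Longrightarrow> c \<in> charts M" "c \<in> charts_at M q \<Longrightarrow> q \<in> fst c"
  by (auto simp: charts_at_def)

lemma charts_at_obtain:
  assumes "q \<in> topspace (mtop M)" obtains c where "c \<in> charts_at M q"
proof -
  have "q \<in> (\<Union>c\<in>charts M. fst c)" using M assms by (simp add: smooth_manifold_def)
  then show ?thesis using that by (auto simp: charts_at_def)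
qed

lemma chart_line_0: "c \<in> charts_at M q \<Longrightarrow> chart_line c q u 0 = q"
  using charts_atD cpoint_chart by (simp add: chart_line_def)

lemma cvec_component:
  assumes "d \<in> charts_at M q" "c \<in> charts_at M q"
  shows "cvec M d q u c = dir_deriv (\<lambda>x. snd c (cpoint d x)) u (snd d q)"
  using assms chart_line_0[OF assms(1)] by (simp add: cvec_def velocity_def chart_line_def dir_deriv_def)

lemma cvec_outside: "d \<in> charts_at M q \<Longrightarrow> c \<notin> charts_at M q \<Longrightarrow> cvec M d q u c = 0"
  using chart_line_0 by (simp add: cvec_def velocity_def)

lemma snd_in_model: "c \<in> charts M \<Longrightarrow> q \<in> fst c \<Longrightarrow> snd c q \<in> model M"
  using rel_open_subset[OF chart_rel_open] by blast

lemma cvec_self: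
  assumes "c \<in> charts_at M q" "u \<in> model M"
  shows "cvec M c q u c = u"
proof -
  note c = charts_atD[OF assms(1)]
  have "cvec M c q u c = dir_deriv (\<lambda>x. x) u (snd c q)"
    unfolding cvec_component[OF assms(1,1)]
    by (rule dir_deriv_cong[OF chart_rel_open[OF c(1)] _ assms(2)]) (use c chart_cpoint in auto)
  then show ?thesis by (simp add: dir_deriv_linear_map bounded_linear_ident)
qed

lemma transition_at:
  assumes "d \<in> charts_at M q" "c \<in> charts_at M q"
  shows "rel_open (model M) (snd d ` (fst d \<inter> fst c))" "snd d q \<in> snd d ` (fst d \<inter> fst c)"
    "(\<lambda>x. snd c (cpoint d x)) differentiable (at (snd d q) within snd d ` (fst d \<inter> fst c))"
    "(\<lambda>x. snd c (cpoint d x)) ` (snd d ` (fst d \<inter> fst c)) \<subseteq> snd c ` fst c"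
proof -
  note c = charts_atD[OF assms(1)] charts_atD[OF assms(2)]
  show U: "rel_open (model M) (snd d ` (fst d \<inter> fst c))" by (rule chart_image_open[OF c(1) chart_openin[OF c(3)]])
  show q: "snd d q \<in> snd d ` (fst d \<inter> fst c)" using c by auto
  show "(\<lambda>x. snd c (cpoint d x)) differentiable (at (snd d q) within snd d ` (fst d \<inter> fst c))"
    by (rule smooth_on_differentiable[OF U transition_smooth[OF c(1,3)] q])
  show "(\<lambda>x. snd c (cpoint d x)) ` (snd d ` (fst d \<inter> fst c)) \<subseteq> snd c ` fst c"
    using cpoint_chart[OF c(1)] by auto
qed

lemma cvec_in_model:
  assumes "d \<in> charts_at M q" "c \<in> charts_at M q" "u \<in> model M"
  shows "cvec M d q u c \<in> model M"
  unfolding cvec_component[OF assms(1,2)]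
  using transition_at[OF assms(1,2)] rel_open_subset[OF chart_rel_open[OF charts_atD(1)[OF assms(2)]]]
  by (intro dir_deriv_in[OF _ _ assms(3) _ model_subspace]) auto

text \<open>The cocycle property of the component changes: the chain rule on the common domain of
  the three charts involved.\<close>

lemma cvec_trans:
  assumes d: "d \<in> charts_at M q" and c: "c \<in> charts_at M q" and u: "u \<in> model M"
  shows "cvec M c q (cvec M d q u c) = cvec M d q u"
proof
  fix e
  show "cvec M c q (cvec M d q u c) e = cvec M d q u e"
  proof (cases "e \<in> charts_at M q")
    case False
    then show ?thesis using cvec_outside c d by metis
  next
    case e: True
    note C = charts_atD[OF d] charts_atD[OF c] charts_atD[OF e]
    define D where "D = snd d ` (fst d \<inter> (fst c \<inter> fst e))"
    have D: "rel_open (model M) D" unfolding D_def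
      by (rule chart_image_open[OF C(1) openin_Int[OF chart_openin[OF C(3)] chart_openin[OF C(5)]]])
    have q: "snd d q \<in> D" using C by (auto simp: D_def)
    have sub: "(\<lambda>x. snd c (cpoint d x)) ` D \<subseteq> snd c ` (fst c \<inter> fst e)"
      using cpoint_chart[OF C(1)] by (auto simp: D_def)
    have cq: "snd c (cpoint d (snd d q)) = snd c q" using cpoint_chart C by simp
    have "cvec M d q u e = dir_deriv (\<lambda>x. snd e (cpoint c (snd c (cpoint d x)))) u (snd d q)"
      unfolding cvec_component[OF d e]
      by (rule dir_deriv_cong[OF D q u]) (auto simp: D_def cpoint_chart C)
    also have "\<dots> = dir_deriv (\<lambda>x. snd e (cpoint c x)) (dir_deriv (\<lambda>x. snd c (cpoint d x)) u (snd d q)) (snd c (cpoint d (snd d q)))"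
    proof (rule dir_deriv_chain[OF D transition_at(1)[OF c e] q u sub])
      show "(\<lambda>x. snd c (cpoint d x)) differentiable (at (snd d q) within D)"
        by (rule smooth_on_differentiable[OF D smooth_on_subset[OF transition_smooth[OF C(1,3)]] q]) (auto simp: D_def)
      show "(\<lambda>x. snd e (cpoint c x)) differentiable (at (snd c (cpoint d (snd d q))) within snd c ` (fst c \<inter> fst e))"
        unfolding cq by (rule transition_at(3)[OF c e])
    qed
    finally show ?thesis using cvec_component[OF d c] cvec_component[OF c e] cq by simp
  qed
qed

lemma cvec_tangent: "d \<in> charts_at M q \<Longrightarrow> u \<in> model M \<Longrightarrow> cvec M d q u \<in> tangent_space M q"
  by (simp add: tangent_space_def cvec_in_model cvec_trans)

lemma tangentD: "X \<in> tangent_space M q \<Longrightarrow> c \<in> charts_at M q \<Longrightarrow> X c \<in> model M"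
  "X \<in> tangent_space M q \<Longrightarrow> c \<in> charts_at M q \<Longrightarrow> cvec M c q (X c) = X"
  by (auto simp: tangent_space_def)

lemma tangent_eqI:
  "X \<in> tangent_space M q \<Longrightarrow> Y \<in> tangent_space M q \<Longrightarrow> c \<in> charts_at M q \<Longrightarrow> X c = Y c \<Longrightarrow> X = Y"
  using tangentD(2)[of X q c] tangentD(2)[of Y q c] by argo

lemma cvec_linear:
  assumes d: "d \<in> charts_at M q" and uv: "u \<in> model M" "v \<in> model M"
  shows "cvec M d q (u + v) = tadd (cvec M d q u) (cvec M d q v)"
    "cvec M d q (a *\<^sub>R u) = tscale a (cvec M d q u)"
proof -
  have "cvec M d q (u + v) c = cvec M d q u c + cvec M d q v c \<and> cvec M d q (a *\<^sub>R u) c = a *\<^sub>R cvec M d q u c" for c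
  proof (cases "c \<in> charts_at M q")
    case True
    note t = transition_at[OF d True]
    show ?thesis unfolding cvec_component[OF d True]
      using dir_deriv_linear(1,2)[OF t(1-3) uv] by simp
  qed (simp add: cvec_outside[OF d])
  then show "cvec M d q (u + v) = tadd (cvec M d q u) (cvec M d q v)"
    "cvec M d q (a *\<^sub>R u) = tscale a (cvec M d q u)"
    by (auto simp: tadd_def tscale_def)
qed

lemma tangent_add_scale:
  assumes "q \<in> topspace (mtop M)" "X \<in> tangent_space M q" "Y \<in> tangent_space M q"
  shows "tadd X Y \<in> tangent_space M q" "tscale a X \<in> tangent_space M q" "tzero \<in> tangent_space M q"
proof -
  obtain c where c: "c \<in> charts_at M q" using charts_at_obtain[OF assms(1)] .
  note X = tangentD[OF assms(2) c] and Y = tangentD[OF assms(3) c]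
  show "tadd X Y \<in> tangent_space M q"
    using cvec_tangent[OF c, of "X c + Y c"] cvec_linear(1)[OF c X(1) Y(1)] X Y model_subspace
    by (simp add: subspace_add)
  show s: "tscale a X \<in> tangent_space M q" for a
    using cvec_tangent[OF c, of "a *\<^sub>R X c"] cvec_linear(2)[OF c X(1) Y(1)] X model_subspace
    by (simp add: subspace_mul)
  show "tzero \<in> tangent_space M q" using s[of 0] by (simp add: tscale_def tzero_def)
qed

text \<open>The atlas is maximal, so what has to be supplied is that the map is a homeomorphism.
  Continuity in both directions is local and follows from the continuity of the smooth transitions
  to and from existing charts.\<close>

lemma chart_intro:
  assumes A: "openin (mtop M) A" and \<phi>A: "openin (top_of_set (model M)) (\<phi> ` A)" and inj: "inj_on \<phi> A"
    and tr: "\<And>d. d \<in> charts M \<Longrightarrow> openin (top_of_set (model M)) (\<phi> ` (A \<inter> fst d))"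
      "\<And>d. d \<in> charts M \<Longrightarrow> smooth_on (model M) (snd d ` (fst d \<inter> A)) (\<lambda>y. \<phi> (cpoint d y))"
      "\<And>d. d \<in> charts M \<Longrightarrow> smooth_on (model M) (\<phi> ` (A \<inter> fst d)) (\<lambda>x. snd d (cpoint (A, \<phi>) x))"
  shows "(A, \<phi>) \<in> charts M"
proof -
  have cov: "\<exists>d\<in>charts M. q \<in> fst d" if "q \<in> A" for q
  proof -
    have "q \<in> topspace (mtop M)" using openin_subset[OF A] that by blast
    then obtain d where "d \<in> charts_at M q" by (rule charts_at_obtain)
    then show ?thesis using charts_atD by blast
  qed
  have cp: "cpoint (A, \<phi>) (\<phi> q) = q" if "q \<in> A" for q using inj that by (simp add: cpoint_def inv_into_f_f)
  have "homeomorphic_maps (subtopology (mtop M) A) (top_of_set (\<phi> ` A)) \<phi> (cpoint (A, \<phi>))"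
    unfolding homeomorphic_maps_def
  proof (intro conjI ballI)
    show "continuous_map (subtopology (mtop M) A) (top_of_set (\<phi> ` A)) \<phi>"
      unfolding continuous_map_def
    proof (intro conjI allI impI)
      fix T assume T: "openin (top_of_set (\<phi> ` A)) T"
      have TE: "openin (top_of_set (model M)) T" using T \<phi>A openin_trans by blast
      have "openin (mtop M) {q \<in> A. \<phi> q \<in> T}"
      proof (subst openin_subopen, intro ballI)
        fix q assume q: "q \<in> {q \<in> A. \<phi> q \<in> T}"
        then obtain d where d: "d \<in> charts M" "q \<in> fst d" using cov by blast
        \<comment> \<open>The preimage of \<open>T\<close> near \<open>q\<close>, read in the chart
          \<open>d\<close>, where openness can be tested in the model space.\<close>
        define S where "S = snd d ` (fst d \<inter> A) \<inter> (\<lambda>y. \<phi> (cpoint d y)) -` T"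
        have "openin (top_of_set (snd d ` (fst d \<inter> A))) S" unfolding S_def
          by (rule continuous_openin_preimage[OF smooth_on_continuous[OF tr(2)[OF d(1)]] _ TE])
            (use \<phi>A openin_imp_subset cpoint_chart[OF d(1)] in fastforce)
        then have S: "openin (top_of_set (model M)) S" using chart_image_open[OF d(1) A] openin_trans by blast
        have "openin (mtop M) {q \<in> fst d. snd d q \<in> S}" by (rule chart_preimage_open[OF d(1) S])
        moreover have "{q \<in> fst d. snd d q \<in> S} \<subseteq> {q \<in> A. \<phi> q \<in> T}"
        proof
          fix r assume "r \<in> {q \<in> fst d. snd d q \<in> S}"
          then have rd: "r \<in> fst d" "snd d r \<in> S" by auto
          then have "snd d r \<in> snd d ` (fst d \<inter> A)" "\<phi> (cpoint d (snd d r)) \<in> T"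
            unfolding S_def by blast+
          then have r: "r \<in> fst d" "snd d r \<in> snd d ` (fst d \<inter> A)" "\<phi> r \<in> T"
            using rd(1) by (simp_all add: cpoint_chart[OF d(1) rd(1)])
          then have "r \<in> A" using chart_inj[OF d(1)] by (auto simp: inj_on_def)
          then show "r \<in> {q \<in> A. \<phi> q \<in> T}" using r by simp
        qed
        moreover have "q \<in> {q \<in> fst d. snd d q \<in> S}" using q d cpoint_chart[OF d(1)] by (auto simp: S_def)
        ultimately show "\<exists>T'. openin (mtop M) T' \<and> q \<in> T' \<and> T' \<subseteq> {q \<in> A. \<phi> q \<in> T}" by blast
      qed
      then have "openin (subtopology (mtop M) A) {q \<in> A. \<phi> q \<in> T}"
        by (auto simp: openin_subtopology)
      then show "openin (subtopology (mtop M) A) {q \<in> topspace (subtopology (mtop M) A). \<phi> q \<in> T}"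
        using openin_subset[OF A] by (simp add: topspace_subtopology Int_absorb1)
    qed (use openin_subset[OF A] in auto)
    show "continuous_map (top_of_set (\<phi> ` A)) (subtopology (mtop M) A) (cpoint (A, \<phi>))"
      unfolding continuous_map_def
    proof (intro conjI allI impI)
      fix T assume "openin (subtopology (mtop M) A) T"
      then obtain V where V: "openin (mtop M) V" "T = V \<inter> A" by (auto simp: openin_subtopology)
      have "openin (top_of_set (model M)) {x \<in> \<phi> ` A. cpoint (A, \<phi>) x \<in> T}"
      proof (subst openin_subopen, intro ballI)
        fix x assume "x \<in> {x \<in> \<phi> ` A. cpoint (A, \<phi>) x \<in> T}"
        then obtain q where q: "q \<in> A" "x = \<phi> q" "q \<in> V" using V cp by auto
        then obtain d where d: "d \<in> charts M" "q \<in> fst d" using cov by blast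
        define S where "S = \<phi> ` (A \<inter> fst d) \<inter> (\<lambda>x. snd d (cpoint (A, \<phi>) x)) -` (snd d ` (fst d \<inter> V))"
        have "openin (top_of_set (\<phi> ` (A \<inter> fst d))) S" unfolding S_def
          by (rule continuous_openin_preimage[OF smooth_on_continuous[OF tr(3)[OF d(1)]],
                where T = "model M"]) (use chart_image_open[OF d(1) V(1)] snd_in_model[OF d(1)] cp in auto)
        then have "openin (top_of_set (model M)) S" using tr(1)[OF d(1)] openin_trans by blast
        moreover have "x \<in> S" using q d cp by (auto simp: S_def)
        moreover have "S \<subseteq> {x \<in> \<phi> ` A. cpoint (A, \<phi>) x \<in> T}"
        proof
          fix y assume "y \<in> S"
          then obtain r where r: "r \<in> A" "r \<in> fst d" "y = \<phi> r" "snd d r \<in> snd d ` (fst d \<inter> V)"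
            using cp by (auto simp: S_def)
          then have "r \<in> V" using chart_inj[OF d(1)] by (auto simp: inj_on_def)
          then show "y \<in> {x \<in> \<phi> ` A. cpoint (A, \<phi>) x \<in> T}" using r V cp by auto
        qed
        ultimately show "\<exists>T'. openin (top_of_set (model M)) T' \<and> x \<in> T' \<and> T' \<subseteq> {x \<in> \<phi> ` A. cpoint (A, \<phi>) x \<in> T}" by blast
      qed
      then show "openin (top_of_set (\<phi> ` A)) {x \<in> topspace (top_of_set (\<phi> ` A)). cpoint (A, \<phi>) x \<in> T}"
        using openin_imp_subset[OF \<phi>A] by (auto intro: openin_subset_trans)
    qed (use cp openin_subset[OF A] in auto)
  qed (use cp in auto)
  then have "homeomorphic_map (subtopology (mtop M) A) (top_of_set (\<phi> ` A)) \<phi>"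
    using homeomorphic_map_maps by blast
  then have "is_chart M (A, \<phi>)" using A \<phi>A by (simp add: is_chart_def)
  moreover have "smooth_transition M (A, \<phi>) d \<and> smooth_transition M d (A, \<phi>)" if "d \<in> charts M" for d
    using tr(2,3)[OF that] by (simp add: smooth_transition_def)
  ultimately show ?thesis using M unfolding smooth_manifold_def by blast
qed

text \<open>In a chart centred at p, with \<open>X e\<close> as linear coordinates on the tangent
  space, \<open>k\<close> is the identity. Other charts change the coordinates on the tangent space
  only by linear maps.\<close>

lemma anchored_from_chart:
  assumes e: "e \<in> charts_at M p" and e0: "snd e p = 0"
    and k: "\<And>X. X \<in> tangent_space M p \<Longrightarrow> X e \<in> snd e ` fst e \<Longrightarrow> k X = cpoint e (X e)"
  shows "anchored_coordinates M p {X \<in> tangent_space M p. X e \<in> snd e ` fst e} k"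
proof -
  note ce = charts_atD[OF e]
  have p: "p \<in> topspace (mtop M)" using chart_openin[OF ce(1)] ce(2) openin_subset by blast
  have e0': "0 \<in> snd e ` fst e" using e0 ce by force
  let ?W = "{X \<in> tangent_space M p. X e \<in> snd e ` fst e}"
  have comp: "X c = cvec M e p (X e) c" if "X \<in> tangent_space M p" for X c using tangentD(2)[OF that e] by simp
  \<comment> \<open>The component change between two charts at \<open>p\<close> is linear on the
    model only; it is extended to the whole type to make it continuous and smooth there.\<close>
  have lin: "\<exists>L. linear L \<and> (\<forall>u\<in>model M. L u = cvec M c p u d) \<and> (\<forall>u. L u \<in> model M)"
    if c: "c \<in> charts_at M p" and d: "d \<in> charts_at M p" for c d
  proof -
    obtain B where B: "finite B" "B \<subseteq> model M" "\<And>v. v \<in> model M \<Longrightarrow> (\<Sum>b\<in>B. (v \<bullet> b) *\<^sub>R b) = v"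
      using subspace_onb[OF model_subspace] by metis
    have "(\<Sum>b\<in>B. (u \<bullet> b) *\<^sub>R cvec M c p b d) = cvec M c p u d" if u: "u \<in> model M" for u
    proof -
      note t = transition_at[OF c d]
      have "cvec M c p (\<Sum>b\<in>B. (u \<bullet> b) *\<^sub>R b) d = (\<Sum>b\<in>B. (u \<bullet> b) *\<^sub>R cvec M c p b d)"
        unfolding cvec_component[OF c d] by (rule dir_deriv_sum[OF t(1-3) B(1)]) (use B(2) in auto)
      then show ?thesis using B(3)[OF u] by simp
    qed
    moreover have "linear (\<lambda>u. \<Sum>b\<in>B. (u \<bullet> b) *\<^sub>R cvec M c p b d)"
      by (auto simp: linear_iff inner_add_left scaleR_add_left sum.distrib scaleR_sum_right)
    moreover have "(\<Sum>b\<in>B. (u \<bullet> b) *\<^sub>R cvec M c p b d) \<in> model M" for u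
      using B(2) by (intro subspace_sum subspace_mul model_subspace cvec_in_model c d) auto
    ultimately show ?thesis by blast
  qed
  have image_eq: "(\<lambda>X. X c) ` {X \<in> ?W. P X} = {u \<in> model M. cvec M c p u e \<in> snd e ` fst e \<and> P (cvec M c p u)}"
    if c: "c \<in> charts_at M p" for c P
  proof (intro set_eqI iffI)
    fix u assume "u \<in> (\<lambda>X. X c) ` {X \<in> ?W. P X}"
    then obtain X where X: "X \<in> tangent_space M p" "X e \<in> snd e ` fst e" "P X" "u = X c" by auto
    then show "u \<in> {u \<in> model M. cvec M c p u e \<in> snd e ` fst e \<and> P (cvec M c p u)}"
      using tangentD[OF X(1) c] by simp
  next
    fix u assume "u \<in> {u \<in> model M. cvec M c p u e \<in> snd e ` fst e \<and> P (cvec M c p u)}"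
    then show "u \<in> (\<lambda>X. X c) ` {X \<in> ?W. P X}"
      using cvec_tangent[OF c] cvec_self[OF c] by (intro image_eqI[of _ _ "cvec M c p u"]) auto
  qed
  have pre_open: "openin (top_of_set (model M)) {u \<in> model M. cvec M c p u e \<in> T}"
    if c: "c \<in> charts_at M p" and T: "openin (top_of_set (model M)) T" for c T
  proof -
    obtain L where L: "linear L" "\<And>u. u \<in> model M \<Longrightarrow> L u = cvec M c p u e" "\<And>u. L u \<in> model M"
      using lin[OF c e] by blast
    have "openin (top_of_set (model M)) (model M \<inter> L -` T)"
      by (rule continuous_openin_preimage[OF linear_continuous_on[OF linear_conv_bounded_linear[THEN iffD1, OF L(1)]] _ T]) (use L(3) in auto)
    moreover have "model M \<inter> L -` T = {u \<in> model M. cvec M c p u e \<in> T}" using L(2) by auto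
    ultimately show ?thesis by simp
  qed
  have kW: "k ` ?W = fst e"
  proof
    show "k ` ?W \<subseteq> fst e" using k cpoint_in[OF ce(1), of _ "fst e"] by auto
    show "fst e \<subseteq> k ` ?W"
    proof
      fix q assume q: "q \<in> fst e"
      then have m: "snd e q \<in> model M" using snd_in_model[OF ce(1)] by blast
      have "k (cvec M e p (snd e q)) = q"
        using k[OF cvec_tangent[OF e m]] cvec_self[OF e m] q cpoint_chart[OF ce(1)] by simp
      then show "q \<in> k ` ?W" using cvec_tangent[OF e m] cvec_self[OF e m] q by force
    qed
  qed
  have inj: "inj_on k ?W"
  proof (rule inj_onI)
    fix X Y assume XY: "X \<in> ?W" "Y \<in> ?W" "k X = k Y"
    then have "X e = Y e" using k chart_cpoint[OF ce(1)] by (metis (mono_tags, lifting) mem_Collect_eq)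
    then show "X = Y" using tangent_eqI[OF _ _ e] XY by blast
  qed
  have inv_k: "inv_into ?W k q = cvec M e p (snd e q)" if q: "q \<in> fst e" for q
  proof (rule inv_into_f_eq[OF inj])
    have m: "snd e q \<in> model M" using snd_in_model[OF ce(1) q] .
    show "cvec M e p (snd e q) \<in> ?W" using cvec_tangent[OF e m] cvec_self[OF e m] q by simp
    show "k (cvec M e p (snd e q)) = q"
      using k[OF cvec_tangent[OF e m]] cvec_self[OF e m] q cpoint_chart[OF ce(1)] by simp
  qed
  have tz: "tzero \<in> tangent_space M p"
  proof -
    have "cvec M e p 0 \<in> tangent_space M p" using cvec_tangent[OF e] model_subspace subspace_0 by blast
    then show ?thesis using tangent_add_scale(3)[OF p] by blast
  qed
  have k0: "k tzero = p" using k[OF tz] e0' cpoint_chart[OF ce] e0 by (simp add: tzero_def)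
  have smooth1: "smooth_on (model M) {u \<in> model M. cvec M c p u e \<in> snd e ` (fst e \<inter> fst d)} (\<lambda>x. snd d (k (cvec M c p x)))"
    if c: "c \<in> charts_at M p" and d: "d \<in> charts M" for c d
  proof -
    let ?D = "{u \<in> model M. cvec M c p u e \<in> snd e ` (fst e \<inter> fst d)}"
    obtain L where L: "linear L" "\<And>u. u \<in> model M \<Longrightarrow> L u = cvec M c p u e" using lin[OF c e] by blast
    have V: "rel_open (model M) (snd e ` (fst e \<inter> fst d))" by (rule chart_image_open[OF ce(1) chart_openin[OF d]])
    have D: "rel_open (model M) ?D" using pre_open[OF c] V by blast
    have "smooth_on (model M) ?D (\<lambda>x. snd d (cpoint e (L x)))"
      by (rule smooth_on_compose[OF D V _ smooth_on_linear[OF L(1)] transition_smooth[OF ce(1) d]]) (use L(2) in auto)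
    then show ?thesis
      by (rule smooth_on_cong[THEN iffD1, rotated]) (use k cvec_tangent[OF c] L(2) in auto)
  qed
  have smooth2: "smooth_on (model M) (snd d ` (fst e \<inter> fst d)) (\<lambda>y. inv_into ?W k (cpoint d y) c)"
    if c: "c \<in> charts_at M p" and d: "d \<in> charts M" for c d
  proof -
    obtain L where L: "linear L" "\<And>u. u \<in> model M \<Longrightarrow> L u = cvec M e p u c" using lin[OF e c] by blast
    have "smooth_on (model M) (snd d ` (fst d \<inter> fst e)) (\<lambda>y. L (snd e (cpoint d y)))"
      by (rule smooth_on_linear_comp[OF _ transition_smooth[OF d ce(1)]]) (use L(1) linear_conv_bounded_linear in blast)
    then show ?thesis unfolding Int_commute[of "fst e"]
      by (rule smooth_on_cong[THEN iffD1, rotated])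
        (use cpoint_chart[OF d] inv_k L(2) snd_in_model[OF ce(1)] in auto)
  qed
  have vel: "velocity M (\<lambda>t. k (tscale t X)) = X" if X: "X \<in> tangent_space M p" for X
  proof -
    have m: "X e \<in> model M" using tangentD(1)[OF X e] .
    have "\<forall>\<^sub>F t in nhds 0. 0 + t *\<^sub>R X e \<in> snd e ` fst e"
      by (rule eventually_line[OF chart_rel_open[OF ce(1)] e0' m])
    then have "\<forall>\<^sub>F t in nhds 0. k (tscale t X) = chart_line e p (X e) t"
      by eventually_elim (use k tangent_add_scale(2)[OF p X X] in \<open>auto simp: chart_line_def e0 tscale_def\<close>)
    from velocity_cong[where M = M, OF this] show ?thesis using tangentD(2)[OF X e] by (simp add: cvec_def)
  qed
  have eq2: "(\<lambda>X. X c) ` {X \<in> ?W. k X \<in> fst d} = {u \<in> model M. cvec M c p u e \<in> snd e ` (fst e \<inter> fst d)}"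
    if c: "c \<in> charts_at M p" and d: "d \<in> charts M" for c d
  proof -
    have "k (cvec M c p u) \<in> fst d \<longleftrightarrow> cvec M c p u e \<in> snd e ` (fst e \<inter> fst d)"
      if u: "u \<in> model M" "cvec M c p u e \<in> snd e ` fst e" for u
    proof -
      have "k (cvec M c p u) = cpoint e (cvec M c p u e)" by (rule k[OF cvec_tangent[OF c u(1)] u(2)])
      then show ?thesis using u(2) cpoint_chart[OF ce(1)] cpoint_in[OF ce(1), of _ "fst e \<inter> fst d"]
        by (auto simp: image_iff)
    qed
    then show ?thesis unfolding image_eq[OF c] by auto
  qed
  show ?thesis
    unfolding anchored_coordinates_def
  proof (intro conjI ballI)
    show "tzero \<in> ?W" using tz e0' by (simp add: tzero_def)
    fix c assume c: "c \<in> charts_at M p"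
    have "(\<lambda>X. X c) ` ?W = {u \<in> model M. cvec M c p u e \<in> snd e ` fst e}" using image_eq[OF c, of "\<lambda>_. True"] by simp
    then show "openin (top_of_set (model M)) ((\<lambda>X. X c) ` ?W)" using pre_open[OF c] chart_rel_open[OF ce(1)] by simp
    fix d assume d: "d \<in> charts M"
    show "openin (top_of_set (model M)) ((\<lambda>X. X c) ` {X \<in> ?W. k X \<in> fst d})"
      unfolding eq2[OF c d] using pre_open[OF c] chart_image_open[OF ce(1) chart_openin[OF d]] by blast
    show "smooth_on (model M) ((\<lambda>X. X c) ` {X \<in> ?W. k X \<in> fst d}) (\<lambda>x. snd d (k (cvec M c p x)))"
      unfolding eq2[OF c d] by (rule smooth1[OF c d])
    show "smooth_on (model M) (snd d ` (k ` ?W \<inter> fst d)) (\<lambda>y. inv_into ?W k (cpoint d y) c)"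
      unfolding kW by (rule smooth2[OF c d])
  qed (use inj kW chart_openin[OF ce(1)] k0 vel in auto)
qed

text \<open>The passage back: anchored coordinates are themselves a chart in the maximal atlas,
  after which everything can be computed in one centred chart.\<close>

lemma chart_from_anchored:
  assumes p: "p \<in> topspace (mtop M)" and k: "anchored_coordinates M p W k"
  obtains e where "e \<in> charts_at M p" "snd e p = 0" "W = {X \<in> tangent_space M p. X e \<in> snd e ` fst e}"
    "\<And>X. X \<in> W \<Longrightarrow> k X = cpoint e (X e)"
proof -
  obtain c where c: "c \<in> charts_at M p" using charts_at_obtain[OF p] .
  note k' = k[unfolded anchored_coordinates_def]
  have WT: "W \<subseteq> tangent_space M p" and W0: "tzero \<in> W" and inj: "inj_on k W" and kWo: "openin (mtop M) (k ` W)"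
    and k0: "k tzero = p" and Wo: "openin (top_of_set (model M)) ((\<lambda>X. X c) ` W)"
    and vel: "\<And>X. X \<in> tangent_space M p \<Longrightarrow> velocity M (\<lambda>t. k (tscale t X)) = X"
    using k' c by blast+
  have kd: "openin (top_of_set (model M)) ((\<lambda>X. X c) ` {X \<in> W. k X \<in> fst d})"
    "smooth_on (model M) ((\<lambda>X. X c) ` {X \<in> W. k X \<in> fst d}) (\<lambda>x. snd d (k (cvec M c p x)))"
    "smooth_on (model M) (snd d ` (k ` W \<inter> fst d)) (\<lambda>y. inv_into W k (cpoint d y) c)" if "d \<in> charts M" for d
    using k' c that by blast+
  \<comment> \<open>The inverse of \<open>k\<close> followed by the linear coordinates that the
    auxiliary chart \<open>c\<close> provides on the tangent space.\<close>
  define \<phi> where "\<phi> q = inv_into W k q c" for q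
  have \<phi>k: "\<phi> (k X) = X c" if "X \<in> W" for X using inv_into_f_f[OF inj that] by (simp add: \<phi>_def)
  have injc: "X = Y" if "X \<in> tangent_space M p" "Y \<in> tangent_space M p" "X c = Y c" for X Y
    using tangent_eqI[OF that(1,2) c that(3)] .
  let ?e = "(k ` W, \<phi>)"
  have inj\<phi>: "inj_on \<phi> (k ` W)" using injc WT \<phi>k by (auto simp: inj_on_def)
  have cp: "cpoint ?e (X c) = k X" if "X \<in> W" for X
    unfolding cpoint_def using inv_into_f_f[OF inj\<phi>, of "k X"] that \<phi>k by auto
  have im: "\<phi> ` (k ` W \<inter> fst d) = (\<lambda>X. X c) ` {X \<in> W. k X \<in> fst d}" for d :: "('m, 'e) chart"
    using \<phi>k by (force simp: image_iff)
  have im': "\<phi> ` k ` W = (\<lambda>X. X c) ` W" using \<phi>k by (force simp: image_iff)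
  have "?e \<in> charts M"
  proof (rule chart_intro[OF kWo _ inj\<phi>])
    show "openin (top_of_set (model M)) (\<phi> ` k ` W)" unfolding im' by (rule Wo)
    fix d assume d: "d \<in> charts M"
    show "openin (top_of_set (model M)) (\<phi> ` (k ` W \<inter> fst d))" unfolding im by (rule kd(1)[OF d])
    show "smooth_on (model M) (snd d ` (fst d \<inter> k ` W)) (\<lambda>y. \<phi> (cpoint d y))"
      using kd(3)[OF d] by (simp add: \<phi>_def Int_commute)
    have eq: "snd d (k (cvec M c p x)) = snd d (cpoint ?e x)" if "x \<in> (\<lambda>X. X c) ` {X \<in> W. k X \<in> fst d}" for x
      using that cp WT tangentD(2)[OF _ c] by auto
    show "smooth_on (model M) (\<phi> ` (k ` W \<inter> fst d)) (\<lambda>x. snd d (cpoint ?e x))"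
      unfolding im by (rule smooth_on_cong[THEN iffD1, OF eq kd(2)[OF d]])
  qed
  moreover have "p \<in> k ` W" using k0 W0 by blast
  ultimately have e: "?e \<in> charts_at M p" by (simp add: charts_at_def)
  have W_iff: "X \<in> W" if "X \<in> tangent_space M p" "X c \<in> (\<lambda>X. X c) ` W" for X
    using that injc WT by blast
  \<comment> \<open>The differential of \<open>k\<close> at 0 is the identity, so a tangent vector
    has the same components in the new chart as in \<open>c\<close>.\<close>
  have Xe: "X ?e = X c" if X: "X \<in> tangent_space M p" for X
  proof -
    have m: "X c \<in> model M" using tangentD(1)[OF X c] .
    have U: "rel_open (model M) ((\<lambda>X. X c) ` W)" using Wo model_subspace by simp
    have "0 \<in> (\<lambda>X. X c) ` W" using W0 by (force simp: tzero_def)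
    from eventually_line[OF U this m] have "\<forall>\<^sub>F t in nhds 0. \<phi> (k (tscale t X)) = t *\<^sub>R X c"
    proof eventually_elim
      case (elim t)
      have "tscale t X \<in> W" using elim by (intro W_iff tangent_add_scale(2)[OF p X X]) (simp add: tscale_def)
      then show ?case using \<phi>k by (simp add: tscale_def)
    qed
    then have "vector_derivative (\<lambda>t. \<phi> (k (tscale t X))) (at 0) = vector_derivative (\<lambda>t. t *\<^sub>R X c) (at 0)"
      by (intro vector_derivative_cong_eq) auto
    also have "\<dots> = X c" by (rule vector_derivative_at) (auto intro!: derivative_eq_intros)
    finally have "velocity M (\<lambda>t. k (tscale t X)) ?e = X c"
      using e k0 by (simp add: velocity_def tscale_def tzero_def[symmetric])
    then show ?thesis using vel[OF X] by simp
  qed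
  have e0: "snd ?e p = 0" using \<phi>k[OF W0] k0 by (simp add: tzero_def)
  have We: "W = {X \<in> tangent_space M p. X ?e \<in> snd ?e ` fst ?e}"
  proof -
    have iff: "X \<in> W \<longleftrightarrow> X \<in> tangent_space M p \<and> X ?e \<in> (\<lambda>X. X c) ` W" for X
    proof (cases "X \<in> tangent_space M p")
      case True
      have "X \<in> W \<longleftrightarrow> X c \<in> (\<lambda>X. X c) ` W" using W_iff[OF True] by blast
      then show ?thesis using Xe[OF True] True by simp
    qed (use WT in blast)
    show ?thesis unfolding fst_conv snd_conv im' by (rule set_eqI, subst mem_Collect_eq) (rule iff)
  qed
  have ke: "k X = cpoint ?e (X ?e)" if X: "X \<in> W" for X
    unfolding Xe[OF subsetD[OF WT X]] by (rule cp[OF X, symmetric])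
  show ?thesis by (rule that[OF e e0 We ke])
qed

end

section \<open>The operator del_dbar in coordinates\<close>

lemma dbar_pullback:
  assumes D: "rel_open EN D" and U: "rel_open E U" and f: "smooth_on EN D f" "f ` D \<subseteq> U"
    and \<theta>: "smooth_on E U \<theta>" and y: "y \<in> D" and w: "w \<in> EN"
    and J: "acs_coef N c y w \<in> EN" "dir_deriv f (acs_coef N c y w) y = I (dir_deriv f w y)"
    and cs: "complex_structure_on E I"
  shows "dbar N c (\<lambda>y. \<theta> (f y)) y w = cdd \<i> I (dir_deriv f w y) (\<lambda>x. of_real (\<theta> x)) (f y)"
proof -
  have fy: "f y \<in> U" using f(2) y by blast
  note df = smooth_on_differentiable[OF D f(1) y] and d\<theta> = smooth_on_differentiable[OF U \<theta> fy]
  have a: "dir_deriv f w y \<in> E"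
    using dir_deriv_in[OF D y w df, of E] U f(2) rel_open_subset[OF U] by blast
  then have Ia: "I (dir_deriv f w y) \<in> E" using complex_structure_onD(1)[OF cs] U by blast
  note r = dir_deriv_linear_comp[OF bounded_linear_of_real U fy _ d\<theta>]
  show ?thesis
    unfolding dbar_def cdd_def r[OF a] r[OF Ia]
      dir_deriv_chain[OF D U y w f(2) df d\<theta>] dir_deriv_chain[OF D U y J(1) f(2) df d\<theta>] J(2) ..
qed

text \<open>After the chain rule for \<open>dbar\<close>, the second derivative of \<open>f\<close>
  is symmetric in the two directions and drops out of the exterior derivative. Averaging with the
  pair rotated by \<open>I\<close> leaves the (1,0)-part. The source structure may vary with the
  point as long as \<open>f\<close> intertwines it with the constant \<open>I\<close>.\<close>

lemma del_dbar_pullback: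
  fixes E EN :: "'e::euclidean_space set"
  assumes D: "rel_open EN D" and U: "rel_open E U" and f: "smooth_on EN D f" "f ` D \<subseteq> U"
    and \<theta>: "smooth_on E U \<theta>"
    and J: "\<And>y w. y \<in> D \<Longrightarrow> w \<in> EN \<Longrightarrow> acs_coef N c y w \<in> EN"
      "\<And>y w. y \<in> D \<Longrightarrow> w \<in> EN \<Longrightarrow> dir_deriv f (acs_coef N c y w) y = I (dir_deriv f w y)"
    and cs: "complex_structure_on E I" and y: "y \<in> D" and u: "u \<in> EN" and w: "w \<in> EN"
  defines "\<Theta> \<equiv> \<lambda>x. complex_of_real (\<theta> x)"
  shows "del_dbar N c (\<lambda>y. \<theta> (f y)) y u w =
    cdd (-\<i>) I (dir_deriv f u y) (cdd \<i> I (dir_deriv f w y) \<Theta>) (f y)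
    - cdd (-\<i>) I (dir_deriv f w y) (cdd \<i> I (dir_deriv f u y) \<Theta>) (f y)"
proof -
  have E: "subspace E" and EN: "subspace EN" using U D by auto
  have \<Theta>: "smooth_on E U \<Theta>" unfolding \<Theta>_def by (rule smooth_on_linear_comp[OF bounded_linear_of_real \<theta>])
  have fy: "f y \<in> U" if "y \<in> D" for y using f(2) that by blast
  note df = smooth_on_differentiable[OF D f(1)]
  note cI = complex_structure_onD[OF cs E]
  have a: "dir_deriv f w y \<in> E" if "y \<in> D" "w \<in> EN" for y w
    using dir_deriv_in[OF D that df[OF that(1)] E] f(2) rel_open_subset[OF U] by blast
  obtain B where B: "finite B" "B \<subseteq> E" "\<And>v. v \<in> E \<Longrightarrow> (\<Sum>b\<in>B. (v \<bullet> b) *\<^sub>R b) = v"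
    using subspace_onb[OF E] by metis
  have BE: "b \<in> E" if "b \<in> B" for b using that B(2) by blast
  have expand: "cdd \<i> I v \<Theta> x = (\<Sum>b\<in>B. of_real (v \<bullet> b) * cdd \<i> I b \<Theta> x)" if "v \<in> E" "x \<in> U" for v x
    using cdd_dir_sum[OF U cs that(2) B(1) BE \<Theta>, where w = "\<lambda>b. b" and a = "\<lambda>b. v \<bullet> b"] B(3)[OF that(1)] by simp
  have sB: "smooth_on E U (cdd \<i> I b \<Theta>)" if "b \<in> E" for b by (rule cdd_smooth[OF U cs \<Theta> that])
  have key: "dir_deriv (\<lambda>y. dbar N c (\<lambda>y. \<theta> (f y)) y w) u y
      = cdd \<i> I (dir_deriv (dir_deriv f w) u y) \<Theta> (f y) + dir_deriv (cdd \<i> I (dir_deriv f w y) \<Theta>) (dir_deriv f u y) (f y)"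
    if u: "u \<in> EN" and w: "w \<in> EN" for u w
  proof -
    have sw: "smooth_on EN D (dir_deriv f w)" by (rule smooth_on_dir_deriv[OF D f(1) w])
    have s1: "smooth_on EN D (\<lambda>y. complex_of_real (dir_deriv f w y \<bullet> b))" for b
      by (intro smooth_on_linear_comp[OF bounded_linear_of_real] smooth_on_inner sw smooth_on_const)
    have s2: "smooth_on EN D (\<lambda>y. cdd \<i> I b \<Theta> (f y))" if "b \<in> B" for b
      by (rule smooth_on_compose[OF D U f(2,1) sB[OF BE[OF that]]])
    note dif = smooth_on_differentiable[OF D _ y] and difU = smooth_on_differentiable[OF U _ fy[OF y]]
    have Dw: "dir_deriv (dir_deriv f w) u y \<in> E"
      by (rule dir_deriv_in[OF D y u dif[OF sw] E]) (use a[OF _ w] in blast)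
    have bl: "bounded_linear (\<lambda>v. complex_of_real (v \<bullet> b))" for b :: 'e
      by (intro bounded_linear_compose[OF bounded_linear_of_real] bounded_linear_inner_left)
    have "dir_deriv (\<lambda>y. dbar N c (\<lambda>y. \<theta> (f y)) y w) u y
        = dir_deriv (\<lambda>y. \<Sum>b\<in>B. of_real (dir_deriv f w y \<bullet> b) * cdd \<i> I b \<Theta> (f y)) u y"
    proof (rule dir_deriv_cong[OF D y u])
      fix y assume y: "y \<in> D"
      show "dbar N c (\<lambda>y. \<theta> (f y)) y w = (\<Sum>b\<in>B. of_real (dir_deriv f w y \<bullet> b) * cdd \<i> I b \<Theta> (f y))"
        unfolding dbar_pullback[OF D U f \<theta> y w J(1)[OF y w] J(2)[OF y w] cs] \<Theta>_def[symmetric]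
        by (rule expand[OF a[OF y w] fy[OF y]])
    qed
    also have "\<dots> = (\<Sum>b\<in>B. dir_deriv (\<lambda>y. of_real (dir_deriv f w y \<bullet> b) * cdd \<i> I b \<Theta> (f y)) u y)"
      by (intro dir_deriv_sum_fun[OF D y u] dif smooth_on_mult s1 s2)
    also have "\<dots> = (\<Sum>b\<in>B. of_real (dir_deriv f w y \<bullet> b) * dir_deriv (cdd \<i> I b \<Theta>) (dir_deriv f u y) (f y)
        + of_real (dir_deriv (dir_deriv f w) u y \<bullet> b) * cdd \<i> I b \<Theta> (f y))"
    proof (rule sum.cong[OF refl])
      fix b assume b: "b \<in> B"
      show "dir_deriv (\<lambda>y. of_real (dir_deriv f w y \<bullet> b) * cdd \<i> I b \<Theta> (f y)) u y
        = of_real (dir_deriv f w y \<bullet> b) * dir_deriv (cdd \<i> I b \<Theta>) (dir_deriv f u y) (f y)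
        + of_real (dir_deriv (dir_deriv f w) u y \<bullet> b) * cdd \<i> I b \<Theta> (f y)"
        unfolding dir_deriv_mult[OF D y u dif[OF s1] dif[OF s2[OF b]]]
          dir_deriv_linear_comp[OF bl D y u dif[OF sw]]
          dir_deriv_chain[OF D U y u f(2) df[OF y] difU[OF sB[OF BE[OF b]]]] ..
    qed
    also have "\<dots> = (\<Sum>b\<in>B. of_real (dir_deriv f w y \<bullet> b) * dir_deriv (cdd \<i> I b \<Theta>) (dir_deriv f u y) (f y))
        + cdd \<i> I (dir_deriv (dir_deriv f w) u y) \<Theta> (f y)"
      unfolding sum.distrib expand[OF Dw fy[OF y]] ..
    also have "(\<Sum>b\<in>B. of_real (dir_deriv f w y \<bullet> b) * dir_deriv (cdd \<i> I b \<Theta>) (dir_deriv f u y) (f y))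
        = dir_deriv (cdd \<i> I (dir_deriv f w y) \<Theta>) (dir_deriv f u y) (f y)"
    proof -
      let ?v = "dir_deriv f w y" and ?u = "dir_deriv f u y"
      have "dir_deriv (cdd \<i> I ?v \<Theta>) ?u (f y) = dir_deriv (\<lambda>x. \<Sum>b\<in>B. of_real (?v \<bullet> b) * cdd \<i> I b \<Theta> x) ?u (f y)"
        by (rule dir_deriv_cong[OF U fy[OF y] a[OF y u]]) (rule expand[OF a[OF y w]])
      also have "\<dots> = (\<Sum>b\<in>B. dir_deriv (\<lambda>x. of_real (?v \<bullet> b) * cdd \<i> I b \<Theta> x) ?u (f y))"
        by (intro dir_deriv_sum_fun[OF U fy[OF y] a[OF y u]] difU smooth_on_mult smooth_on_const sB BE)
      also have "\<dots> = (\<Sum>b\<in>B. of_real (?v \<bullet> b) * dir_deriv (cdd \<i> I b \<Theta>) ?u (f y))"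
        by (intro sum.cong refl dir_deriv_linear_comp[OF bounded_linear_mult_right U fy[OF y] a[OF y u]] difU sB BE)
      finally show ?thesis by simp
    qed
    finally show ?thesis by simp
  qed
  define \<Psi> where "\<Psi> a b = dir_deriv (cdd \<i> I b \<Theta>) a (f y) - dir_deriv (cdd \<i> I a \<Theta>) b (f y)" for a b
  have one: "d_one_form (dbar N c (\<lambda>y. \<theta> (f y))) y u w = \<Psi> (dir_deriv f u y) (dir_deriv f w y)"
    if "u \<in> EN" "w \<in> EN" for u w
    using key[OF that] key[OF that(2,1)] dir_deriv_commute[OF D f(1) that y] by (simp add: d_one_form_def \<Psi>_def)
  let ?a = "dir_deriv f u y" and ?b = "dir_deriv f w y"
  have ab: "?a \<in> E" "?b \<in> E" using a y u w by auto
  have rot: "dir_deriv (cdd \<i> I (I v) \<Theta>) t (f y) = - \<i> * dir_deriv (cdd \<i> I v \<Theta>) t (f y)" if v: "v \<in> E" and t: "t \<in> E" for v t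
  proof -
    have "dir_deriv (cdd \<i> I (I v) \<Theta>) t (f y) = dir_deriv (\<lambda>x. - \<i> * cdd \<i> I v \<Theta> x) t (f y)"
      by (rule dir_deriv_cong[OF U fy[OF y] t]) (use cdd_rotate[OF U cs _ v \<Theta>, of _ \<i>] in simp)
    also have "\<dots> = - \<i> * dir_deriv (cdd \<i> I v \<Theta>) t (f y)"
      by (rule dir_deriv_linear_comp[OF bounded_linear_mult_right U fy[OF y] t smooth_on_differentiable[OF U sB[OF v] fy[OF y]]])
    finally show ?thesis .
  qed
  have dd: "del_dbar N c (\<lambda>y. \<theta> (f y)) y u w = (\<Psi> ?a ?b + \<Psi> (I ?a) (I ?b)) / 2"
    unfolding del_dbar_def one[OF u w] one[OF J(1)[OF y u] J(1)[OF y w]] J(2)[OF y u] J(2)[OF y w] ..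
  show ?thesis
    unfolding dd \<Psi>_def rot[OF ab(1) cI(1)[OF ab(2)]] rot[OF ab(2) cI(1)[OF ab(1)]]
    unfolding cdd_def[of "-\<i>"] by (simp add: field_simps)
qed

lemma del_dbar_constant:
  fixes E :: "'e::euclidean_space set"
  assumes U: "rel_open E U" and \<theta>: "smooth_on E U \<theta>" and cs: "complex_structure_on E I"
    and I: "\<And>x w. x \<in> U \<Longrightarrow> w \<in> E \<Longrightarrow> acs_coef M c x w = I w"
    and x: "x \<in> U" and u: "u \<in> E" and w: "w \<in> E"
  shows "del_dbar M c \<theta> x u w =
    cdd (-\<i>) I u (cdd \<i> I w (\<lambda>x. complex_of_real (\<theta> x))) x - cdd (-\<i>) I w (cdd \<i> I u (\<lambda>x. complex_of_real (\<theta> x))) x"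
proof -
  have id: "dir_deriv (\<lambda>x. x) v y = v" for v y :: 'e
    by (simp add: dir_deriv_linear_map bounded_linear_ident)
  have "\<And>x w. x \<in> U \<Longrightarrow> w \<in> E \<Longrightarrow> acs_coef M c x w \<in> E"
    using I complex_structure_onD(1)[OF cs] U by simp
  from del_dbar_pullback[OF U U smooth_on_bounded_linear[OF bounded_linear_ident] _ \<theta> this _ cs x u w] show ?thesis
    by (simp add: id I)
qed

section \<open>Charts of Kaehler manifolds\<close>

context
  fixes M :: "('m, 'e::euclidean_space, 'r) hermitian_structure_scheme"
  assumes K: "kaehler_manifold M"
begin

lemma kaehler_smooth_manifold: "smooth_manifold M" using K by (simp add: kaehler_manifold_def)
lemma kaehler_riemannian: "riemannian_metric M" using K by (simp add: kaehler_manifold_def)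
lemma chart_in_topspace: "c \<in> charts_at M q \<Longrightarrow> q \<in> topspace (mtop M)"
  using openin_subset[OF chart_openin[OF kaehler_smooth_manifold]] charts_atD[OF kaehler_smooth_manifold] by blast

lemma chart_point: "c \<in> charts M \<Longrightarrow> x \<in> snd c ` fst c \<Longrightarrow> c \<in> charts_at M (cpoint c x)"
  using cpoint_in[OF kaehler_smooth_manifold, of c x "fst c"] by (simp add: charts_at_def)

lemma tangent_scale: "c \<in> charts_at M q \<Longrightarrow> X \<in> tangent_space M q \<Longrightarrow> tscale a X \<in> tangent_space M q"
  by (rule tangent_add_scale(2)[OF kaehler_smooth_manifold chart_in_topspace])

lemma kaehler_metric_chart:
  assumes c: "c \<in> charts M"
  shows "metric_chart (model M) (snd c ` fst c) (metr_coef M c)"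
proof
  note R = kaehler_riemannian[unfolded riemannian_metric_def, THEN conjunct1, rule_format]
  show "rel_open (model M) (snd c ` fst c)" by (rule chart_rel_open[OF kaehler_smooth_manifold c])
  show "smooth_on (model M) (snd c ` fst c) (\<lambda>x. metr_coef M c x u w)" if "u \<in> model M" "w \<in> model M" for u w
    using kaehler_riemannian c that by (simp add: riemannian_metric_def)
  fix x assume "x \<in> snd c ` fst c"
  then have q: "c \<in> charts_at M (cpoint c x)" by (rule chart_point[OF c])
  note q' = chart_in_topspace[OF q] and t = cvec_tangent[OF kaehler_smooth_manifold q]
  note R = kaehler_riemannian[unfolded riemannian_metric_def, THEN conjunct1, rule_format, OF q']
  show "metr_coef M c x u w = metr_coef M c x w u" if "u \<in> model M" "w \<in> model M" for u w
    unfolding metr_coef_def by (rule R[OF t[OF that(1)], THEN conjunct1, rule_format, OF t[OF that(2)]])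
  show "metr_coef M c x (u + a *\<^sub>R v) w = metr_coef M c x u w + a * metr_coef M c x v w"
    if "u \<in> model M" "v \<in> model M" "w \<in> model M" for u v w a
  proof -
    have "a *\<^sub>R v \<in> model M" using that model_subspace[OF kaehler_smooth_manifold] by (auto intro: subspace_mul)
    then have "cvec M c (cpoint c x) (u + a *\<^sub>R v) = tadd (cvec M c (cpoint c x) u) (tscale a (cvec M c (cpoint c x) v))"
      using cvec_linear[OF kaehler_smooth_manifold q] that by simp
    then show ?thesis unfolding metr_coef_def
      using R[OF t[OF that(1)], THEN conjunct2, THEN conjunct1, rule_format, OF t[OF that(2)] t[OF that(3)]] by simp
  qed
  show "metr_coef M c x u u > 0" if "u \<in> model M" "u \<noteq> 0" for u
  proof -
    have "cvec M c (cpoint c x) u \<noteq> tzero"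
      using cvec_self[OF kaehler_smooth_manifold q that(1)] that(2) by (auto simp: tzero_def)
    then show ?thesis unfolding metr_coef_def using R[OF t[OF that(1)]] by blast
  qed
qed

lemma acs_facts:
  assumes "q \<in> topspace (mtop M)" "X \<in> tangent_space M q"
  shows "acs M q X \<in> tangent_space M q" "acs M q (acs M q X) = tscale (-1) X"
    "Y \<in> tangent_space M q \<Longrightarrow> acs M q (tadd X (tscale a Y)) = tadd (acs M q X) (tscale a (acs M q Y))"
    "Y \<in> tangent_space M q \<Longrightarrow> metr M q (acs M q X) (acs M q Y) = metr M q X Y"
  using K assms by (auto simp: kaehler_manifold_def almost_complex_structure_def)

lemma acs_cvec:
  assumes c: "c \<in> charts_at M q" and u: "u \<in> model M"
  shows "acs_coef M c (snd c q) u \<in> model M"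
    "acs M q (cvec M c q u) = cvec M c q (acs_coef M c (snd c q) u)"
proof -
  have cq: "cpoint c (snd c q) = q" using cpoint_chart[OF kaehler_smooth_manifold] charts_atD[OF kaehler_smooth_manifold c] by blast
  have t: "acs M q (cvec M c q u) \<in> tangent_space M q"
    by (rule acs_facts[OF chart_in_topspace[OF c] cvec_tangent[OF kaehler_smooth_manifold c u]])
  have "acs_coef M c (snd c q) u = acs M q (cvec M c q u) c" by (simp add: acs_coef_def cq)
  then show "acs_coef M c (snd c q) u \<in> model M" "acs M q (cvec M c q u) = cvec M c q (acs_coef M c (snd c q) u)"
    using tangentD[OF kaehler_smooth_manifold t c] by simp_all
qed

lemma acs_coef_complex:
  assumes c: "c \<in> charts M" and x: "x \<in> snd c ` fst c"
  shows "complex_structure_on (model M) (acs_coef M c x)"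
    "u \<in> model M \<Longrightarrow> w \<in> model M \<Longrightarrow> metr_coef M c x (acs_coef M c x u) (acs_coef M c x w) = metr_coef M c x u w"
proof -
  note q = chart_point[OF c x] and xc = chart_cpoint[OF kaehler_smooth_manifold c x]
  note top = chart_in_topspace[OF q] and t = cvec_tangent[OF kaehler_smooth_manifold q] and A = acs_cvec[OF q, unfolded xc]
  have sq: "acs_coef M c x (acs_coef M c x u) = - u" if u: "u \<in> model M" for u
  proof -
    have "cvec M c (cpoint c x) (acs_coef M c x (acs_coef M c x u)) = tscale (-1) (cvec M c (cpoint c x) u)"
      using acs_facts(2)[OF top t[OF u]] A(2)[OF u] A(2)[OF A(1)[OF u]] by simp
    then have "cvec M c (cpoint c x) (acs_coef M c x (acs_coef M c x u)) c = - cvec M c (cpoint c x) u c"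
      by (simp add: tscale_def)
    then show ?thesis using cvec_self[OF kaehler_smooth_manifold q] A(1) u by simp
  qed
  have lin: "acs_coef M c x (u + a *\<^sub>R v) = acs_coef M c x u + a *\<^sub>R acs_coef M c x v"
    if uv: "u \<in> model M" "v \<in> model M" for u v a
  proof -
    have av: "a *\<^sub>R v \<in> model M" using uv model_subspace[OF kaehler_smooth_manifold] by (auto intro: subspace_mul)
    then have "cvec M c (cpoint c x) (u + a *\<^sub>R v) = tadd (cvec M c (cpoint c x) u) (tscale a (cvec M c (cpoint c x) v))"
      using cvec_linear[OF kaehler_smooth_manifold q] uv by simp
    then show ?thesis
      unfolding acs_coef_def using acs_facts(3)[OF top t[OF uv(1)] t[OF uv(2)], of a] by (simp add: tadd_def tscale_def)
  qed
  show "complex_structure_on (model M) (acs_coef M c x)"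
    unfolding complex_structure_on_def using A(1) sq lin by simp
  show "metr_coef M c x (acs_coef M c x u) (acs_coef M c x w) = metr_coef M c x u w" if "u \<in> model M" "w \<in> model M"
    unfolding metr_coef_def A(2)[OF that(1), symmetric] A(2)[OF that(2), symmetric]
    by (rule acs_facts(4)[OF top t[OF that(1)] t[OF that(2)]])
qed

lemma christoffel_koszul:
  assumes c: "c \<in> charts M" and x: "x \<in> snd c ` fst c" and u: "u \<in> model M" and w: "w \<in> model M"
  shows "christoffel M c x u w \<in> model M"
    "z \<in> model M \<Longrightarrow> metr_coef M c x (christoffel M c x u w) z =
      (dir_deriv (\<lambda>x. metr_coef M c x w z) u x + dir_deriv (\<lambda>x. metr_coef M c x u z) w x
       - dir_deriv (\<lambda>x. metr_coef M c x u w) z x) / 2"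
  using theI'[OF metric_chart.koszul_unique[OF kaehler_metric_chart[OF c] x u w]]
  unfolding christoffel_def by blast+

text \<open>When the structure has constant coefficients, the derivative term in
  \<open>parallel_acs\<close> disappears and only the Christoffel terms remain.\<close>

lemma christoffel_complex:
  assumes c: "c \<in> charts M" and const: "\<And>x u. x \<in> snd c ` fst c \<Longrightarrow> u \<in> model M \<Longrightarrow> acs_coef M c x u = I u"
    and x: "x \<in> snd c ` fst c" and u: "u \<in> model M" and w: "w \<in> model M"
  shows "christoffel M c x u (I w) = I (christoffel M c x u w)"
proof -
  have "cov_deriv_along M c (\<lambda>y. y) (\<lambda>y. acs_coef M c y w) u x
      = acs_coef M c x (cov_deriv_along M c (\<lambda>y. y) (\<lambda>y. w) u x)"
    using K c x u w unfolding kaehler_manifold_def parallel_acs_def by blast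
  moreover have "dir_deriv (\<lambda>y. acs_coef M c y w) u x = 0"
  proof -
    have "dir_deriv (\<lambda>y. acs_coef M c y w) u x = dir_deriv (\<lambda>y. I w) u x"
      by (rule dir_deriv_cong[OF chart_rel_open[OF kaehler_smooth_manifold c] x u]) (rule const[OF _ w])
    then show ?thesis by (simp add: dir_deriv_const)
  qed
  moreover have "dir_deriv (\<lambda>y. y) u x = u" by (simp add: dir_deriv_linear_map bounded_linear_ident)
  ultimately show ?thesis
    using const[OF x w] const[OF x christoffel_koszul(1)[OF c x u w]] by (simp add: cov_deriv_along_def dir_deriv_const)
qed

text \<open>In the chart \<open>e\<close> the map \<open>k\<close> is the identity. Holomorphy with
  respect to the fixed structure at p then says that the structure at every point has the same
  coefficients as at p.\<close>

lemma holomorphic_coordinates_constant: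
  assumes e: "e \<in> charts_at M p" and W: "W = {X \<in> tangent_space M p. X e \<in> snd e ` fst e}"
    and k: "\<And>X. X \<in> W \<Longrightarrow> k X = cpoint e (X e)" and hol: "holomorphic_coordinates M p W k"
    and x: "x \<in> snd e ` fst e" and u: "u \<in> model M"
  shows "acs_coef M e x u = acs_coef M e (snd e p) u"
proof -
  note ce = charts_atD[OF kaehler_smooth_manifold e]
  have p: "p \<in> topspace (mtop M)" by (rule chart_in_topspace[OF e])
  have xm: "x \<in> model M" using x rel_open_subset[OF chart_rel_open[OF kaehler_smooth_manifold ce(1)]] by blast
  note q = chart_point[OF ce(1) x] and xc = chart_cpoint[OF kaehler_smooth_manifold ce(1) x]
  let ?q = "cpoint e x" and ?X = "cvec M e p x"
  have X: "?X \<in> W" using W cvec_tangent[OF kaehler_smooth_manifold e xm] cvec_self[OF kaehler_smooth_manifold e xm] x by simp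
  have kX: "k ?X = ?q" using k[OF X] cvec_self[OF kaehler_smooth_manifold e xm] by simp
  have vel: "velocity M (\<lambda>t. k (tadd ?X (tscale t Y))) = cvec M e ?q (Y e)" if Y: "Y \<in> tangent_space M p" for Y
  proof -
    have Ye: "Y e \<in> model M" using tangentD(1)[OF kaehler_smooth_manifold Y e] .
    have "\<forall>\<^sub>F t in nhds 0. x + t *\<^sub>R Y e \<in> snd e ` fst e"
      by (rule eventually_line[OF chart_rel_open[OF kaehler_smooth_manifold ce(1)] x Ye])
    then have "\<forall>\<^sub>F t in nhds 0. k (tadd ?X (tscale t Y)) = chart_line e ?q (Y e) t"
    proof eventually_elim
      case (elim t)
      have c: "tadd ?X (tscale t Y) e = x + t *\<^sub>R Y e"
        using cvec_self[OF kaehler_smooth_manifold e xm] by (simp add: tadd_def tscale_def)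
      have "tadd ?X (tscale t Y) \<in> W"
        unfolding W using elim c tangent_add_scale(1)[OF kaehler_smooth_manifold p cvec_tangent[OF kaehler_smooth_manifold e xm] tangent_scale[OF e Y]] by simp
      from k[OF this] show ?case unfolding c by (simp add: chart_line_def xc)
    qed
    from velocity_cong[where M = M, OF this] show ?thesis by (simp add: cvec_def)
  qed
  let ?Y = "cvec M e p u"
  have Y: "?Y \<in> tangent_space M p" by (rule cvec_tangent[OF kaehler_smooth_manifold e u])
  have AY: "acs M p ?Y \<in> tangent_space M p" by (rule acs_facts[OF p Y])
  have "cvec M e ?q (acs M p ?Y e) = acs M ?q (cvec M e ?q u)"
    using hol[unfolded holomorphic_coordinates_def, rule_format, OF X Y]
    unfolding vel[OF Y] vel[OF AY] kX cvec_self[OF kaehler_smooth_manifold e u] .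
  also have "\<dots> = cvec M e ?q (acs_coef M e x u)" using acs_cvec(2)[OF q u] xc by simp
  finally have "acs M p ?Y e = acs_coef M e x u"
    using cvec_self[OF kaehler_smooth_manifold q] tangentD(1)[OF kaehler_smooth_manifold AY e] acs_cvec(1)[OF q u] xc by metis
  moreover have "acs M p ?Y e = acs_coef M e (snd e p) u"
    using acs_cvec[OF e u] cvec_self[OF kaehler_smooth_manifold e] by simp
  ultimately show ?thesis by simp
qed

end

section \<open>Taylor series\<close>

lemma iter_deriv_of_real:
  fixes u :: "'e::euclidean_space \<Rightarrow> real"
  assumes "rel_open E U" "X \<in> E" "smooth_on E U u" "x \<in> U"
  shows "iter_deriv n X (\<lambda>x. complex_of_real (u x)) x = of_real (iter_deriv n X u x)"
  using assms(4)
proof (induction n arbitrary: x)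
  case (Suc n)
  have "iter_deriv (Suc n) X (\<lambda>x. complex_of_real (u x)) x = dir_deriv (\<lambda>x. complex_of_real (iter_deriv n X u x)) X x"
    using dir_deriv_cong[OF assms(1) Suc.prems assms(2) Suc.IH] by simp
  also have "\<dots> = of_real (iter_deriv (Suc n) X u x)"
    using dir_deriv_linear_comp[OF bounded_linear_of_real assms(1) Suc.prems assms(2)
        smooth_on_differentiable[OF assms(1) iter_deriv_smooth[OF assms(1-3)] Suc.prems]] by simp
  finally show ?case .
qed simp

text \<open>Links the one-variable derivatives in \<open>taylor_series\<close> with iterated
  directional derivatives. The statement holds on the whole open set of parameters because the
  induction differentiates it.\<close>

lemma iter_deriv_eq_deriv:
  fixes u :: "'e::euclidean_space \<Rightarrow> real"
  assumes U: "rel_open E U" and X: "X \<in> E" and u: "smooth_on E U u"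
    and h: "\<And>t. t *\<^sub>R X \<in> U \<Longrightarrow> h t = u (t *\<^sub>R X)" and t: "t *\<^sub>R X \<in> U"
  shows "(deriv ^^ n) h t = iter_deriv n X u (t *\<^sub>R X)"
  using t
proof (induction n arbitrary: t)
  case (Suc n)
  obtain T where T: "open T" "U = E \<inter> T" using U by (auto simp: openin_open)
  have "{t. t *\<^sub>R X \<in> U} = (\<lambda>t. t *\<^sub>R X) -` T" using T X U by (auto intro: subspace_mul)
  moreover have "open ((\<lambda>t. t *\<^sub>R X) -` T)" by (intro open_vimage T(1) continuous_intros)
  ultimately have op: "open {t. t *\<^sub>R X \<in> U}" by simp
  have "deriv ((deriv ^^ n) h) t = deriv (\<lambda>t. iter_deriv n X u (t *\<^sub>R X)) t"
    by (intro deriv_cong_ev eventually_mono[OF eventually_nhds_in_open[OF op]]) (use Suc in auto)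
  also have "\<dots> = dir_deriv (iter_deriv n X u) X (t *\<^sub>R X)"
    using line_has_vector_derivative[OF U _ X, of 0 t "iter_deriv n X u"]
      smooth_on_differentiable[OF U iter_deriv_smooth[OF U X u]] Suc.prems
    by (intro DERIV_imp_deriv) (simp add: has_real_derivative_iff_has_vector_derivative)
  finally show ?case by simp
qed (simp add: h)

lemma jet_eq_deriv:
  fixes u :: "'e::euclidean_space \<Rightarrow> real"
  assumes "rel_open E U" "0 \<in> U" "X \<in> E" "smooth_on E U u" "\<And>t. t *\<^sub>R X \<in> U \<Longrightarrow> h t = u (t *\<^sub>R X)"
  shows "jet n (\<lambda>x. of_real (u x)) X = of_real ((deriv ^^ n) h 0 / fact n)"
  using iter_deriv_eq_deriv[OF assms(1,3,4,5), of 0 n] iter_deriv_of_real[OF assms(1,3,4,2), of n] assms(2)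
  by (simp add: jet_def)

lemma higher_deriv_square: "(deriv ^^ n) (\<lambda>t::real. t * t * c) 0 / fact n = (if n = 2 then c else 0)"
proof -
  have d1: "deriv (\<lambda>t::real. t * t * c) = (\<lambda>t. 2 * c * t)"
    by (rule ext, rule DERIV_imp_deriv) (auto intro!: derivative_eq_intros)
  have d2: "deriv (\<lambda>t::real. 2 * c * t) = (\<lambda>t. 2 * c)"
    by (rule ext, rule DERIV_imp_deriv) (auto intro!: derivative_eq_intros)
  have d3: "deriv (\<lambda>t::real. 2 * c) = (\<lambda>t. 0)" by (rule ext) simp
  have d0: "(deriv ^^ m) (\<lambda>t::real. 0 :: real) = (\<lambda>t. 0)" for m
    by (induction m) auto
  consider "n = 0" | "n = 1" | "n = 2" | m where "n = Suc (Suc (Suc m))"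
    by (metis One_nat_def Suc_1 not0_implies_Suc)
  then show ?thesis
  proof cases
    case 4
    have "(deriv ^^ n) (\<lambda>t::real. t * t * c) = (deriv ^^ m) (\<lambda>t. 0)"
      unfolding 4 funpow_Suc_right o_apply d1 d2 d3 ..
    then show ?thesis using 4 d0 by simp
  qed (simp_all add: d1 d2 numeral_2_eq_2)
qed

lemma smooth_on_polynomial:
  fixes P :: "'e::euclidean_space \<Rightarrow> complex"
  assumes "polynomial_function P" shows "smooth_on E U P"
proof -
  have r: "smooth_on E U p" if "real_polynomial_function p" for p :: "'e \<Rightarrow> real"
    using that
    by (induction p rule: real_polynomial_function.induct)
      (auto intro: smooth_on_bounded_linear smooth_on_const smooth_on_add smooth_on_mult)
  have "real_polynomial_function (Re \<circ> P)" "real_polynomial_function (Im \<circ> P)"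
    using assms bounded_linear_Re bounded_linear_Im by (auto simp: polynomial_function_def)
  then have "smooth_on E U (\<lambda>x. complex_of_real ((Re \<circ> P) x) + \<i> * complex_of_real ((Im \<circ> P) x))"
    by (intro smooth_on_add smooth_on_mult smooth_on_const smooth_on_linear_comp[OF bounded_linear_of_real] r)
  then show ?thesis by (simp add: complex_eq[symmetric])
qed

context
  fixes M :: "('m, 'e::euclidean_space, 'r) hermitian_structure_scheme" and e :: "('m, 'e) chart" and p :: 'm
  assumes K: "kaehler_manifold M" and e: "e \<in> charts_at M p"
begin

text \<open>The equation defining \<open>Sym_bi\<close> is the infinitesimal form of rotation by
  weight \<kappa> - \<kappa>'; smoothness comes from the polynomial that represents \<zeta> in the
  chart.\<close>

lemma Sym_bi_weight:
  assumes \<zeta>: "\<zeta> \<in> Sym_bi M p a b"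
  shows "has_weight (model M) (acs_coef M e (snd e p)) (int a - int b) (\<lambda>x. \<zeta> (cvec M e p x))"
proof -
  note M = kaehler_smooth_manifold[OF K] and t = cvec_tangent[OF kaehler_smooth_manifold[OF K] e]
  obtain P where P: "polynomial_function P" "\<And>X. X \<in> tangent_space M p \<Longrightarrow> \<zeta> X = P (X e)"
    using \<zeta> e by (auto simp: Sym_bi_def homogeneous_poly_def)
  have "smooth_on (model M) (model M) (\<lambda>x. \<zeta> (cvec M e p x))"
    by (rule smooth_on_cong[THEN iffD1, OF _ smooth_on_polynomial[OF P(1)]])
      (simp add: P(2)[OF t] cvec_self[OF M e])
  moreover have "dir_deriv (\<lambda>x. \<zeta> (cvec M e p x)) (acs_coef M e (snd e p) x) x = \<i> * of_int (int a - int b) * \<zeta> (cvec M e p x)"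
    if x: "x \<in> model M" for x
  proof -
    note A = acs_cvec[OF K e x]
    have "cvec M e p (x + s *\<^sub>R acs_coef M e (snd e p) x) = tadd (cvec M e p x) (tscale s (acs M p (cvec M e p x)))" for s
    proof -
      have "s *\<^sub>R acs_coef M e (snd e p) x \<in> model M" using A(1) model_subspace[OF M] by (auto intro: subspace_mul)
      then show ?thesis using cvec_linear[OF M e] A x by simp
    qed
    moreover have "((\<lambda>s. \<zeta> (tadd (cvec M e p x) (tscale s (acs M p (cvec M e p x))))) has_vector_derivative
        \<i> * (of_nat a - of_nat b) * \<zeta> (cvec M e p x)) (at 0)"
      using \<zeta> t[OF x] by (auto simp: Sym_bi_def)
    ultimately show ?thesis unfolding dir_deriv_def by (simp add: vector_derivative_at)
  qed
  ultimately show ?thesis by (simp add: has_weight_def)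
qed

text \<open>Here the constant 4 originates: with a + b = n and b \<ge> 2 the weight is a - b = n - 2
  b \<le> n - 4.\<close>

lemma Sym_ge22_weights:
  assumes \<eta>: "\<eta> \<in> Sym_ge22 M p"
  shows "weights_le (model M) (acs_coef M e (snd e p)) (int n - 4) (\<lambda>x. of_real (\<eta> n (cvec M e p x)))"
proof -
  obtain \<zeta> where \<zeta>: "\<And>a b. \<zeta> a b \<in> Sym_bi M p a b" "\<And>n X. X \<in> tangent_space M p \<Longrightarrow>
      complex_of_real (\<eta> n X) = (\<Sum>(a, b)\<in>{(a, b). a + b = n \<and> a \<ge> 2 \<and> b \<ge> 2}. \<zeta> a b X)"
    using \<eta> unfolding Sym_ge22_def by blast
  \<comment> \<open>Recovers the antiholomorphic degree from the weight k = n - 2 b. For n < 4 the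
    range {2..n - 2} is empty, in accordance with the empty sum.\<close>
  define b where "b k = nat ((int n - k) div 2)" for k
  define z where "z k = (\<lambda>x. \<zeta> (n - b k) (b k) (cvec M e p x))" for k
  let ?S = "(\<lambda>b. int n - 2 * int b) ` {2..n - 2}"
  have "{(a, b). a + b = n \<and> a \<ge> 2 \<and> b \<ge> 2} = (\<lambda>b. (n - b, b)) ` {2..n - 2}"
    by (auto simp: image_iff)
  then have "complex_of_real (\<eta> n (cvec M e p x)) = (\<Sum>k\<in>?S. z k x)" if "x \<in> model M" for x
    using \<zeta>(2)[OF cvec_tangent[OF kaehler_smooth_manifold[OF K] e that], of n]
    by (simp add: sum.reindex inj_on_def z_def b_def)
  moreover have "k \<le> int n - 4 \<and> has_weight (model M) (acs_coef M e (snd e p)) k (z k)" if kS: "k \<in> ?S" for k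
  proof -
    obtain c where c: "2 \<le> c" "c \<le> n - 2" "k = int n - 2 * int c" using kS by auto
    have "b k = c" "int (n - c) - int c = k" using c by (auto simp: b_def)
    then show ?thesis using Sym_bi_weight[OF \<zeta>(1), of "n - c" c] c by (simp add: z_def)
  qed
  ultimately show ?thesis unfolding weights_le_def by (intro exI[of _ ?S] exI[of _ z]) auto
qed

text \<open>Translates the intrinsic definition of normal coordinates into the hypotheses of the
  locale \<open>kaehler_chart\<close>. The chart is cut down to \<open>V\<close>, where the
  potential lives.\<close>

theorem kaehler_chart_at:
  assumes e0: "snd e p = 0" and const: "\<And>x u. x \<in> snd e ` fst e \<Longrightarrow> u \<in> model M \<Longrightarrow> acs_coef M e x u = acs_coef M e 0 u"
    and k: "\<And>X. X \<in> tangent_space M p \<Longrightarrow> X e \<in> snd e ` fst e \<Longrightarrow> k X = cpoint e (X e)"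
    and pot: "local_potential M V \<theta>" and pV: "p \<in> V"
    and taylor: "(\<lambda>n X. taylor_series (\<lambda>X. \<theta> (k X)) n X - (if n = 2 then metr M p X X else 0)) \<in> Sym_ge22 M p"
  shows "kaehler_chart (model M) (snd e ` (fst e \<inter> V)) (metr_coef M e) (acs_coef M e 0) (christoffel M e)
    (\<lambda>x. complex_of_real (\<theta> (cpoint e x)))"
proof -
  note M = kaehler_smooth_manifold[OF K] and ce = charts_atD[OF kaehler_smooth_manifold[OF K] e]
  let ?E = "model M" and ?U = "snd e ` (fst e \<inter> V)" and ?I = "acs_coef M e 0"
  have V: "openin (mtop M) V" using pot by (simp add: local_potential_def)
  have U: "rel_open ?E ?U" by (rule chart_image_open[OF M ce(1) V])
  have sub: "?U \<subseteq> snd e ` fst e" by blast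
  have U0: "0 \<in> ?U" using e0 ce pV by force
  interpret m: metric_chart ?E "snd e ` fst e" "metr_coef M e" by (rule kaehler_metric_chart[OF K ce(1)])
  have cp0: "cpoint e 0 = p" using cpoint_chart[OF M ce] e0 by simp
  have cs: "complex_structure_on ?E ?I" by (rule acs_coef_complex[OF K ce(1)]) (use U0 sub in blast)
  have \<theta>: "smooth_on ?E ?U (\<lambda>x. \<theta> (cpoint e x))"
    "\<And>x u w. x \<in> ?U \<Longrightarrow> u \<in> ?E \<Longrightarrow> w \<in> ?E \<Longrightarrow> complex_of_real (metr_coef M e x (acs_coef M e x u) w)
      = \<i> / 2 * del_dbar M e (\<lambda>x. \<theta> (cpoint e x)) x u w"
    using pot ce(1) by (auto simp: local_potential_def)
  show ?thesis
  proof
    show "rel_open ?E ?U" by (rule U)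
    fix x assume "x \<in> ?U"
    then have x: "x \<in> ?U" "x \<in> snd e ` fst e" using sub by auto
    show "metr_coef M e x u w = metr_coef M e x w u" if "u \<in> ?E" "w \<in> ?E" for u w by (rule m.g_sym[OF x(2) that])
    show "metr_coef M e x (u + a *\<^sub>R v) w = metr_coef M e x u w + a * metr_coef M e x v w"
      if "u \<in> ?E" "v \<in> ?E" "w \<in> ?E" for u v w a by (rule m.g_lin[OF x(2) that])
    show "0 < metr_coef M e x u u" if "u \<in> ?E" "u \<noteq> 0" for u by (rule m.g_pos[OF x(2) that])
    show "metr_coef M e x (?I u) (?I w) = metr_coef M e x u w" if "u \<in> ?E" "w \<in> ?E" for u w
      using acs_coef_complex(2)[OF K ce(1) x(2) that] const[OF x(2)] that by simp
    show "christoffel M e x u w \<in> ?E" if "u \<in> ?E" "w \<in> ?E" for u w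
      by (rule christoffel_koszul[OF K ce(1) x(2) that])
    show "metr_coef M e x (christoffel M e x u w) z =
      (dir_deriv (\<lambda>x. metr_coef M e x w z) u x + dir_deriv (\<lambda>x. metr_coef M e x u z) w x
       - dir_deriv (\<lambda>x. metr_coef M e x u w) z x) / 2" if "u \<in> ?E" "w \<in> ?E" "z \<in> ?E" for u w z
      by (rule christoffel_koszul(2)[OF K ce(1) x(2) that])
    show "christoffel M e x u (?I w) = ?I (christoffel M e x u w)" if "u \<in> ?E" "w \<in> ?E" for u w
      by (rule christoffel_complex[OF K ce(1) const x(2) that])
    show "complex_of_real (metr_coef M e x (?I u) w) = \<i> / 2 *
        (cdd (- \<i>) ?I u (cdd \<i> ?I w (\<lambda>x. complex_of_real (\<theta> (cpoint e x)))) x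
        - cdd (- \<i>) ?I w (cdd \<i> ?I u (\<lambda>x. complex_of_real (\<theta> (cpoint e x)))) x)" if uw: "u \<in> ?E" "w \<in> ?E" for u w
      using \<theta>(2)[OF x(1) uw] unfolding const[OF x(2) uw(1)]
      using del_dbar_constant[OF U \<theta>(1) cs const x(1) uw] sub by auto
  next
    show "smooth_on ?E ?U (\<lambda>x. metr_coef M e x u w)" if "u \<in> ?E" "w \<in> ?E" for u w
      by (rule smooth_on_subset[OF m.g_smooth[OF that] sub])
    show "0 \<in> ?U" by (rule U0)
    show "complex_structure_on ?E ?I" by (rule cs)
    show "smooth_on ?E ?U (\<lambda>x. complex_of_real (\<theta> (cpoint e x)))"
      by (rule smooth_on_linear_comp[OF bounded_linear_of_real \<theta>(1)])
    show "jet_weights ?E ?I 4 (\<lambda>x. complex_of_real (\<theta> (cpoint e x)) - complex_of_real (metr_coef M e 0 x x))"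
      unfolding jet_weights_def
    proof
      fix n
      define q where "q x = metr_coef M e 0 x x" for x
      obtain B where B: "finite B" "B \<subseteq> ?E" "\<And>v. v \<in> ?E \<Longrightarrow> (\<Sum>b\<in>B. (v \<bullet> b) *\<^sub>R b) = v"
        using subspace_onb[OF model_subspace[OF M]] by metis
      have BE: "b \<in> ?E" if "b \<in> B" for b using that B(2) by blast
      have z: "0 \<in> snd e ` fst e" using U0 sub by blast
      \<comment> \<open>The metric at 0 is bilinear on the model only, so smoothness of the
        quadratic form is read off from its polynomial expression in coordinates.\<close>
      have "smooth_on ?E ?U (\<lambda>x. \<Sum>i\<in>B. (x \<bullet> i) * (\<Sum>j\<in>B. (x \<bullet> j) * metr_coef M e 0 i j))"
        by (intro smooth_on_sum smooth_on_mult smooth_on_const smooth_on_bounded_linear bounded_linear_inner_left)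
      moreover have "(\<Sum>i\<in>B. (x \<bullet> i) * (\<Sum>j\<in>B. (x \<bullet> j) * metr_coef M e 0 i j)) = q x" if "x \<in> ?U" for x
      proof -
        have x: "x \<in> ?E" using that rel_open_subset[OF U] by blast
        have "(\<Sum>i\<in>B. (x \<bullet> i) * (\<Sum>j\<in>B. (x \<bullet> j) * metr_coef M e 0 i j)) = (\<Sum>i\<in>B. (x \<bullet> i) * metr_coef M e 0 i x)"
          using m.g_sum(2)[OF z B(1) BE, where a = "\<lambda>b. x \<bullet> b" and v = "\<lambda>b. b"] B(3)[OF x] BE by simp
        also have "\<dots> = q x"
          using m.g_sum(1)[OF z B(1) BE x, where a = "\<lambda>b. x \<bullet> b" and v = "\<lambda>b. b"] B(3)[OF x] by (simp add: q_def)
        finally show ?thesis .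
      qed
      ultimately have q: "smooth_on ?E ?U q" by (rule smooth_on_cong[THEN iffD1, rotated])
      have "weights_le ?E ?I (int n - 4) (\<lambda>x. of_real (taylor_series (\<lambda>X. \<theta> (k X)) n (cvec M e p x)
          - (if n = 2 then metr M p (cvec M e p x) (cvec M e p x) else 0)))"
        using Sym_ge22_weights[OF taylor, of n] e0 by simp
      moreover have "of_real (taylor_series (\<lambda>X. \<theta> (k X)) n (cvec M e p x)
          - (if n = 2 then metr M p (cvec M e p x) (cvec M e p x) else 0))
          = jet n (\<lambda>x. complex_of_real (\<theta> (cpoint e x)) - complex_of_real (metr_coef M e 0 x x)) x" if x: "x \<in> ?E" for x
      proof -
        let ?X = "cvec M e p x"
        have t: "?X \<in> tangent_space M p" by (rule cvec_tangent[OF M e x])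
        have j1: "jet n (\<lambda>x. of_real (\<theta> (cpoint e x))) x = of_real (taylor_series (\<lambda>X. \<theta> (k X)) n ?X)"
          unfolding taylor_series_def
        proof (rule jet_eq_deriv[OF U U0 x \<theta>(1)])
          fix s assume "s *\<^sub>R x \<in> ?U"
          moreover have "tscale s ?X e = s *\<^sub>R x" using cvec_self[OF M e x] by (simp add: tscale_def)
          ultimately show "\<theta> (k (tscale s ?X)) = \<theta> (cpoint e (s *\<^sub>R x))"
            using k[OF tangent_scale[OF K e t, of s]] sub by auto
        qed
        have j2: "jet n (\<lambda>x. of_real (q x)) x = of_real (if n = 2 then q x else 0)"
          unfolding higher_deriv_square[of n "q x", symmetric]
        proof (rule jet_eq_deriv[OF U U0 x q])
          fix s show "s * s * q x = q (s *\<^sub>R x)"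
            using m.g_simps(3,4)[OF z _ x x] x model_subspace[OF M]
            by (simp add: q_def m.g_simps(3)[OF z x x] m.g_simps(4)[OF z _ x x] subspace_mul)
        qed
        have "jet n (\<lambda>x. complex_of_real (\<theta> (cpoint e x)) - complex_of_real (q x)) x
          = jet n (\<lambda>x. of_real (\<theta> (cpoint e x))) x - jet n (\<lambda>x. of_real (q x)) x"
          unfolding jet_def
          using iter_deriv_diff[OF U x smooth_on_linear_comp[OF bounded_linear_of_real \<theta>(1)]
              smooth_on_linear_comp[OF bounded_linear_of_real q] U0, of n] by (simp add: diff_divide_distrib)
        moreover have "q x = metr M p ?X ?X" by (simp add: q_def metr_coef_def cp0)
        ultimately show ?thesis unfolding j1 j2 by (simp add: q_def)
      qed
      ultimately show "weights_le ?E ?I (int n - 4)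
          (jet n (\<lambda>x. complex_of_real (\<theta> (cpoint e x)) - complex_of_real (metr_coef M e 0 x x)))"
        by (rule weights_le_cong[THEN iffD1, rotated])
    qed
  qed
qed

end

section \<open>Complex submanifolds\<close>

locale kaehler_submanifold =
  fixes M :: "('m, 'e::euclidean_space) hermitian_structure" and N :: "('m, 'e) smooth_structure"
  assumes K: "kaehler_manifold M" and CS: "complex_submanifold N M"
begin

lemmas M_smooth = kaehler_smooth_manifold[OF K]

lemma N_smooth: "smooth_manifold N" and N_sub: "topspace (mtop N) \<subseteq> topspace (mtop M)"
  and N_cont: "continuous_map (mtop N) (mtop M) (\<lambda>q. q)"
  using CS by (auto simp: complex_submanifold_def submanifold_def)

lemma N_in_topspace: "d \<in> charts_at N q \<Longrightarrow> q \<in> topspace (mtop N)"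
  using openin_subset[OF chart_openin[OF N_smooth]] charts_atD[OF N_smooth] by blast

text \<open>The topology of N may be finer than the subspace topology; the continuity of the
  inclusion supplies exactly the openness needed.\<close>

lemma N_openin: "openin (mtop M) V \<Longrightarrow> openin (mtop N) {q \<in> topspace (mtop N). q \<in> V}"
  using openin_continuous_map_preimage[OF N_cont] by simp

lemma N_chart_inter_open:
  assumes d: "d \<in> charts N" and V: "openin (mtop M) V"
  shows "rel_open (model N) (snd d ` (fst d \<inter> V))"
proof -
  have "fst d \<inter> V = fst d \<inter> {q \<in> topspace (mtop N). q \<in> V}"
    using openin_subset[OF chart_openin[OF N_smooth d]] by auto
  then show ?thesis using chart_image_open[OF N_smooth d N_openin[OF V]] by simp
qed

lemma inclusion_smooth:
  "d \<in> charts N \<Longrightarrow> c \<in> charts M \<Longrightarrow> smooth_on (model N) (snd d ` (fst d \<inter> fst c)) (\<lambda>y. snd c (cpoint d y))"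
  using CS by (simp add: complex_submanifold_def submanifold_def)

lemma inclusion_at:
  assumes "d \<in> charts_at N q" "c \<in> charts_at M q"
  shows "rel_open (model N) (snd d ` (fst d \<inter> fst c))" "snd d q \<in> snd d ` (fst d \<inter> fst c)"
    "(\<lambda>y. snd c (cpoint d y)) differentiable (at (snd d q) within snd d ` (fst d \<inter> fst c))"
    "(\<lambda>y. snd c (cpoint d y)) ` (snd d ` (fst d \<inter> fst c)) \<subseteq> snd c ` fst c"
proof -
  note c = charts_atD[OF N_smooth assms(1)] charts_atD[OF M_smooth assms(2)]
  show U: "rel_open (model N) (snd d ` (fst d \<inter> fst c))"
    by (rule N_chart_inter_open[OF c(1) chart_openin[OF M_smooth c(3)]])
  show q: "snd d q \<in> snd d ` (fst d \<inter> fst c)" using c by auto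
  show "(\<lambda>y. snd c (cpoint d y)) differentiable (at (snd d q) within snd d ` (fst d \<inter> fst c))"
    by (rule smooth_on_differentiable[OF U inclusion_smooth[OF c(1,3)] q])
  show "(\<lambda>y. snd c (cpoint d y)) ` (snd d ` (fst d \<inter> fst c)) \<subseteq> snd c ` fst c"
    using cpoint_chart[OF N_smooth c(1)] by auto
qed

lemma inclusion_in_model:
  assumes "d \<in> charts_at N q" "c \<in> charts_at M q" "u \<in> model N"
  shows "dir_deriv (\<lambda>y. snd c (cpoint d y)) u (snd d q) \<in> model M"
  using inclusion_at[OF assms(1,2)] rel_open_subset[OF chart_rel_open[OF M_smooth charts_atD(1)[OF M_smooth assms(2)]]]
  by (intro dir_deriv_in[OF _ _ assms(3) _ model_subspace[OF M_smooth]]) auto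

text \<open>Independence of the chart of N, by the chain rule. It makes the arbitrary choice in
  \<open>incl_differential\<close> irrelevant.\<close>

lemma inclusion_change_chart:
  assumes d: "d \<in> charts_at N q" and d': "d' \<in> charts_at N q" and c: "c \<in> charts_at M q" and X: "X \<in> tangent_space N q"
  shows "dir_deriv (\<lambda>y. snd c (cpoint d' y)) (X d') (snd d' q) = dir_deriv (\<lambda>y. snd c (cpoint d y)) (X d) (snd d q)"
proof -
  note C = charts_atD[OF N_smooth d] charts_atD[OF N_smooth d'] charts_atD[OF M_smooth c]
  define D where "D = snd d ` (fst d \<inter> (fst d' \<inter> {r \<in> topspace (mtop N). r \<in> fst c}))"
  have D: "rel_open (model N) D" unfolding D_def
    by (intro chart_image_open[OF N_smooth C(1)] openin_Int chart_openin[OF N_smooth C(3)] N_openin chart_openin[OF M_smooth C(5)])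
  have q: "snd d q \<in> D" using C N_in_topspace[OF d] by (auto simp: D_def)
  have cp: "cpoint d (snd d r) = r" if "r \<in> fst d" for r by (rule cpoint_chart[OF N_smooth C(1) that])
  have sub: "(\<lambda>y. snd d' (cpoint d y)) ` D \<subseteq> snd d' ` (fst d' \<inter> fst c)"
    using cp by (auto simp: D_def)
  have dq: "snd d' (cpoint d (snd d q)) = snd d' q" using cp C by simp
  have "dir_deriv (\<lambda>y. snd c (cpoint d y)) (X d) (snd d q)
      = dir_deriv (\<lambda>y. snd c (cpoint d' (snd d' (cpoint d y)))) (X d) (snd d q)"
    by (rule dir_deriv_cong[OF D q tangentD(1)[OF N_smooth X d]]) (auto simp: D_def cp cpoint_chart[OF N_smooth C(3)])
  also have "\<dots> = dir_deriv (\<lambda>y. snd c (cpoint d' y)) (dir_deriv (\<lambda>y. snd d' (cpoint d y)) (X d) (snd d q)) (snd d' (cpoint d (snd d q)))"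
  proof (rule dir_deriv_chain[OF D inclusion_at(1)[OF d' c] q tangentD(1)[OF N_smooth X d] sub])
    show "(\<lambda>y. snd d' (cpoint d y)) differentiable (at (snd d q) within D)"
      by (rule smooth_on_differentiable[OF D smooth_on_subset[OF transition_smooth[OF N_smooth C(1,3)]] q]) (auto simp: D_def)
    show "(\<lambda>y. snd c (cpoint d' y)) differentiable (at (snd d' (cpoint d (snd d q))) within snd d' ` (fst d' \<inter> fst c))"
      unfolding dq by (rule inclusion_at(3)[OF d' c])
  qed
  also have "dir_deriv (\<lambda>y. snd d' (cpoint d y)) (X d) (snd d q) = X d'"
    using cvec_component[OF N_smooth d d', of "X d"] tangentD(2)[OF N_smooth X d] by simp
  finally show ?thesis unfolding dq by simp
qed

lemma incl_differential_eq:
  assumes X: "X \<in> tangent_space N q" and d: "d \<in> charts_at N q" and c: "c \<in> charts_at M q"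
  shows "incl_differential N M q X = cvec M c q (dir_deriv (\<lambda>y. snd c (cpoint d y)) (X d) (snd d q))"
proof
  define d0 where "d0 = (SOME d. d \<in> charts_at N q)"
  have d0: "d0 \<in> charts_at N q" unfolding d0_def using d by (rule someI)
  let ?u = "dir_deriv (\<lambda>y. snd c (cpoint d y)) (X d) (snd d q)"
  note Xd = tangentD(1)[OF N_smooth X d]
  have l0: "chart_line d0 q (X d0) 0 = q" by (rule chart_line_0[OF N_smooth d0])
  fix e
  show "incl_differential N M q X e = cvec M c q ?u e"
  proof (cases "e \<in> charts_at M q")
    case False
    then show ?thesis
      using l0 cvec_outside[OF M_smooth c False] by (simp add: incl_differential_def Let_def d0_def[symmetric] velocity_def)
  next
    case e: True
    have "incl_differential N M q X e = dir_deriv (\<lambda>y. snd e (cpoint d0 y)) (X d0) (snd d0 q)"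
      using l0 e by (simp add: incl_differential_def Let_def d0_def[symmetric] velocity_def dir_deriv_def chart_line_def)
    also have "\<dots> = dir_deriv (\<lambda>y. snd e (cpoint d y)) (X d) (snd d q)"
      by (rule inclusion_change_chart[OF d d0 e X])
    also have "\<dots> = dir_deriv (\<lambda>x. snd e (cpoint c x)) ?u (snd c q)"
    proof -
      note C = charts_atD[OF N_smooth d] charts_atD[OF M_smooth c] charts_atD[OF M_smooth e]
      let ?D = "snd d ` (fst d \<inter> (fst c \<inter> fst e))"
      have D: "rel_open (model N) ?D"
        by (intro N_chart_inter_open[OF C(1)] openin_Int chart_openin[OF M_smooth] C)
      have q: "snd d q \<in> ?D" using C by auto
      have cp: "cpoint d (snd d r) = r" if "r \<in> fst d" for r by (rule cpoint_chart[OF N_smooth C(1) that])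
      have cq: "snd c (cpoint d (snd d q)) = snd c q" using cp C by simp
      have "dir_deriv (\<lambda>y. snd e (cpoint d y)) (X d) (snd d q)
          = dir_deriv (\<lambda>y. snd e (cpoint c (snd c (cpoint d y)))) (X d) (snd d q)"
        by (rule dir_deriv_cong[OF D q Xd]) (auto simp: cp cpoint_chart[OF M_smooth C(3)])
      also have "\<dots> = dir_deriv (\<lambda>x. snd e (cpoint c x)) ?u (snd c (cpoint d (snd d q)))"
      proof (rule dir_deriv_chain[OF D transition_at(1)[OF M_smooth c e] q Xd])
        show "(\<lambda>y. snd c (cpoint d y)) ` ?D \<subseteq> snd c ` (fst c \<inter> fst e)" using cp by auto
        show "(\<lambda>y. snd c (cpoint d y)) differentiable (at (snd d q) within ?D)"
          by (rule smooth_on_differentiable[OF D smooth_on_subset[OF inclusion_smooth[OF C(1,3)]] q]) auto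
        show "(\<lambda>x. snd e (cpoint c x)) differentiable (at (snd c (cpoint d (snd d q))) within snd c ` (fst c \<inter> fst e))"
          unfolding cq by (rule transition_at(3)[OF M_smooth c e])
      qed
      finally show ?thesis unfolding cq .
    qed
    finally show ?thesis using cvec_component[OF M_smooth c e] by simp
  qed
qed

lemma charts_at_M_obtain:
  assumes "d \<in> charts_at N q" obtains c where "c \<in> charts_at M q"
  using charts_at_obtain[OF M_smooth] N_in_topspace[OF assms] N_sub by blast

lemma incl_tangent:
  assumes "X \<in> tangent_space N q" "d \<in> charts_at N q"
  shows "incl_differential N M q X \<in> tangent_space M q"
proof -
  obtain c where c: "c \<in> charts_at M q" by (rule charts_at_M_obtain[OF assms(2)])
  show ?thesis unfolding incl_differential_eq[OF assms c]
    by (intro cvec_tangent[OF M_smooth c] inclusion_in_model[OF assms(2) c] tangentD(1)[OF N_smooth assms])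
qed

lemma incl_linear:
  assumes X: "X \<in> tangent_space N q" and Y: "Y \<in> tangent_space N q" and d: "d \<in> charts_at N q"
  shows "incl_differential N M q (tadd X Y) = tadd (incl_differential N M q X) (incl_differential N M q Y)"
    "incl_differential N M q (tscale a X) = tscale a (incl_differential N M q X)"
proof -
  obtain c where c: "c \<in> charts_at M q" by (rule charts_at_M_obtain[OF d])
  note t = tangent_add_scale[OF N_smooth N_in_topspace[OF d] X Y]
  note i = inclusion_at[OF d c] and m = tangentD(1)[OF N_smooth X d] tangentD(1)[OF N_smooth Y d]
  note l = dir_deriv_linear[OF i(1-3) m]
  have c1: "tadd X Y d = X d + Y d" "tscale a X d = a *\<^sub>R X d" by (simp_all add: tadd_def tscale_def)
  note mm = inclusion_in_model[OF d c m(1)] inclusion_in_model[OF d c m(2)]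
  show "incl_differential N M q (tadd X Y) = tadd (incl_differential N M q X) (incl_differential N M q Y)"
    unfolding incl_differential_eq[OF t(1) d c] incl_differential_eq[OF X d c] incl_differential_eq[OF Y d c] c1 l(1)
    by (rule cvec_linear(1)[OF M_smooth c mm])
  show "incl_differential N M q (tscale a X) = tscale a (incl_differential N M q X)"
    unfolding incl_differential_eq[OF t(2) d c] incl_differential_eq[OF X d c] c1 l(2)
    by (rule cvec_linear(2)[OF M_smooth c mm])
qed

lemma incl_inj: "q \<in> topspace (mtop N) \<Longrightarrow> inj_on (incl_differential N M q) (tangent_space N q)"
  using CS by (simp add: complex_submanifold_def submanifold_def)

lemma incl_complex:
  "q \<in> topspace (mtop N) \<Longrightarrow> X \<in> tangent_space N q \<Longrightarrow>
    acs M q (incl_differential N M q X) \<in> incl_differential N M q ` tangent_space N q"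
  using CS by (simp add: complex_submanifold_def)

section \<open>The inclusion in a pair of charts\<close>

context
  fixes c d :: "('m, 'e) chart"
  assumes c: "c \<in> charts M" and d: "d \<in> charts N"
begin

lemma inclusion_point:
  assumes y: "y \<in> snd d ` (fst d \<inter> fst c)"
  shows "d \<in> charts_at N (cpoint d y)" "c \<in> charts_at M (cpoint d y)" "snd d (cpoint d y) = y"
    "cpoint c (snd c (cpoint d y)) = cpoint d y" "snd c (cpoint d y) \<in> snd c ` fst c"
  using cpoint_in[OF N_smooth d y] c d cpoint_chart[OF M_smooth c] by (auto simp: charts_at_def)

lemma incl_cvec:
  assumes y: "y \<in> snd d ` (fst d \<inter> fst c)" and w: "w \<in> model N"
  shows "incl_differential N M (cpoint d y) (cvec N d (cpoint d y) w)
    = cvec M c (cpoint d y) (dir_deriv (\<lambda>y. snd c (cpoint d y)) w y)"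
  using incl_differential_eq[OF cvec_tangent[OF N_smooth inclusion_point(1)[OF y] w] inclusion_point(1,2)[OF y]]
    cvec_self[OF N_smooth inclusion_point(1)[OF y] w] inclusion_point(3)[OF y] by simp

lemma inclusion_immersion:
  assumes y: "y \<in> snd d ` (fst d \<inter> fst c)" and w: "w \<in> model N" and 0: "dir_deriv (\<lambda>y. snd c (cpoint d y)) w y = 0"
  shows "w = 0"
proof -
  note P = inclusion_point[OF y]
  have z: "0 \<in> model N" using model_subspace[OF N_smooth] by (rule subspace_0)
  have "dir_deriv (\<lambda>y. snd c (cpoint d y)) 0 y = 0" by (simp add: dir_deriv_def)
  then have "incl_differential N M (cpoint d y) (cvec N d (cpoint d y) w) = incl_differential N M (cpoint d y) (cvec N d (cpoint d y) 0)"
    unfolding incl_cvec[OF y w] incl_cvec[OF y z] 0 by simp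
  then have "cvec N d (cpoint d y) w = cvec N d (cpoint d y) 0"
    using incl_inj[OF N_in_topspace[OF P(1)]] cvec_tangent[OF N_smooth P(1)] w z by (auto simp: inj_on_def)
  then show ?thesis using cvec_self[OF N_smooth P(1)] w z by metis
qed

lemma inclusion_model:
  assumes y: "y \<in> snd d ` (fst d \<inter> fst c)" and w: "w \<in> model N"
  shows "dir_deriv (\<lambda>y. snd c (cpoint d y)) w y \<in> model M"
  using inclusion_in_model[OF inclusion_point(1,2)[OF y] w] inclusion_point(3)[OF y] by simp

lemma inclusion_complex:
  assumes y: "y \<in> snd d ` (fst d \<inter> fst c)" and w: "w \<in> model N"
  obtains w' where "w' \<in> model N" "dir_deriv (\<lambda>y. snd c (cpoint d y)) w' y
    = acs_coef M c (snd c (cpoint d y)) (dir_deriv (\<lambda>y. snd c (cpoint d y)) w y)"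
proof -
  note P = inclusion_point[OF y]
  let ?q = "cpoint d y" and ?f = "\<lambda>y. snd c (cpoint d y)"
  obtain Y where Y: "Y \<in> tangent_space N ?q" "incl_differential N M ?q Y = acs M ?q (incl_differential N M ?q (cvec N d ?q w))"
    using incl_complex[OF N_in_topspace[OF P(1)] cvec_tangent[OF N_smooth P(1) w]] by force
  note A = acs_cvec[OF K P(2) inclusion_model[OF y w]]
  have Yd: "Y d \<in> model N" using tangentD(1)[OF N_smooth Y(1) P(1)] .
  have "cvec M c ?q (dir_deriv ?f (Y d) y) = cvec M c ?q (acs_coef M c (?f y) (dir_deriv ?f w y))"
    using Y(2) unfolding incl_cvec[OF y w] A(2) incl_differential_eq[OF Y(1) P(1,2)] P(3) .
  then have "dir_deriv ?f (Y d) y = acs_coef M c (?f y) (dir_deriv ?f w y)"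
    using cvec_self[OF M_smooth P(2)] inclusion_model[OF y Yd] A(1) by metis
  then show ?thesis using that[OF Yd] by blast
qed

end

section \<open>The induced structure on the submanifold\<close>

abbreviation Ni :: "('m, 'e) hermitian_structure" where "Ni \<equiv> induced_structure N M"

lemma induced_simps [simp]: "mtop Ni = mtop N" "model Ni = model N" "charts Ni = charts N"
  "charts_at Ni q = charts_at N q" "velocity Ni \<gamma> = velocity N \<gamma>" "cvec Ni c q u = cvec N c q u"
  "tangent_space Ni q = tangent_space N q"
  "metr Ni q X Y = metr M q (incl_differential N M q X) (incl_differential N M q Y)"
proof -
  show 1: "mtop Ni = mtop N" "model Ni = model N" "charts Ni = charts N"
    "metr Ni q X Y = metr M q (incl_differential N M q X) (incl_differential N M q Y)"
    by (simp_all add: induced_structure_def)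
  show 2: "charts_at Ni q = charts_at N q" for q by (simp add: charts_at_def 1)
  show 3: "velocity Ni \<gamma> = velocity N \<gamma>" for \<gamma> by (simp add: velocity_def 2)
  show 4: "cvec Ni c q u = cvec N c q u" for c q u by (simp add: cvec_def 3)
  show "tangent_space Ni q = tangent_space N q" by (simp add: tangent_space_def 1 2 4)
qed

lemma induced_anchored: "anchored_coordinates Ni p W k = anchored_coordinates N p W k"
  by (simp add: anchored_coordinates_def)

text \<open>The definite description in \<open>induced_structure\<close> is meaningful because the
  differential of the inclusion is injective and its image is invariant under the structure of
  M.\<close>

lemma induced_acs:
  assumes q: "q \<in> topspace (mtop N)" and X: "X \<in> tangent_space N q"
  shows "acs Ni q X \<in> tangent_space N q" "incl_differential N M q (acs Ni q X) = acs M q (incl_differential N M q X)"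
    "Y \<in> tangent_space N q \<Longrightarrow> incl_differential N M q Y = acs M q (incl_differential N M q X) \<Longrightarrow> acs Ni q X = Y"
proof -
  have "\<exists>!Y. Y \<in> tangent_space N q \<and> incl_differential N M q Y = acs M q (incl_differential N M q X)"
    using incl_complex[OF q X] incl_inj[OF q] unfolding inj_on_def by (metis (no_types, lifting) imageE)
  from theI'[OF this] have t: "acs Ni q X \<in> tangent_space N q \<and> incl_differential N M q (acs Ni q X) = acs M q (incl_differential N M q X)"
    by (simp add: induced_structure_def)
  then show "acs Ni q X \<in> tangent_space N q" "incl_differential N M q (acs Ni q X) = acs M q (incl_differential N M q X)" by auto
  show "acs Ni q X = Y" if "Y \<in> tangent_space N q" "incl_differential N M q Y = acs M q (incl_differential N M q X)"
    using t that incl_inj[OF q] by (simp add: inj_on_def)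
qed

lemma induced_metr_coef:
  assumes c: "c \<in> charts M" and d: "d \<in> charts N" and y: "y \<in> snd d ` (fst d \<inter> fst c)" and uw: "u \<in> model N" "w \<in> model N"
  shows "metr_coef Ni d y u w = metr_coef M c (snd c (cpoint d y))
    (dir_deriv (\<lambda>y. snd c (cpoint d y)) u y) (dir_deriv (\<lambda>y. snd c (cpoint d y)) w y)"
  using incl_cvec[OF c d y uw(1)] incl_cvec[OF c d y uw(2)] inclusion_point(4)[OF c d y] by (simp add: metr_coef_def)

lemma induced_acs_coef:
  assumes c: "c \<in> charts M" and d: "d \<in> charts N" and y: "y \<in> snd d ` (fst d \<inter> fst c)" and w: "w \<in> model N"
  shows "acs_coef Ni d y w \<in> model N"
    "dir_deriv (\<lambda>y. snd c (cpoint d y)) (acs_coef Ni d y w) y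
      = acs_coef M c (snd c (cpoint d y)) (dir_deriv (\<lambda>y. snd c (cpoint d y)) w y)"
    "acs Ni (cpoint d y) (cvec N d (cpoint d y) w) = cvec N d (cpoint d y) (acs_coef Ni d y w)"
proof -
  note P = inclusion_point[OF c d y]
  let ?q = "cpoint d y" and ?f = "\<lambda>y. snd c (cpoint d y)"
  have t: "cvec N d ?q w \<in> tangent_space N ?q" by (rule cvec_tangent[OF N_smooth P(1) w])
  note A = induced_acs[OF N_in_topspace[OF P(1)] t]
  have eq: "acs_coef Ni d y w = acs Ni ?q (cvec N d ?q w) d" by (simp add: acs_coef_def)
  show m: "acs_coef Ni d y w \<in> model N" unfolding eq by (rule tangentD(1)[OF N_smooth A(1) P(1)])
  show e: "acs Ni ?q (cvec N d ?q w) = cvec N d ?q (acs_coef Ni d y w)"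
    unfolding eq by (rule tangentD(2)[OF N_smooth A(1) P(1), symmetric])
  note B = acs_cvec[OF K P(2) inclusion_model[OF c d y w]]
  have "cvec M c ?q (dir_deriv ?f (acs_coef Ni d y w) y) = cvec M c ?q (acs_coef M c (?f y) (dir_deriv ?f w y))"
    using A(2) unfolding e incl_cvec[OF c d y m] incl_cvec[OF c d y w] B(2) .
  then show "dir_deriv ?f (acs_coef Ni d y w) y = acs_coef M c (?f y) (dir_deriv ?f w y)"
    using cvec_self[OF M_smooth P(2)] inclusion_model[OF c d y m] B(1) by metis
qed

text \<open>The inclusion is holomorphic, so \<partial> dbar commutes with pulling back. In an
  arbitrary chart of N and in the chart \<open>e\<close> of M, both sides reduce to the same
  expression in \<open>cdd\<close>.\<close>

lemma induced_potential:
  assumes e: "e \<in> charts M" and const: "\<And>x u. x \<in> snd e ` fst e \<Longrightarrow> u \<in> model M \<Longrightarrow> acs_coef M e x u = I u"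
    and cs: "complex_structure_on (model M) I" and pot: "local_potential M V \<theta>"
  shows "local_potential Ni {q \<in> topspace (mtop N). q \<in> V \<inter> fst e} \<theta>"
  unfolding local_potential_def
proof (intro conjI ballI)
  have V: "openin (mtop M) V" using pot by (simp add: local_potential_def)
  have Ve: "openin (mtop M) (V \<inter> fst e)" by (intro openin_Int V chart_openin[OF M_smooth e])
  let ?V = "{q \<in> topspace (mtop N). q \<in> V \<inter> fst e}"
  show "openin (mtop Ni) ?V" using N_openin[OF Ve] by simp
  fix c assume "c \<in> charts Ni"
  then have c: "c \<in> charts N" by simp
  let ?D = "snd c ` (fst c \<inter> ?V)" and ?U = "snd e ` (fst e \<inter> V)" and ?f = "\<lambda>y. snd e (cpoint c y)"
  have D: "rel_open (model N) ?D" by (rule chart_image_open[OF N_smooth c N_openin[OF Ve]])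
  have U: "rel_open (model M) ?U" by (rule chart_image_open[OF M_smooth e V])
  have sub: "?D \<subseteq> snd c ` (fst c \<inter> fst e)" by auto
  have f: "smooth_on (model N) ?D ?f" by (rule smooth_on_subset[OF inclusion_smooth[OF c e] sub])
  have fU: "?f ` ?D \<subseteq> ?U" using cpoint_chart[OF N_smooth c] by auto
  have cp: "cpoint e (?f y) = cpoint c y" if "y \<in> ?D" for y
    by (rule inclusion_point(4)[OF e c]) (use that sub in blast)
  have \<theta>: "smooth_on (model M) ?U (\<lambda>x. \<theta> (cpoint e x))"
    "\<And>x u w. x \<in> ?U \<Longrightarrow> u \<in> model M \<Longrightarrow> w \<in> model M \<Longrightarrow> complex_of_real (metr_coef M e x (acs_coef M e x u) w)
      = \<i> / 2 * del_dbar M e (\<lambda>x. \<theta> (cpoint e x)) x u w"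
    using pot e by (auto simp: local_potential_def)
  have "smooth_on (model N) ?D (\<lambda>y. \<theta> (cpoint e (?f y)))"
    by (rule smooth_on_compose[OF D U fU f \<theta>(1)])
  then show "smooth_on (model Ni) ?D (\<lambda>x. \<theta> (cpoint c x))"
    unfolding induced_simps by (rule smooth_on_cong[THEN iffD1, rotated]) (simp only: cp)
  fix y u w assume y: "y \<in> ?D" and "u \<in> model Ni" "w \<in> model Ni"
  then have uw: "u \<in> model N" "w \<in> model N" by simp_all
  have fy: "?f y \<in> ?U" "?f y \<in> snd e ` fst e" using fU y by blast+
  have ysub: "y \<in> snd c ` (fst c \<inter> fst e)" if "y \<in> ?D" for y using sub that by blast
  note J = induced_acs_coef[OF e c ysub]
  have J2: "dir_deriv ?f (acs_coef Ni c y w) y = I (dir_deriv ?f w y)" if "y \<in> ?D" "w \<in> model N" for y w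
    using J(2)[OF that] const[OF _ inclusion_model[OF e c ysub[OF that(1)] that(2)]] fU that(1) by auto
  note a = inclusion_model[OF e c ysub[OF y] uw(1)] and b = inclusion_model[OF e c ysub[OF y] uw(2)]
  have "del_dbar Ni c (\<lambda>x. \<theta> (cpoint c x)) y u w = del_dbar M e (\<lambda>x. \<theta> (cpoint e x)) (?f y) (dir_deriv ?f u y) (dir_deriv ?f w y)"
  proof -
    have "dbar Ni c (\<lambda>x. \<theta> (cpoint c x)) y w = dbar Ni c (\<lambda>y. \<theta> (cpoint e (?f y))) y w"
      if "y \<in> ?D" "w \<in> model N" for y w
      using dir_deriv_cong[OF D that(1), of _ "\<lambda>x. \<theta> (cpoint c x)" "\<lambda>y. \<theta> (cpoint e (?f y))"] cp that(2) J(1)[OF that]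
      by (simp add: dbar_def)
    then have "d_one_form (dbar Ni c (\<lambda>x. \<theta> (cpoint c x))) y u w = d_one_form (dbar Ni c (\<lambda>y. \<theta> (cpoint e (?f y)))) y u w"
      if "u \<in> model N" "w \<in> model N" for u w
      unfolding d_one_form_def using that
      by (intro arg_cong2[where f = "(-)"] dir_deriv_cong[OF D y]) auto
    then have "del_dbar Ni c (\<lambda>x. \<theta> (cpoint c x)) y u w = del_dbar Ni c (\<lambda>y. \<theta> (cpoint e (?f y))) y u w"
      unfolding del_dbar_def using uw J(1)[OF y] by simp
    also have "\<dots> = del_dbar M e (\<lambda>x. \<theta> (cpoint e x)) (?f y) (dir_deriv ?f u y) (dir_deriv ?f w y)"
    proof (rule trans)
      let ?\<Theta> = "\<lambda>x. complex_of_real (\<theta> (cpoint e x))"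
      show "del_dbar Ni c (\<lambda>y. \<theta> (cpoint e (?f y))) y u w =
          cdd (-\<i>) I (dir_deriv ?f u y) (cdd \<i> I (dir_deriv ?f w y) ?\<Theta>) (?f y)
          - cdd (-\<i>) I (dir_deriv ?f w y) (cdd \<i> I (dir_deriv ?f u y) ?\<Theta>) (?f y)"
        using J(1) J2 by (intro del_dbar_pullback[OF D U f fU \<theta>(1) _ _ cs y uw]) simp_all
      show "\<dots> = del_dbar M e (\<lambda>x. \<theta> (cpoint e x)) (?f y) (dir_deriv ?f u y) (dir_deriv ?f w y)"
        by (rule del_dbar_constant[OF U \<theta>(1) cs _ fy(1) a b, symmetric]) (use const in auto)
    qed
    finally show ?thesis .
  qed
  moreover have "metr_coef Ni c y (acs_coef Ni c y u) w
      = metr_coef M e (?f y) (acs_coef M e (?f y) (dir_deriv ?f u y)) (dir_deriv ?f w y)"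
    unfolding induced_metr_coef[OF e c ysub[OF y] J(1)[OF y uw(1)] uw(2)] J(2)[OF y uw(1)] ..
  ultimately show "complex_of_real (metr_coef Ni c y (acs_coef Ni c y u) w)
      = \<i> / 2 * del_dbar Ni c (\<lambda>x. \<theta> (cpoint c x)) y u w"
    using \<theta>(2)[OF fy(1) a b] by simp
qed

text \<open>The differential of the inclusion is linear and commutes with the complex structures, so
  composing with it preserves bidegrees.\<close>

lemma induced_Sym_bi:
  assumes p: "p \<in> topspace (mtop N)" and \<zeta>: "\<zeta> \<in> Sym_bi M p a b"
  shows "(\<lambda>X. \<zeta> (incl_differential N M p X)) \<in> Sym_bi Ni p a b"
proof -
  obtain d where d: "d \<in> charts_at N p" by (rule charts_at_obtain[OF N_smooth p])
  obtain c where c: "c \<in> charts_at M p" by (rule charts_at_M_obtain[OF d])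
  note t = incl_tangent[OF _ d]
  have z: "homogeneous_poly M p (a + b) \<zeta>" "\<And>X. X \<in> tangent_space M p \<Longrightarrow>
      ((\<lambda>t. \<zeta> (tadd X (tscale t (acs M p X)))) has_vector_derivative \<i> * (of_nat a - of_nat b) * \<zeta> X) (at 0)"
    using \<zeta> by (auto simp: Sym_bi_def)
  obtain P where P: "polynomial_function P" "\<And>X. X \<in> tangent_space M p \<Longrightarrow> \<zeta> X = P (X c)"
    using z(1) c by (auto simp: homogeneous_poly_def)
  have "\<exists>Q. polynomial_function Q \<and> (\<forall>X\<in>tangent_space N p. \<zeta> (incl_differential N M p X) = Q (X d))"
    if d: "d \<in> charts_at N p" for d
  proof -
    let ?f = "\<lambda>y. snd c (cpoint d y)"
    note i = inclusion_at[OF d c]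
    obtain B where B: "finite B" "B \<subseteq> model N" "\<And>v. v \<in> model N \<Longrightarrow> (\<Sum>b\<in>B. (v \<bullet> b) *\<^sub>R b) = v"
      using subspace_onb[OF model_subspace[OF N_smooth]] by metis
    \<comment> \<open>The differential in coordinates, extended from the model of N to the whole
      type so that \<open>P \<circ> L\<close> is a polynomial function.\<close>
    define L where "L v = (\<Sum>b\<in>B. (v \<bullet> b) *\<^sub>R dir_deriv ?f b (snd d p))" for v
    have L_bl: "bounded_linear L" unfolding L_def
      by (intro bounded_linear_sum bounded_linear_compose[OF bounded_linear_scaleR_left] bounded_linear_inner_left)
    have L: "L v = dir_deriv ?f v (snd d p)" if v: "v \<in> model N" for v
    proof -
      have "dir_deriv ?f (\<Sum>b\<in>B. (v \<bullet> b) *\<^sub>R b) (snd d p) = L v"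
        unfolding L_def by (rule dir_deriv_sum[OF i(1-3) B(1)]) (use B(2) in auto)
      then show ?thesis using B(3)[OF v] by simp
    qed
    have "polynomial_function (P \<circ> L)"
      by (intro polynomial_function_compose polynomial_function_bounded_linear L_bl P(1))
    moreover have "\<zeta> (incl_differential N M p X) = (P \<circ> L) (X d)" if X: "X \<in> tangent_space N p" for X
    proof -
      have "incl_differential N M p X c = L (X d)"
        unfolding incl_differential_eq[OF X d c] L[OF tangentD(1)[OF N_smooth X d]]
        by (rule cvec_self[OF M_smooth c inclusion_in_model[OF d c tangentD(1)[OF N_smooth X d]]])
      then show ?thesis using P(2)[OF incl_tangent[OF X d]] by simp
    qed
    ultimately show ?thesis by blast
  qed
  moreover have "\<zeta> (incl_differential N M p (tscale s X)) = complex_of_real (s ^ (a + b)) * \<zeta> (incl_differential N M p X)"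
    if X: "X \<in> tangent_space N p" for X s
    using z(1) t[OF X] incl_linear(2)[OF X X d] by (simp add: homogeneous_poly_def)
  moreover have "((\<lambda>s. \<zeta> (incl_differential N M p (tadd X (tscale s (acs Ni p X))))) has_vector_derivative
      \<i> * (of_nat a - of_nat b) * \<zeta> (incl_differential N M p X)) (at 0)" if X: "X \<in> tangent_space N p" for X
  proof -
    note A = induced_acs[OF p X]
    have "incl_differential N M p (tadd X (tscale s (acs Ni p X)))
        = tadd (incl_differential N M p X) (tscale s (acs M p (incl_differential N M p X)))" for s
      using incl_linear(1)[OF X tangent_add_scale(2)[OF N_smooth p A(1) A(1)] d] incl_linear(2)[OF A(1) A(1) d] A(2) by simp
    then show ?thesis using z(2)[OF t[OF X]] by simp
  qed
  ultimately show ?thesis unfolding Sym_bi_def homogeneous_poly_def by simp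
qed

lemma induced_Sym_ge22:
  assumes p: "p \<in> topspace (mtop N)" and \<eta>: "\<eta> \<in> Sym_ge22 M p"
  shows "(\<lambda>n X. \<eta> n (incl_differential N M p X)) \<in> Sym_ge22 Ni p"
proof -
  obtain d where d: "d \<in> charts_at N p" by (rule charts_at_obtain[OF N_smooth p])
  obtain \<zeta> where \<zeta>: "\<And>a b. \<zeta> a b \<in> Sym_bi M p a b" "\<And>n X. X \<in> tangent_space M p \<Longrightarrow>
      complex_of_real (\<eta> n X) = (\<Sum>(a, b)\<in>{(a, b). a + b = n \<and> a \<ge> 2 \<and> b \<ge> 2}. \<zeta> a b X)"
    using \<eta> unfolding Sym_ge22_def by blast
  show ?thesis unfolding Sym_ge22_def mem_Collect_eq induced_simps
  proof (intro exI[of _ "\<lambda>a b X. \<zeta> a b (incl_differential N M p X)"] conjI allI ballI)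
    show "(\<lambda>X. \<zeta> a b (incl_differential N M p X)) \<in> Sym_bi Ni p a b" for a b
      by (rule induced_Sym_bi[OF p \<zeta>(1)])
    show "complex_of_real (\<eta> n (incl_differential N M p X))
      = (\<Sum>(a, b)\<in>{(a, b). a + b = n \<and> 2 \<le> a \<and> 2 \<le> b}. \<zeta> a b (incl_differential N M p X))"
      if "X \<in> tangent_space N p" for n X by (rule \<zeta>(2)[OF incl_tangent[OF that d]])
  qed
qed

end

section \<open>Restriction of the normal coordinates\<close>

context kaehler_submanifold
begin

text \<open>Near \<open>p\<close> the submanifold is a graph over its tangent space: the adapted chart \<open>e\<close> is the
  composition of the normal chart \<open>m\<close> with (a linear isomorphism applied to) the orthogonal
  projection to the tangent space.\<close>

lemma adapted_chart:
  assumes m: "m \<in> charts_at M p" and m0: "snd m p = 0" and pN: "p \<in> topspace (mtop N)"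
    and V: "openin (mtop M) V" "p \<in> V"
  defines "I \<equiv> acs_coef M m 0" and "g \<equiv> metr_coef M m 0"
  obtains e B where "e \<in> charts_at N p" "snd e p = 0" "fst e \<subseteq> fst m \<inter> V" "convex (snd e ` fst e)"
    "bounded_linear B" "\<And>v. B v \<in> model N" "\<And>x. x \<in> snd e ` fst e \<Longrightarrow> B (snd m (cpoint e x)) = x"
    "\<And>a w. a \<in> model M \<Longrightarrow> B a = 0 \<Longrightarrow> w \<in> model N \<Longrightarrow> g a (dir_deriv (\<lambda>x. snd m (cpoint e x)) w 0) = 0"
    "\<And>a. a \<in> model M \<Longrightarrow> B a = 0 \<Longrightarrow> B (I a) = 0"
proof -
  note cm = charts_atD[OF M_smooth m]
  interpret g: metric_chart "model M" "snd m ` fst m" "metr_coef M m" by (rule kaehler_metric_chart[OF K cm(1)])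
  have z: "0 \<in> snd m ` fst m" using m0 cm(2) by force
  note EM = model_subspace[OF M_smooth] and EN = model_subspace[OF N_smooth]
  note I = complex_structure_onD[OF acs_coef_complex(1)[OF K cm(1) z] EM, folded I_def]
  obtain d where d: "d \<in> charts_at N p" by (rule charts_at_obtain[OF N_smooth pN])
  note cd = charts_atD[OF N_smooth d]
  define f where "f y = snd m (cpoint d y)" for y
  define y0 where "y0 = snd d p"
  define D where "D = snd d ` (fst d \<inter> (fst m \<inter> V))"
  have D: "rel_open (model N) D" unfolding D_def
    by (intro N_chart_inter_open[OF cd(1)] openin_Int chart_openin[OF M_smooth cm(1)] V(1))
  have y0: "y0 \<in> D" using cd cm V by (auto simp: D_def y0_def)
  have Dsub: "D \<subseteq> snd d ` (fst d \<inter> fst m)" by (auto simp: D_def)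
  have f: "smooth_on (model N) D f" unfolding f_def[abs_def]
    by (rule smooth_on_subset[OF inclusion_smooth[OF cd(1) cm(1)] Dsub])
  have cp: "cpoint d (snd d q) = q" if "q \<in> fst d" for q by (rule cpoint_chart[OF N_smooth cd(1) that])
  have f_in: "f ` D \<subseteq> model M" unfolding f_def D_def using cp snd_in_model[OF M_smooth cm(1)] by auto
  have f0: "f y0 = 0" using cp[OF cd(2)] m0 by (simp add: f_def y0_def)
  note Df = inclusion_model[OF cm(1) cd(1) subsetD[OF Dsub], folded f_def[abs_def]]
  define A where "A w = dir_deriv f w y0" for w
  have A_in: "A w \<in> model M" if "w \<in> model N" for w unfolding A_def by (rule Df[OF y0 that])
  have A_inj: "w = 0" if "w \<in> model N" "A w = 0" for w
    using inclusion_immersion[OF cm(1) cd(1) subsetD[OF Dsub y0], folded f_def[abs_def]] that by (simp add: A_def)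
  have A_I: "\<exists>w'\<in>model N. A w' = I (A w)" if w: "w \<in> model N" for w
  proof (rule inclusion_complex[OF cm(1) cd(1) subsetD[OF Dsub y0] w, folded f_def])
    fix w' assume "w' \<in> model N" "dir_deriv f w' y0 = acs_coef M m (f y0) (dir_deriv f w y0)"
    then show ?thesis unfolding A_def I_def f0 by blast
  qed
  obtain BN where BN: "finite BN" "BN \<subseteq> model N" "\<And>a b. a \<in> BN \<Longrightarrow> b \<in> BN \<Longrightarrow> a \<bullet> b = (if a = b then 1 else 0)"
    "\<And>v. v \<in> model N \<Longrightarrow> (\<Sum>b\<in>BN. (v \<bullet> b) *\<^sub>R b) = v" using subspace_onb[OF EN] by metis
  obtain BM where BM: "finite BM" "BM \<subseteq> model M" "\<And>v. v \<in> model M \<Longrightarrow> (\<Sum>b\<in>BM. (v \<bullet> b) *\<^sub>R b) = v"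
    using subspace_onb[OF EM] by metis
  have BNE: "b \<in> model N" if "b \<in> BN" for b using that BN(2) by blast
  have BME: "b \<in> model M" if "b \<in> BM" for b using that BM(2) by blast
  \<comment> \<open>The adjoint of \<open>A\<close> with respect to the metric at p: B v \<bullet> w
    = g v (A w). Its kernel on the model of M is the orthogonal complement of the tangent space of
    N.\<close>
  define B where "B v = (\<Sum>b\<in>BN. (\<Sum>i\<in>BM. (v \<bullet> i) * g i (A b)) *\<^sub>R b)" for v
  have B_bl: "bounded_linear B" unfolding B_def
    by (intro bounded_linear_sum bounded_linear_compose[OF bounded_linear_scaleR_left]
        bounded_linear_compose[OF bounded_linear_mult_left] bounded_linear_inner_left)
  have B_in: "B v \<in> model N" for v unfolding B_def using BNE by (intro subspace_sum subspace_mul EN) auto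
  have B_inner: "B v \<bullet> w = g v (A w)" if v: "v \<in> model M" and w: "w \<in> model N" for v w
  proof -
    have Bb: "(\<Sum>i\<in>BM. (v \<bullet> i) * g i (A b)) = g v (A b)" if "b \<in> BN" for b
      unfolding g_def using g.g_sum(1)[OF z BM(1) BME A_in[OF BNE[OF that]], where a = "\<lambda>i. v \<bullet> i" and v = "\<lambda>i. i"] BM(3)[OF v] by simp
    have "A w = dir_deriv f (\<Sum>b\<in>BN. (w \<bullet> b) *\<^sub>R b) y0" using BN(4)[OF w] by (simp add: A_def)
    also have "\<dots> = (\<Sum>b\<in>BN. (w \<bullet> b) *\<^sub>R A b)" unfolding A_def
      by (rule dir_deriv_sum[OF D y0 smooth_on_differentiable[OF D f y0] BN(1) BNE])
    finally have "g v (A w) = (\<Sum>b\<in>BN. (w \<bullet> b) * g v (A b))"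
      unfolding g_def using g.g_sum(2)[OF z BN(1) A_in[OF BNE] v, where a = "\<lambda>b. w \<bullet> b"] by simp
    moreover have "B v \<bullet> w = (\<Sum>b\<in>BN. g v (A b) * (b \<bullet> w))"
      unfolding B_def inner_sum_left inner_scaleR_left by (rule sum.cong[OF refl]) (simp add: Bb)
    ultimately show ?thesis by (simp add: inner_commute mult.commute)
  qed
  have B_zero: "g a (A w) = 0" if "a \<in> model M" "B a = 0" "w \<in> model N" for a w
    using B_inner[OF that(1,3)] that(2) by simp
  \<comment> \<open>The tangent space of N is I-invariant and \<open>I\<close> is orthogonal, so the
    orthogonal complement is I-invariant too.\<close>
  have B_I: "B (I a) = 0" if a: "a \<in> model M" "B a = 0" for a
  proof -
    have Ia: "I a \<in> model M" using I(1)[OF a(1)] .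
    have "B (I a) \<bullet> w = 0" if w: "w \<in> model N" for w
    proof -
      obtain w' where w': "w' \<in> model N" "A w' = I (A w)" using A_I[OF w] by blast
      have "g (I a) (A w) = - g (I a) (I (I (A w)))"
        using I(2)[OF A_in[OF w]] g.g_simps(8)[OF z Ia A_in[OF w] A_in[OF w]] by (simp add: g_def)
      also have "\<dots> = - g a (I (A w))"
        using acs_coef_complex(2)[OF K cm(1) z a(1) I(1)[OF A_in[OF w]]] by (simp add: g_def I_def)
      also have "\<dots> = 0" using B_zero[OF a w'(1)] w'(2) by simp
      finally show ?thesis using B_inner[OF Ia w] by simp
    qed
    from this[OF B_in, of "I a"] show ?thesis by simp
  qed
  \<comment> \<open>The future chart map in the coordinates of \<open>d\<close>. Its differential at
    \<open>y0\<close> is the adjoint of \<open>A\<close> composed with \<open>A\<close>, which is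
    injective since \<open>A\<close> is.\<close>
  define \<tau> where "\<tau> y = B (f y)" for y
  have \<tau>: "smooth_on (model N) D \<tau>" unfolding \<tau>_def[abs_def] by (rule smooth_on_linear_comp[OF B_bl f])
  have \<tau>_in: "\<tau> ` D \<subseteq> model N" using B_in by (auto simp: \<tau>_def)
  have D\<tau>: "dir_deriv \<tau> w y0 = B (A w)" if "w \<in> model N" for w
    unfolding \<tau>_def[abs_def] A_def by (rule dir_deriv_linear_comp[OF B_bl D y0 that smooth_on_differentiable[OF D f y0]])
  have \<tau>_inj: "w = 0" if w: "w \<in> model N" "dir_deriv \<tau> w y0 = 0" for w
  proof -
    have "g (A w) (A w) = 0" using B_zero[OF A_in[OF w(1)] _ w(1)] D\<tau>[OF w(1)] w(2) by simp
    then have "A w = 0" using g.g_pos[OF z A_in[OF w(1)]] by (force simp: g_def)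
    then show ?thesis using A_inj[OF w(1)] by blast
  qed
  obtain D' gi where D': "rel_open (model N) D'" "D' \<subseteq> D" "y0 \<in> D'" "rel_open (model N) (\<tau> ` D')"
    "smooth_on (model N) (\<tau> ` D') gi" "\<And>y. y \<in> D' \<Longrightarrow> gi (\<tau> y) = y"
    using smooth_inverse_function[OF D \<tau> \<tau>_in y0 \<tau>_inj] by blast
  have \<tau>0: "\<tau> y0 = 0" using linear_0[OF bounded_linear.linear[OF B_bl]] f0 by (simp add: \<tau>_def)
  have "0 \<in> \<tau> ` D'" using D'(3) \<tau>0 by force
  moreover obtain T where T: "open T" "\<tau> ` D' = model N \<inter> T" using D'(4) by (auto simp: openin_open)
  ultimately obtain r where r: "r > 0" "ball 0 r \<subseteq> T" using open_contains_ball by blast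
  \<comment> \<open>A ball inside the image, because the identity theorem along complex lines needs
    a convex chart domain.\<close>
  define W where "W = model N \<inter> ball 0 r"
  have W: "rel_open (model N) W" "convex W" "W \<subseteq> \<tau> ` D'" "0 \<in> W"
    using EN r T subspace_0[OF EN] by (auto simp: W_def convex_Int subspace_imp_convex)
  define D2 where "D2 = D' \<inter> \<tau> -` W"
  have D2: "openin (top_of_set (model N)) D2"
  proof -
    have "openin (top_of_set D') D2" unfolding D2_def
      by (rule continuous_openin_preimage[OF continuous_on_subset[OF smooth_on_continuous[OF \<tau>] D'(2)], of "model N"])
        (use W(1) \<tau>_in D'(2) in auto)
    then show ?thesis using D'(1) openin_trans by blast
  qed
  define Q where "Q = {q \<in> fst d. snd d q \<in> D2}"
  define \<phi> where "\<phi> q = \<tau> (snd d q)" for q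
  have gi: "gi x \<in> D2" "\<tau> (gi x) = x" if "x \<in> W" for x
    using that W(3) D'(6) by (auto simp: D2_def)
  have D2D: "D2 \<subseteq> D" "D2 \<subseteq> D'" using D'(2) by (auto simp: D2_def)
  have D2_im: "D2 \<subseteq> snd d ` fst d" using D2D(1) by (auto simp: D_def)
  have cpQ: "cpoint d y \<in> Q" "snd d (cpoint d y) = y" if "y \<in> D2" for y
    using that D2_im cpoint_in[OF N_smooth cd(1), of y "fst d"] by (auto simp: Q_def)
  have Q: "openin (mtop N) Q" unfolding Q_def by (rule chart_preimage_open[OF N_smooth cd(1) D2])
  have Qd: "Q \<subseteq> fst d" by (auto simp: Q_def)
  have \<phi>Q: "\<phi> ` Q = W"
  proof
    show "\<phi> ` Q \<subseteq> W" by (auto simp: \<phi>_def Q_def D2_def)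
    show "W \<subseteq> \<phi> ` Q"
    proof
      fix x assume "x \<in> W"
      then show "x \<in> \<phi> ` Q" using gi[of x] cpQ[of "gi x"] by (intro image_eqI[of _ _ "cpoint d (gi x)"]) (auto simp: \<phi>_def)
    qed
  qed
  have \<phi>_inj: "inj_on \<phi> Q"
  proof (rule inj_onI)
    fix q q' assume q: "q \<in> Q" "q' \<in> Q" "\<phi> q = \<phi> q'"
    then have "gi (\<tau> (snd d q)) = gi (\<tau> (snd d q'))" by (simp add: \<phi>_def)
    moreover have "snd d q \<in> D'" "snd d q' \<in> D'" using q D2D(2) by (auto simp: Q_def)
    ultimately have "snd d q = snd d q'" using D'(6)[of "snd d q"] D'(6)[of "snd d q'"] by simp
    then show "q = q'" using chart_inj[OF N_smooth cd(1)] q by (auto simp: Q_def inj_on_def)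
  qed
  let ?e = "(Q, \<phi>)"
  have cpe: "cpoint ?e x = cpoint d (gi x)" if "x \<in> W" for x
  proof -
    have "cpoint d (gi x) \<in> Q" "\<phi> (cpoint d (gi x)) = x" using gi[OF that] cpQ[of "gi x"] by (auto simp: \<phi>_def)
    then have "inv_into Q \<phi> x = cpoint d (gi x)" by (rule inv_into_f_eq[OF \<phi>_inj])
    then show ?thesis by (simp add: cpoint_def[of ?e])
  qed
  have gW: "smooth_on (model N) W gi" by (rule smooth_on_subset[OF D'(5) W(3)])
  have im: "\<phi> ` (Q \<inter> fst c) = W \<inter> gi -` (snd d ` (fst d \<inter> fst c))" for c :: "('m, 'e) chart"
  proof (intro set_eqI iffI)
    fix x assume "x \<in> \<phi> ` (Q \<inter> fst c)"
    then obtain q where q: "q \<in> Q" "q \<in> fst c" "x = \<phi> q" by blast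
    then have "gi x = snd d q" using D'(6)[of "snd d q"] D2D(2) by (auto simp: \<phi>_def Q_def)
    then show "x \<in> W \<inter> gi -` (snd d ` (fst d \<inter> fst c))" using q \<phi>Q Qd by auto
  next
    fix x assume x: "x \<in> W \<inter> gi -` (snd d ` (fst d \<inter> fst c))"
    then obtain q where q: "q \<in> fst d" "q \<in> fst c" "gi x = snd d q" by auto
    then have "q \<in> Q" using gi(1)[of x] x by (auto simp: Q_def)
    moreover have "\<phi> q = x" using gi(2)[of x] x q(3) by (simp add: \<phi>_def)
    ultimately show "x \<in> \<phi> ` (Q \<inter> fst c)" using q by blast
  qed
  have gN: "gi x \<in> model N" if "x \<in> W" for x
    using gi(1)[OF that] D2D(1) rel_open_subset[OF D] by blast
  have op: "rel_open (model N) (\<phi> ` (Q \<inter> fst c))" if c: "c \<in> charts N" for c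
  proof -
    have "openin (top_of_set W) (W \<inter> gi -` (snd d ` (fst d \<inter> fst c)))"
      by (rule continuous_openin_preimage[OF smooth_on_continuous[OF gW], of "model N"])
        (use gN chart_image_open[OF N_smooth cd(1) chart_openin[OF N_smooth c]] in auto)
    then show ?thesis unfolding im using W(1) openin_trans by blast
  qed
  have "?e \<in> charts N"
  proof (rule chart_intro[OF N_smooth Q _ \<phi>_inj])
    show "openin (top_of_set (model N)) (\<phi> ` Q)" unfolding \<phi>Q using W(1) by blast
    fix c assume c: "c \<in> charts N"
    show "openin (top_of_set (model N)) (\<phi> ` (Q \<inter> fst c))" using op[OF c] by blast
    have "smooth_on (model N) (snd c ` (fst c \<inter> Q)) (\<lambda>y. \<tau> (snd d (cpoint c y)))"
    proof (rule smooth_on_compose[OF chart_image_open[OF N_smooth c Q] D _ _ \<tau>])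
      show "(\<lambda>y. snd d (cpoint c y)) ` (snd c ` (fst c \<inter> Q)) \<subseteq> D"
        using cpoint_chart[OF N_smooth c] D2D(1) by (auto simp: Q_def)
      show "smooth_on (model N) (snd c ` (fst c \<inter> Q)) (\<lambda>y. snd d (cpoint c y))"
        by (rule smooth_on_subset[OF transition_smooth[OF N_smooth c cd(1)]]) (use Qd in auto)
    qed
    then show "smooth_on (model N) (snd c ` (fst c \<inter> Q)) (\<lambda>y. \<phi> (cpoint c y))" by (simp add: \<phi>_def)
    have "smooth_on (model N) (\<phi> ` (Q \<inter> fst c)) (\<lambda>x. snd c (cpoint d (gi x)))"
    proof (rule smooth_on_compose[where f = gi and g = "\<lambda>x. snd c (cpoint d x)", OF op[OF c] chart_image_open[OF N_smooth cd(1) chart_openin[OF N_smooth c]]])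
      show "gi ` (\<phi> ` (Q \<inter> fst c)) \<subseteq> snd d ` (fst d \<inter> fst c)" unfolding im by auto
      show "smooth_on (model N) (\<phi> ` (Q \<inter> fst c)) gi" by (rule smooth_on_subset[OF gW]) (auto simp: im)
      show "smooth_on (model N) (snd d ` (fst d \<inter> fst c)) (\<lambda>x. snd c (cpoint d x))"
        by (rule transition_smooth[OF N_smooth cd(1) c])
    qed
    then show "smooth_on (model N) (\<phi> ` (Q \<inter> fst c)) (\<lambda>x. snd c (cpoint ?e x))"
      by (rule smooth_on_cong[THEN iffD1, rotated]) (use cpe im in auto)
  qed
  moreover have pQ: "p \<in> Q" using cd(2) D'(3) \<tau>0 W(4) by (auto simp: Q_def D2_def y0_def)
  ultimately have e: "?e \<in> charts_at N p" by (simp add: charts_at_def)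
  show ?thesis
  proof (rule that[OF e])
    show "snd ?e p = 0" using \<tau>0 by (simp add: \<phi>_def y0_def)
    show "fst ?e \<subseteq> fst m \<inter> V"
    proof
      fix q assume "q \<in> fst ?e"
      then have "q \<in> fst d" "snd d q \<in> D" using D2D(1) by (auto simp: Q_def)
      then show "q \<in> fst m \<inter> V" using cp by (auto simp: D_def dest!: arg_cong[where f = "cpoint d"])
    qed
    show "convex (snd ?e ` fst ?e)" using W(2) \<phi>Q by simp
    show "bounded_linear B" "B v \<in> model N" for v by (rule B_bl B_in)+
    show "B (snd m (cpoint ?e x)) = x" if "x \<in> snd ?e ` fst ?e" for x
      using that gi(2)[of x] cpe[of x] \<phi>Q by (simp add: \<tau>_def f_def)
    show "B (I a) = 0" if "a \<in> model M" "B a = 0" for a by (rule B_I[OF that])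
    show "g a (dir_deriv (\<lambda>x. snd m (cpoint ?e x)) w 0) = 0" if a: "a \<in> model M" "B a = 0" and w: "w \<in> model N" for a w
    proof -
      have g0: "gi 0 = y0" using D'(6)[OF D'(3)] \<tau>0 by simp
      have gD: "gi ` W \<subseteq> D" using gi D2D by auto
      note dg = smooth_on_differentiable[OF W(1) gW W(4)]
      have "dir_deriv (\<lambda>x. snd m (cpoint ?e x)) w 0 = dir_deriv (\<lambda>x. f (gi x)) w 0"
        by (rule dir_deriv_cong[OF W(1) W(4) w]) (simp add: cpe f_def)
      also have "\<dots> = A (dir_deriv gi w 0)"
        unfolding A_def using dir_deriv_chain[OF W(1) D W(4) w gD dg, of f] smooth_on_differentiable[OF D f y0] g0 by simp
      also have "g a \<dots> = 0"
        by (rule B_zero[OF a]) (rule dir_deriv_in[OF W(1,4) w dg EN], use gN in auto)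
      finally show ?thesis .
    qed
  qed
qed

text \<open>The core is that F, the submanifold in the normal chart of M, is linear. Then
  \<open>knc\<close> on the tangent space of N is the inverse of the chart \<open>e\<close>, and the
  potential of M restricts to one of N with the right Taylor series.\<close>

theorem normal_coordinates_restrict:
  assumes TG: "totally_geodesic N M" and pN: "p \<in> topspace (mtop N)" and knc: "kaehler_normal_coordinates M p knc"
  shows "kaehler_normal_coordinates Ni p (\<lambda>X. knc (incl_differential N M p X))"
proof -
  have pM: "p \<in> topspace (mtop M)" using pN N_sub by blast
  obtain W V \<theta> where anch: "anchored_coordinates M p W knc" and hol: "holomorphic_coordinates M p W knc"
    and pot: "local_potential M V \<theta>" and pV: "p \<in> V"
    and taylor: "(\<lambda>n X. taylor_series (\<lambda>X. \<theta> (knc X)) n X - (if n = 2 then metr M p X X else 0)) \<in> Sym_ge22 M p"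
    using knc unfolding kaehler_normal_coordinates_def by blast
  obtain m where m: "m \<in> charts_at M p" and m0: "snd m p = 0"
    and W: "W = {X \<in> tangent_space M p. X m \<in> snd m ` fst m}" and km: "\<And>X. X \<in> W \<Longrightarrow> knc X = cpoint m (X m)"
    by (rule chart_from_anchored[OF M_smooth pM anch]) (rule that)
  have k: "knc X = cpoint m (X m)" if "X \<in> tangent_space M p" "X m \<in> snd m ` fst m" for X
    using km that W by blast
  note cm = charts_atD[OF M_smooth m]
  have V: "openin (mtop M) V" using pot by (simp add: local_potential_def)
  define I where "I = acs_coef M m 0"
  have const: "acs_coef M m x u = I u" if "x \<in> snd m ` fst m" "u \<in> model M" for x u
    using holomorphic_coordinates_constant[OF K m W km hol that] by (simp add: I_def m0)
  have "kaehler_chart (model M) (snd m ` (fst m \<inter> V)) (metr_coef M m) (acs_coef M m 0) (christoffel M m)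
      (\<lambda>x. complex_of_real (\<theta> (cpoint m x)))"
    by (rule kaehler_chart_at[OF K m m0 _ k pot pV taylor]) (use const in \<open>auto simp: I_def\<close>)
  then interpret A: kaehler_chart "model M" "snd m ` (fst m \<inter> V)" "metr_coef M m" I "christoffel M m"
      "\<lambda>x. complex_of_real (\<theta> (cpoint m x))" by (simp only: I_def)
  obtain e B where e: "e \<in> charts_at N p" and e0: "snd e p = 0" and e_sub: "fst e \<subseteq> fst m \<inter> V"
    and e_conv: "convex (snd e ` fst e)" and B_bl: "bounded_linear B" and B_in: "\<And>v. B v \<in> model N"
    and BF: "\<And>x. x \<in> snd e ` fst e \<Longrightarrow> B (snd m (cpoint e x)) = x"
    and B_orth: "\<And>a w. a \<in> model M \<Longrightarrow> B a = 0 \<Longrightarrow> w \<in> model N \<Longrightarrow> metr_coef M m 0 a (dir_deriv (\<lambda>x. snd m (cpoint e x)) w 0) = 0"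
    and B_I: "\<And>a. a \<in> model M \<Longrightarrow> B a = 0 \<Longrightarrow> B (I a) = 0"
    by (rule adapted_chart[OF m m0 pN V pV, folded I_def]) (rule that)
  note ce = charts_atD[OF N_smooth e]
  define F where "F x = snd m (cpoint e x)" for x
  let ?D = "snd e ` fst e"
  have eq_em: "fst e \<inter> fst m = fst e" using e_sub by blast
  have D: "rel_open (model N) ?D" by (rule chart_rel_open[OF N_smooth ce(1)])
  have D0: "0 \<in> ?D" using e0 ce(2) by force
  have F: "smooth_on (model N) ?D F" using inclusion_smooth[OF ce(1) cm(1)] by (simp add: eq_em F_def[abs_def])
  have F_in: "F ` ?D \<subseteq> snd m ` (fst m \<inter> V)"
    using e_sub cpoint_chart[OF N_smooth ce(1)] by (auto simp: F_def)
  have cp0: "cpoint e 0 = p" using cpoint_chart[OF N_smooth ce] e0 by simp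
  have F0: "F 0 = 0" by (simp add: F_def cp0 m0)
  note P = inclusion_point[OF cm(1) ce(1), unfolded eq_em]
  note DF_in = inclusion_model[OF cm(1) ce(1), unfolded eq_em, folded F_def[abs_def]]
  note DF_inj = inclusion_immersion[OF cm(1) ce(1), unfolded eq_em, folded F_def[abs_def]]
  note dF = smooth_on_differentiable[OF D F]
  have Fm: "F x \<in> snd m ` fst m" if "x \<in> ?D" for x using F_in that by blast
  have B_lin: "linear B" using B_bl by (rule bounded_linear.linear)
  \<comment> \<open>Differentiates the graph condition B (F x) = x: the differentials of F at
    different points differ only by vectors in the kernel of \<open>B\<close>.\<close>
  have BDF: "B (dir_deriv F w x) = w" if x: "x \<in> ?D" and w: "w \<in> model N" for x w
  proof -
    have "B (dir_deriv F w x) = dir_deriv (\<lambda>x. B (F x)) w x"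
      by (rule dir_deriv_linear_comp[OF B_bl D x w dF[OF x], symmetric])
    also have "\<dots> = dir_deriv (\<lambda>x. x) w x" by (rule dir_deriv_cong[OF D x w]) (simp add: BF F_def)
    finally show ?thesis by (simp add: dir_deriv_linear_map bounded_linear_ident)
  qed
  define J where "J = acs_coef Ni e 0"
  note J_all = induced_acs_coef[OF cm(1) ce(1), unfolded eq_em, folded F_def]
  have J_all2: "dir_deriv F (acs_coef Ni e x w) x = I (dir_deriv F w x)" if "x \<in> ?D" "w \<in> model N" for x w
    using J_all(2)[OF that] const[OF Fm[OF that(1)] DF_in[OF that]] by (simp add: F_def[abs_def])
  \<comment> \<open>The structure of N at x is w \<mapsto> B (I (dF_x w)). Changing x alters dF_x w
    by an element of the I-invariant kernel of \<open>B\<close>, so the result does not depend on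
    x.\<close>
  have J_const: "acs_coef Ni e x w = J w" if x: "x \<in> ?D" and w: "w \<in> model N" for x w
  proof -
    have "acs_coef Ni e x w = B (I (dir_deriv F w x))" if "x \<in> ?D" for x
      using BDF[OF that J_all(1)[OF that w]] J_all2[OF that w] by simp
    moreover have "B (I (dir_deriv F w x)) = B (I (dir_deriv F w 0))"
    proof -
      note i = DF_in[OF x w] DF_in[OF D0 w]
      have "dir_deriv F w x - dir_deriv F w 0 \<in> model M" using i A.E by (auto intro: subspace_diff)
      moreover have "B (dir_deriv F w x - dir_deriv F w 0) = 0"
        using BDF[OF x w] BDF[OF D0 w] by (simp add: linear_diff[OF B_lin])
      ultimately have "B (I (dir_deriv F w x - dir_deriv F w 0)) = 0" by (rule B_I)
      moreover have "I (dir_deriv F w x - dir_deriv F w 0) = I (dir_deriv F w x) - I (dir_deriv F w 0)"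
        using A.I(3)[OF i(1), of "- dir_deriv F w 0"] A.I(6)[OF i(2)] i(2) A.E by (simp add: subspace_neg)
      ultimately show ?thesis by (simp add: linear_diff[OF B_lin])
    qed
    ultimately show ?thesis using x D0 by (simp add: J_def)
  qed
  have FJ: "dir_deriv F (J w) x = I (dir_deriv F w x)" if "x \<in> ?D" "w \<in> model N" for x w
    using J_all2[OF that] J_const[OF that] by simp
  note EN = model_subspace[OF N_smooth]
  have J_in: "J w \<in> model N" if "w \<in> model N" for w unfolding J_def by (rule J_all(1)[OF D0 that])
  \<comment> \<open>\<open>B\<close> inverts the differential of F at 0, so identities for
    \<open>J\<close> can be checked after applying that differential, where they become identities
    for \<open>I\<close>.\<close>
  have F_eq: "u = v" if "u \<in> model N" "v \<in> model N" "dir_deriv F u 0 = dir_deriv F v 0" for u v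
    using BDF[OF D0 that(1)] BDF[OF D0 that(2)] unfolding that(3) by (rule trans[OF sym])
  have csN: "complex_structure_on (model N) J"
    unfolding complex_structure_on_def
  proof (intro ballI conjI allI)
    fix u assume u: "u \<in> model N"
    show "J u \<in> model N" by (rule J_in[OF u])
    have mu: "- u \<in> model N" using u EN by (rule subspace_neg[rotated])
    show "J (J u) = - u"
      by (rule F_eq[OF J_in[OF J_in[OF u]] mu])
        (simp add: FJ D0 J_in u A.I(2)[OF DF_in[OF D0 u]] dir_deriv_linear(3)[OF D D0 dF[OF D0] u u])
    fix v a assume v: "v \<in> model N"
    have av: "a *\<^sub>R v \<in> model N" "a *\<^sub>R J v \<in> model N" "u + a *\<^sub>R v \<in> model N" "J u + a *\<^sub>R J v \<in> model N"
      using u v J_in EN by (auto intro: subspace_add subspace_mul)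
    note l = dir_deriv_linear[OF D D0 dF[OF D0]]
    have aI: "a *\<^sub>R dir_deriv F v 0 \<in> model M" using DF_in[OF D0 v] A.E by (auto intro: subspace_mul)
    show "J (u + a *\<^sub>R v) = J u + a *\<^sub>R J v"
    proof (rule F_eq[OF J_in[OF av(3)] av(4)])
      show "dir_deriv F (J (u + a *\<^sub>R v)) 0 = dir_deriv F (J u + a *\<^sub>R J v) 0"
        unfolding FJ[OF D0 av(3)] l(1)[OF u av(1)] l(2)[OF v v] l(1)[OF J_in[OF u] av(2)] l(2)[OF J_in[OF v] J_in[OF v]]
          FJ[OF D0 u] FJ[OF D0 v] A.I(3)[OF DF_in[OF D0 u] aI] A.I(5)[OF DF_in[OF D0 v]] ..
    qed
  qed
  interpret S: kaehler_chart_map "model M" "snd m ` (fst m \<inter> V)" "metr_coef M m" I "christoffel M m"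
    "\<lambda>x. complex_of_real (\<theta> (cpoint m x))" "model N" ?D J F
  proof
    show "rel_open (model N) ?D" "0 \<in> ?D" "convex ?D" "complex_structure_on (model N) J" "smooth_on (model N) ?D F"
      "F ` ?D \<subseteq> snd m ` (fst m \<inter> V)" "F 0 = 0"
      by (rule D D0 e_conv csN F F_in F0)+
    fix x w assume x: "x \<in> ?D" and w: "w \<in> model N"
    show "dir_deriv F (J w) x = I (dir_deriv F w x)" by (rule FJ[OF x w])
    show "w = 0" if "dir_deriv F w x = 0" by (rule DF_inj[OF x w that])
    show "\<exists>z\<in>model N. dir_deriv (dir_deriv F w) u x + christoffel M m (F x) (dir_deriv F u x) (dir_deriv F w x) = dir_deriv F z x"
      if u: "u \<in> model N" for u
      using TG[unfolded totally_geodesic_def, rule_format, OF ce(1) cm(1), unfolded eq_em, OF x u w]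
      by (simp add: Let_def cov_deriv_along_def F_def[abs_def])
  qed
  have F_linear: "F x = dir_deriv F x 0" if x: "x \<in> ?D" for x
  proof -
    have xN: "x \<in> model N" using x rel_open_subset[OF D] by blast
    have Fx: "F x \<in> model M" using Fm[OF x] snd_in_model[OF M_smooth cm(1)] by auto
    \<comment> \<open>The deviation from linearity, a constant normal vector once x is fixed. It
      lies in the kernel of \<open>B\<close>, so it is orthogonal to the tangent space; the normal
      component theorem makes it orthogonal to F x as well, hence to itself.\<close>
    define n where "n = F x - dir_deriv F x 0"
    have n: "n \<in> model M" unfolding n_def using Fx DF_in[OF D0 xN] A.E by (auto intro: subspace_diff)
    have "B n = 0" using BF[OF x] BDF[OF D0 xN] by (simp add: n_def linear_diff[OF B_lin] F_def)
    then have o: "metr_coef M m 0 n (dir_deriv F w 0) = 0" if "w \<in> model N" for w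
      using B_orth[OF n _ that] by (simp add: F_def[abs_def])
    have o': "metr_coef M m 0 (dir_deriv F w 0) n = 0" if "w \<in> model N" for w
      using o[OF that] A.g_sym[OF A.U0 n DF_in[OF D0 that]] by simp
    have "A.h 0 (F x) n = 0" by (rule S.normal_component_zero[OF x n o'])
    then have "Re (A.h 0 (F x) n) = 0" by simp
    then have "metr_coef M m 0 (F x) n = 0" by (simp add: A.h_def)
    then have "metr_coef M m 0 n n = 0"
      using A.g_simps(9)[OF A.U0 Fx DF_in[OF D0 xN] n] o'[OF xN] by (simp add: n_def)
    then have "n = 0" using A.g_pos[OF A.U0 n] by force
    then show ?thesis by (simp add: n_def)
  qed
  let ?k = "\<lambda>X. knc (incl_differential N M p X)"
  have incl_eq: "incl_differential N M p X = cvec M m p (dir_deriv F (X e) 0)" if X: "X \<in> tangent_space N p" for X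
    using incl_differential_eq[OF X e m] e0 by (simp add: F_def[abs_def])
  \<comment> \<open>By linearity of F the included tangent vector has the coordinates F (X e) in the
    normal chart, so both charts name the same point.\<close>
  have kN: "?k X = cpoint e (X e)" if X: "X \<in> tangent_space N p" and Xe: "X e \<in> ?D" for X
  proof -
    have XN: "X e \<in> model N" by (rule tangentD(1)[OF N_smooth X e])
    have "incl_differential N M p X m = F (X e)"
      unfolding incl_eq[OF X] F_linear[OF Xe] by (rule cvec_self[OF M_smooth m DF_in[OF D0 XN]])
    then have "?k X = cpoint m (F (X e))"
      using k[OF incl_tangent[OF X e]] Fm[OF Xe] by simp
    then show ?thesis using P(4)[OF Xe] by (simp add: F_def)
  qed
  let ?W = "{X \<in> tangent_space N p. X e \<in> ?D}"
  have "anchored_coordinates Ni p ?W ?k"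
    unfolding induced_anchored by (rule anchored_from_chart[where k = ?k, OF N_smooth e e0 kN])
  moreover have "holomorphic_coordinates Ni p ?W ?k"
    unfolding holomorphic_coordinates_def induced_simps
  proof (intro ballI)
    fix X Y assume X: "X \<in> ?W" and Y: "Y \<in> tangent_space N p"
    let ?x = "X e"
    have x: "?x \<in> ?D" and XT: "X \<in> tangent_space N p" using X by auto
    note Q = P(1)[OF x]
    have kX: "?k X = cpoint e ?x" by (rule kN[OF XT x])
    have vel: "velocity N (\<lambda>t. ?k (tadd X (tscale t Y))) = cvec N e (cpoint e ?x) (Y e)"
      if Y: "Y \<in> tangent_space N p" for Y
    proof -
      have Ye: "Y e \<in> model N" using tangentD(1)[OF N_smooth Y e] .
      have "\<forall>\<^sub>F t in nhds 0. ?x + t *\<^sub>R Y e \<in> ?D"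
        by (rule eventually_line[OF D x Ye])
      then have "\<forall>\<^sub>F t in nhds 0. ?k (tadd X (tscale t Y)) = chart_line e (cpoint e ?x) (Y e) t"
      proof eventually_elim
        case (elim t)
        have c: "tadd X (tscale t Y) e = ?x + t *\<^sub>R Y e" by (simp add: tadd_def tscale_def)
        have t: "tadd X (tscale t Y) \<in> tangent_space N p"
          using tangent_add_scale(1)[OF N_smooth pN XT tangent_add_scale(2)[OF N_smooth pN Y Y]] .
        show ?case using kN[OF t] elim unfolding c by (simp add: chart_line_def P(3)[OF x])
      qed
      from velocity_cong[where M = N, OF this] show ?thesis by (simp add: cvec_def)
    qed
    have Ye: "Y e \<in> model N" by (rule tangentD(1)[OF N_smooth Y e])
    note AY = induced_acs(1)[OF pN Y]
    have "acs Ni p Y e = acs_coef Ni e 0 (Y e)"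
      using tangentD(2)[OF N_smooth Y e] by (simp add: acs_coef_def cp0)
    then have AYe: "acs Ni p Y e = acs_coef Ni e ?x (Y e)" using J_const[OF x Ye] by (simp add: J_def)
    show "velocity N (\<lambda>t. ?k (tadd X (tscale t (acs Ni p Y))))
        = acs Ni (?k X) (velocity N (\<lambda>t. ?k (tadd X (tscale t Y))))"
      unfolding vel[OF Y] vel[OF AY] kX AYe by (rule J_all(3)[OF x Ye, symmetric])
  qed
  moreover have "local_potential Ni {q \<in> topspace (mtop N). q \<in> V \<inter> fst m} \<theta>"
    by (rule induced_potential[OF cm(1) const A.cs pot])
  moreover have "p \<in> {q \<in> topspace (mtop N). q \<in> V \<inter> fst m}" using pN pV cm(2) by blast
  moreover have "(\<lambda>n X. taylor_series (\<lambda>X. \<theta> (?k X)) n X - (if n = 2 then metr Ni p X X else 0)) \<in> Sym_ge22 Ni p"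
  proof -
    \<comment> \<open>The differential of the inclusion commutes with scaling, so the Taylor
      components along a line in the tangent space of N are those of M along the included
      line.\<close>
    have eq: "taylor_series (\<lambda>X. \<theta> (?k X)) n X - (if n = 2 then metr Ni p X X else 0)
      = taylor_series (\<lambda>X. \<theta> (knc X)) n (incl_differential N M p X)
        - (if n = 2 then metr M p (incl_differential N M p X) (incl_differential N M p X) else 0)"
      if X: "X \<in> tangent_space N p" for n X
      unfolding taylor_series_def using incl_linear(2)[OF X X e] by simp
    have "(\<lambda>n X. taylor_series (\<lambda>X. \<theta> (knc X)) n (incl_differential N M p X)
        - (if n = 2 then metr M p (incl_differential N M p X) (incl_differential N M p X) else 0)) \<in> Sym_ge22 Ni p"
      by (rule induced_Sym_ge22[OF pN taylor])
    then show ?thesis unfolding Sym_ge22_def mem_Collect_eq by (simp only: induced_simps(7) eq cong: ball_cong)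
  qed
  ultimately show ?thesis unfolding kaehler_normal_coordinates_def by blast
qed

end

theorem corollary4p9:
  fixes M :: "('m, 'e::euclidean_space) hermitian_structure"
    and N :: "('m, 'e) smooth_structure"
    and p :: 'm
    and knc :: "('m, 'e) tvec \<Rightarrow> 'm"
  assumes "kaehler_manifold M"
    and "real_analytic_metric M"
    and "complex_submanifold N M"
    and "totally_geodesic N M"
    and "p \<in> topspace (mtop N)"
    and "kaehler_normal_coordinates M p knc"
  shows "kaehler_normal_coordinates (induced_structure N M) p
           (\<lambda>X. knc (incl_differential N M p X))"
proof -
  interpret kaehler_submanifold M N using assms(1,3) by unfold_locales
  show ?thesis by (rule normal_coordinates_restrict[OF assms(4,5,6)])
qed

end
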